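(* Let $K$ be a large perfect field. Then every existentially definable subset of $K^m$ (for any $m$) is an \'ez subset of $K^m$. In particular, every existentially definable subset of $K$ is the union of a definable \'etale open subset of $K$ and a finite set.
   Context: $K$ is large if every $K$-curve with a smooth $K$-point has infinitely many $K$-points. A $K$-variety is a separated reduced $K$-scheme of finite type. For a $K$-variety $V$, an \'etale image in $V(K)$ is the image of $X(K)\to V(K)$ for an \'etale morphism $X \to V$ of $K$-varieties; these form a basis for the \'etale open topology on $V(K)$; here $K^m=\mathbb{A}^m(K)$. A Zariski closed subset $V'(K)$ ($V'$ a closed subvariety) carries the \'etale open topology of $V'(K)$. Definable means first-order definable in the language of rings with parameters from $K$; existentially definable means definable by a formula $\exists y\,\phi(x,y)$ with $\phi$ quantifier-free (with parameters). An \'ez subset of $K^m$ is a finite union of definable sets each of which is an \'etale open subset of a Zariski closed subset of $K^m$. *)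

theory Defs
  imports
    "HOL-Library.Poly_Mapping"
    "HOL-Analysis.Abstract_Topology"
    "HOL-Decision_Procs.Algebra_Aux"
    "HOL-Algebra.QuotRing"
begin

section \<open>Polynomial rings in finitely many variables\<close>

text \<open>
  Polynomials over a ring record are finitely supported functions from monomials
  to coefficients.  The field \<open>K\<close> is a type \<open>'k\<close> of class \<open>field\<close>, seen as a ring
  record through \<^const>\<open>cring_class_ops\<close>.
\<close>

type_synonym monom = "nat \<Rightarrow>\<^sub>0 nat"

definition mpoly_ring :: "('a, 'b) ring_scheme \<Rightarrow> nat \<Rightarrow> (monom \<Rightarrow> 'a) ring" where
  "mpoly_ring R n =
    \<lparr>carrier = {p. (\<forall>\<alpha>. p \<alpha> \<in> carrier R) \<and> finite {\<alpha>. p \<alpha> \<noteq> \<zero>\<^bsub>R\<^esub>} \<and>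
        (\<forall>\<alpha>. p \<alpha> \<noteq> \<zero>\<^bsub>R\<^esub> \<longrightarrow> Poly_Mapping.keys \<alpha> \<subseteq> {..<n})},
     monoid.mult = (\<lambda>p q \<gamma>. \<Oplus>\<^bsub>R\<^esub>\<alpha>\<in>{\<alpha>. \<exists>\<beta>. \<alpha> + \<beta> = \<gamma>}. p \<alpha> \<otimes>\<^bsub>R\<^esub> q (\<gamma> - \<alpha>)),
     one = (\<lambda>\<alpha>. if \<alpha> = 0 then \<one>\<^bsub>R\<^esub> else \<zero>\<^bsub>R\<^esub>),
     zero = (\<lambda>\<alpha>. \<zero>\<^bsub>R\<^esub>),
     add = (\<lambda>p q \<alpha>. p \<alpha> \<oplus>\<^bsub>R\<^esub> q \<alpha>)\<rparr>"

definition mpoly_const :: "('a, 'b) ring_scheme \<Rightarrow> 'a \<Rightarrow> monom \<Rightarrow> 'a" where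
  "mpoly_const R c = (\<lambda>\<alpha>. if \<alpha> = 0 then c else \<zero>\<^bsub>R\<^esub>)"

text \<open>The value of \<open>p\<close> in the \<open>R\<close>-algebra \<open>h : R \<rightarrow> S\<close> at the tuple \<open>b\<close>.\<close>

definition mpoly_eval ::
  "('a, 'b) ring_scheme \<Rightarrow> ('c, 'd) ring_scheme \<Rightarrow> ('a \<Rightarrow> 'c) \<Rightarrow> (nat \<Rightarrow> 'c) \<Rightarrow> (monom \<Rightarrow> 'a) \<Rightarrow> 'c" where
  "mpoly_eval R S h b p =
    (\<Oplus>\<^bsub>S\<^esub>\<alpha>\<in>{\<alpha>. p \<alpha> \<noteq> \<zero>\<^bsub>R\<^esub>}.
      h (p \<alpha>) \<otimes>\<^bsub>S\<^esub> (\<Otimes>\<^bsub>S\<^esub>i\<in>Poly_Mapping.keys \<alpha>. b i [^]\<^bsub>S\<^esub> Poly_Mapping.lookup \<alpha> i))"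

definition mpoly_pderiv :: "('a, 'b) ring_scheme \<Rightarrow> nat \<Rightarrow> (monom \<Rightarrow> 'a) \<Rightarrow> monom \<Rightarrow> 'a" where
  "mpoly_pderiv R i p = (\<lambda>\<alpha>. add_pow R (Poly_Mapping.lookup \<alpha> i + 1) (p (\<alpha> + Poly_Mapping.single i 1)))"

definition invertible_matrix :: "('a, 'b) ring_scheme \<Rightarrow> nat \<Rightarrow> (nat \<Rightarrow> nat \<Rightarrow> 'a) \<Rightarrow> bool" where
  "invertible_matrix R n M \<longleftrightarrow>
    (\<exists>N. (\<forall>i<n. \<forall>j<n. N i j \<in> carrier R) \<and>
      (\<forall>i<n. \<forall>j<n.
        (\<Oplus>\<^bsub>R\<^esub>k\<in>{..<n}. M i k \<otimes>\<^bsub>R\<^esub> N k j) = (if i = j then \<one>\<^bsub>R\<^esub> else \<zero>\<^bsub>R\<^esub>) \<and>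
        (\<Oplus>\<^bsub>R\<^esub>k\<in>{..<n}. N i k \<otimes>\<^bsub>R\<^esub> M k j) = (if i = j then \<one>\<^bsub>R\<^esub> else \<zero>\<^bsub>R\<^esub>)))"

text \<open>
  \<open>h : A \<rightarrow> B\<close> is standard smooth of relative dimension \<open>d\<close>: for some \<open>n\<close> there is a
  presentation \<open>B = A[x\<^sub>1,\<dots>,x\<^sub>n\<^sub>+\<^sub>d] / (f\<^sub>1,\<dots>,f\<^sub>n)\<close> in which the Jacobian matrix of
  \<open>f\<^sub>1,\<dots>,f\<^sub>n\<close> with respect to \<open>x\<^sub>1,\<dots>,x\<^sub>n\<close> is invertible over \<open>B\<close>.
\<close>

definition standard_smooth ::
  "('a, 'b) ring_scheme \<Rightarrow> ('c, 'd) ring_scheme \<Rightarrow> ('a \<Rightarrow> 'c) \<Rightarrow> nat \<Rightarrow> bool" where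
  "standard_smooth A B h d \<longleftrightarrow>
    (\<exists>n b f. (\<forall>i<n + d. b i \<in> carrier B) \<and>
      (\<forall>i<n. f i \<in> carrier (mpoly_ring A (n + d))) \<and>
      mpoly_eval A B h b ` carrier (mpoly_ring A (n + d)) = carrier B \<and>
      {p \<in> carrier (mpoly_ring A (n + d)). mpoly_eval A B h b p = \<zero>\<^bsub>B\<^esub>} =
        genideal (mpoly_ring A (n + d)) (f ` {..<n}) \<and>
      invertible_matrix B n (\<lambda>i j. mpoly_eval A B h b (mpoly_pderiv A j (f i))))"


section \<open>Spaces with a sheaf of \<open>K\<close>-algebras\<close>

text \<open>
  \<open>sect X U\<close> is the ring of sections over the open set \<open>U\<close>, \<open>rstr X U W\<close> the restriction
  from \<open>U\<close> to \<open>W \<subseteq> U\<close>, and \<open>scal X U\<close> the structure map from \<open>K\<close> to \<open>sect X U\<close>; only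
  their values on open sets matter.  For a scheme, a sheaf of \<open>K\<close>-algebras structure is
  the same as a morphism to \<open>Spec K\<close>.
\<close>

record ('p, 's, 'k) kspace =
  space_topology :: "'p topology"
  sect :: "'p set \<Rightarrow> 's ring"
  rstr :: "'p set \<Rightarrow> 'p set \<Rightarrow> 's \<Rightarrow> 's"
  scal :: "'p set \<Rightarrow> 'k \<Rightarrow> 's"

abbreviation kopen :: "('p, 's, 'k) kspace \<Rightarrow> 'p set \<Rightarrow> bool" where
  "kopen X U \<equiv> openin (space_topology X) U"

abbreviation kpts :: "('p, 's, 'k) kspace \<Rightarrow> 'p set" where
  "kpts X \<equiv> topspace (space_topology X)"

definition sheaf_of_algebras :: "('p, 's, 'k::field) kspace \<Rightarrow> bool" where
  "sheaf_of_algebras X \<longleftrightarrow>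
    (\<forall>U. kopen X U \<longrightarrow>
      cring (sect X U) \<and> scal X U \<in> ring_hom cring_class_ops (sect X U) \<and>
      (\<forall>s\<in>carrier (sect X U). rstr X U U s = s)) \<and>
    (\<forall>U W. kopen X U \<and> kopen X W \<and> W \<subseteq> U \<longrightarrow>
      rstr X U W \<in> ring_hom (sect X U) (sect X W) \<and>
      (\<forall>c. rstr X U W (scal X U c) = scal X W c)) \<and>
    (\<forall>U W T. kopen X U \<and> kopen X W \<and> kopen X T \<and> W \<subseteq> U \<and> T \<subseteq> W \<longrightarrow>
      (\<forall>s\<in>carrier (sect X U). rstr X W T (rstr X U W s) = rstr X U T s)) \<and>
    (\<forall>\<U> s. (\<forall>U\<in>\<U>. kopen X U \<and> s U \<in> carrier (sect X U)) \<and>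
      (\<forall>U\<in>\<U>. \<forall>W\<in>\<U>. rstr X U (U \<inter> W) (s U) = rstr X W (U \<inter> W) (s W)) \<longrightarrow>
      (\<exists>!t. t \<in> carrier (sect X (\<Union>\<U>)) \<and> (\<forall>U\<in>\<U>. rstr X (\<Union>\<U>) U t = s U)))"

definition restrict_kspace :: "('p, 's, 'k) kspace \<Rightarrow> 'p set \<Rightarrow> ('p, 's, 'k) kspace" where
  "restrict_kspace X U = X\<lparr>space_topology := subtopology (space_topology X) U\<rparr>"

text \<open>The germ at \<open>x\<close> of the section \<open>s\<close> over \<open>U\<close> is a unit of the stalk.\<close>

definition unit_at :: "('p, 's, 'k) kspace \<Rightarrow> 'p \<Rightarrow> 'p set \<Rightarrow> 's \<Rightarrow> bool" where
  "unit_at X x U s \<longleftrightarrow>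
    (\<exists>W. kopen X W \<and> x \<in> W \<and> W \<subseteq> U \<and> rstr X U W s \<in> Units (sect X W))"

definition preim :: "('p, 's, 'k) kspace \<Rightarrow> ('p \<Rightarrow> 'q) \<Rightarrow> 'q set \<Rightarrow> 'p set" where
  "preim X f V = {x \<in> kpts X. f x \<in> V}"

text \<open>
  A morphism over \<open>K\<close> is a continuous map \<open>f\<close> with pullbacks \<open>F V\<close> from the sections of
  \<open>Y\<close> over \<open>V\<close> to those of \<open>X\<close> over the preimage of \<open>V\<close>; the last clause says that the
  induced maps on stalks are local.
\<close>

definition kmorphism ::
  "('p, 's, 'k::field) kspace \<Rightarrow> ('q, 't, 'k) kspace \<Rightarrow> ('p \<Rightarrow> 'q) \<Rightarrow> ('q set \<Rightarrow> 't \<Rightarrow> 's) \<Rightarrow> bool" where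
  "kmorphism X Y f F \<longleftrightarrow>
    continuous_map (space_topology X) (space_topology Y) f \<and>
    (\<forall>V. kopen Y V \<longrightarrow>
      F V \<in> ring_hom (sect Y V) (sect X (preim X f V)) \<and>
      (\<forall>c. F V (scal Y V c) = scal X (preim X f V) c)) \<and>
    (\<forall>V W. kopen Y V \<and> kopen Y W \<and> W \<subseteq> V \<longrightarrow>
      (\<forall>s\<in>carrier (sect Y V).
        rstr X (preim X f V) (preim X f W) (F V s) = F W (rstr Y V W s))) \<and>
    (\<forall>x\<in>kpts X. \<forall>V. kopen Y V \<and> f x \<in> V \<longrightarrow>
      (\<forall>s\<in>carrier (sect Y V). unit_at X x (preim X f V) (F V s) \<longrightarrow> unit_at Y (f x) V s))"

definition kisomorphic ::
  "('p, 's, 'k::field) kspace \<Rightarrow> ('q, 't, 'k) kspace \<Rightarrow> bool" where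
  "kisomorphic X Y \<longleftrightarrow>
    (\<exists>f F. kmorphism X Y f F \<and>
      homeomorphic_map (space_topology X) (space_topology Y) f \<and>
      (\<forall>V. kopen Y V \<longrightarrow>
        bij_betw (F V) (carrier (sect Y V)) (carrier (sect X (preim X f V)))))"


section \<open>Affine schemes\<close>

definition zariski_open :: "('a, 'b) ring_scheme \<Rightarrow> 'a set set \<Rightarrow> bool" where
  "zariski_open R U \<longleftrightarrow> (\<exists>E\<subseteq>carrier R. U = {P. primeideal P R \<and> \<not> E \<subseteq> P})"

lemma istopology_zariski_open: "istopology (zariski_open R)"
  unfolding istopology_def
proof (intro conjI allI impI)
  fix S T
  assume "zariski_open R S" "zariski_open R T"
  then obtain E F where E: "E \<subseteq> carrier R" "S = {P. primeideal P R \<and> \<not> E \<subseteq> P}"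
    and F: "F \<subseteq> carrier R" "T = {P. primeideal P R \<and> \<not> F \<subseteq> P}"
    unfolding zariski_open_def by blast
  let ?G = "{c \<in> carrier R. \<exists>e\<in>E. \<exists>f\<in>F. c = e \<otimes>\<^bsub>R\<^esub> f}"
  have "S \<inter> T = {P. primeideal P R \<and> \<not> ?G \<subseteq> P}"
  proof (intro equalityI subsetI)
    fix P assume "P \<in> S \<inter> T"
    then have P: "primeideal P R" and "\<not> E \<subseteq> P" "\<not> F \<subseteq> P" using E F by auto
    then obtain e f where ef: "e \<in> E" "e \<notin> P" "f \<in> F" "f \<notin> P" by blast
    interpret primeideal P R by (rule P)
    have "e \<in> carrier R" "f \<in> carrier R" using ef E F by auto
    then have "e \<otimes>\<^bsub>R\<^esub> f \<in> ?G" "e \<otimes>\<^bsub>R\<^esub> f \<notin> P" using ef I_prime by auto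
    with P show "P \<in> {P. primeideal P R \<and> \<not> ?G \<subseteq> P}" by blast
  next
    fix P assume "P \<in> {P. primeideal P R \<and> \<not> ?G \<subseteq> P}"
    then have P: "primeideal P R" and "\<not> ?G \<subseteq> P" by auto
    then obtain e f where ef: "e \<in> E" "f \<in> F" "e \<otimes>\<^bsub>R\<^esub> f \<notin> P" by blast
    interpret primeideal P R by (rule P)
    have "e \<in> carrier R" "f \<in> carrier R" using ef E F by auto
    then have "e \<notin> P" "f \<notin> P" using ef I_l_closed I_r_closed by auto
    then show "P \<in> S \<inter> T" using P E F ef by auto
  qed
  moreover have "?G \<subseteq> carrier R" by blast
  ultimately show "zariski_open R (S \<inter> T)" unfolding zariski_open_def by blast
next
  fix \<K> assume K: "\<forall>S\<in>\<K>. zariski_open R S"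
  let ?E = "\<Union>{E. E \<subseteq> carrier R \<and> {P. primeideal P R \<and> \<not> E \<subseteq> P} \<in> \<K>}"
  have "\<Union>\<K> = {P. primeideal P R \<and> \<not> ?E \<subseteq> P}"
  proof (intro equalityI subsetI)
    fix P assume "P \<in> \<Union>\<K>"
    then obtain S where S: "S \<in> \<K>" "P \<in> S" by blast
    then obtain E where E: "E \<subseteq> carrier R" "S = {P. primeideal P R \<and> \<not> E \<subseteq> P}"
      using K unfolding zariski_open_def by blast
    then have "E \<subseteq> ?E" using S(1) by blast
    then show "P \<in> {P. primeideal P R \<and> \<not> ?E \<subseteq> P}" using S(2) E(2) by blast
  next
    fix P assume "P \<in> {P. primeideal P R \<and> \<not> ?E \<subseteq> P}"
    then have P: "primeideal P R" and "\<not> ?E \<subseteq> P" by auto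
    then obtain E where "{P. primeideal P R \<and> \<not> E \<subseteq> P} \<in> \<K>" "\<not> E \<subseteq> P" by blast
    with P show "P \<in> \<Union>\<K>" by blast
  qed
  moreover have "?E \<subseteq> carrier R" by blast
  ultimately show "zariski_open R (\<Union>\<K>)" unfolding zariski_open_def by blast
qed

text \<open>The element \<open>a/s\<close> of the localization of \<open>R\<close> at \<open>P\<close>, as a class of pairs.\<close>

definition frac :: "('a, 'b) ring_scheme \<Rightarrow> 'a set \<Rightarrow> 'a \<Rightarrow> 'a \<Rightarrow> ('a \<times> 'a) set" where
  "frac R P a s =
    {(b, t). b \<in> carrier R \<and> t \<in> carrier R - P \<and>
      (\<exists>u\<in>carrier R - P. u \<otimes>\<^bsub>R\<^esub> (a \<otimes>\<^bsub>R\<^esub> t) = u \<otimes>\<^bsub>R\<^esub> (b \<otimes>\<^bsub>R\<^esub> s))}"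

definition frac_add ::
  "('a, 'b) ring_scheme \<Rightarrow> 'a set \<Rightarrow> ('a \<times> 'a) set \<Rightarrow> ('a \<times> 'a) set \<Rightarrow> ('a \<times> 'a) set" where
  "frac_add R P X Y =
    (\<Union>(a, s)\<in>X. \<Union>(b, t)\<in>Y. frac R P (a \<otimes>\<^bsub>R\<^esub> t \<oplus>\<^bsub>R\<^esub> b \<otimes>\<^bsub>R\<^esub> s) (s \<otimes>\<^bsub>R\<^esub> t))"

definition frac_mult ::
  "('a, 'b) ring_scheme \<Rightarrow> 'a set \<Rightarrow> ('a \<times> 'a) set \<Rightarrow> ('a \<times> 'a) set \<Rightarrow> ('a \<times> 'a) set" where
  "frac_mult R P X Y =
    (\<Union>(a, s)\<in>X. \<Union>(b, t)\<in>Y. frac R P (a \<otimes>\<^bsub>R\<^esub> b) (s \<otimes>\<^bsub>R\<^esub> t))"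

text \<open>
  Sections of the structure sheaf of \<open>Spec R\<close>: families of elements of the local rings
  which are locally given by one fraction.
\<close>

type_synonym 'a spec_section = "'a set \<Rightarrow> ('a \<times> 'a) set"

definition spec_sections :: "('a, 'b) ring_scheme \<Rightarrow> 'a set set \<Rightarrow> 'a spec_section set" where
  "spec_sections R U =
    {\<sigma> \<in> extensional U. \<forall>P\<in>U. \<exists>W a s. zariski_open R W \<and> P \<in> W \<and> W \<subseteq> U \<and>
      a \<in> carrier R \<and> s \<in> carrier R \<and> (\<forall>Q\<in>W. s \<notin> Q \<and> \<sigma> Q = frac R Q a s)}"

definition spec :: "('a, 'b) ring_scheme \<Rightarrow> ('k \<Rightarrow> 'a) \<Rightarrow> ('a set, 'a spec_section, 'k) kspace" where
  "spec R c =
    \<lparr>space_topology = topology (zariski_open R),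
     sect = (\<lambda>U. \<lparr>carrier = spec_sections R U,
       monoid.mult = (\<lambda>\<sigma> \<tau>. \<lambda>P\<in>U. frac_mult R P (\<sigma> P) (\<tau> P)),
       one = (\<lambda>P\<in>U. frac R P \<one>\<^bsub>R\<^esub> \<one>\<^bsub>R\<^esub>),
       zero = (\<lambda>P\<in>U. frac R P \<zero>\<^bsub>R\<^esub> \<one>\<^bsub>R\<^esub>),
       add = (\<lambda>\<sigma> \<tau>. \<lambda>P\<in>U. frac_add R P (\<sigma> P) (\<tau> P))\<rparr>),
     rstr = (\<lambda>U W \<sigma>. restrict \<sigma> W),
     scal = (\<lambda>U k. \<lambda>P\<in>U. frac R P (c k) \<one>\<^bsub>R\<^esub>)\<rparr>"

type_synonym 'k kpoly = "monom \<Rightarrow> 'k"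

abbreviation kpoly_ring :: "nat \<Rightarrow> ('k::field) kpoly ring" where
  "kpoly_ring n \<equiv> mpoly_ring cring_class_ops n"

text \<open>\<open>Spec K[x\<^sub>1,\<dots>,x\<^sub>n]/J\<close>, the closed subscheme of affine \<open>n\<close>-space defined by \<open>J\<close>.\<close>

definition closed_subscheme ::
  "nat \<Rightarrow> 'k kpoly set \<Rightarrow> ('k kpoly set set, ('k kpoly set) spec_section, 'k::field) kspace" where
  "closed_subscheme n J =
    spec (kpoly_ring n Quot J) (\<lambda>k. J +>\<^bsub>kpoly_ring n\<^esub> mpoly_const cring_class_ops k)"


section \<open>Varieties\<close>

text \<open>
  Open subschemes isomorphic to the spectrum of a finitely generated \<open>K\<close>-algebra.  In a
  scheme locally of finite type over \<open>K\<close> every affine open subscheme is of this form.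
\<close>

definition affine_open :: "('p, 's, 'k::field) kspace \<Rightarrow> 'p set \<Rightarrow> bool" where
  "affine_open X U \<longleftrightarrow> kopen X U \<and>
    (\<exists>n J. ideal J (kpoly_ring n) \<and> kisomorphic (restrict_kspace X U) (closed_subscheme n J))"

definition finite_type_scheme :: "('p, 's, 'k::field) kspace \<Rightarrow> bool" where
  "finite_type_scheme X \<longleftrightarrow> sheaf_of_algebras X \<and>
    (\<exists>\<U>. finite \<U> \<and> (\<forall>U\<in>\<U>. affine_open X U) \<and> \<Union>\<U> = kpts X)"

definition reduced_scheme :: "('p, 's, 'k) kspace \<Rightarrow> bool" where
  "reduced_scheme X \<longleftrightarrow>
    (\<forall>U s. kopen X U \<and> s \<in> carrier (sect X U) \<and>
      (\<exists>n::nat. s [^]\<^bsub>sect X U\<^esub> n = \<zero>\<^bsub>sect X U\<^esub>) \<longrightarrow> s = \<zero>\<^bsub>sect X U\<^esub>)"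

text \<open>
  The diagonal \<open>X \<rightarrow> X \<times> X\<close> is a closed immersion, checked on the affine open cover of
  \<open>X \<times> X\<close> by the products \<open>U \<times> W\<close>: over \<open>U \<times> W\<close> the diagonal is \<open>U \<inter> W \<rightarrow> U \<times> W\<close>, which
  is a closed immersion iff \<open>U \<inter> W\<close> is affine and the map from \<open>\<O>(U) \<otimes> \<O>(W)\<close> to
  \<open>\<O>(U \<inter> W)\<close> is surjective.
\<close>

definition separated_scheme :: "('p, 's, 'k::field) kspace \<Rightarrow> bool" where
  "separated_scheme X \<longleftrightarrow>
    (\<exists>\<U>. (\<forall>U\<in>\<U>. affine_open X U) \<and> \<Union>\<U> = kpts X \<and>
      (\<forall>U\<in>\<U>. \<forall>W\<in>\<U>. affine_open X (U \<inter> W) \<and>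
        (\<forall>s\<in>carrier (sect X (U \<inter> W)). \<exists>(n::nat) a b.
          (\<forall>i<n. a i \<in> carrier (sect X U) \<and> b i \<in> carrier (sect X W)) \<and>
          s = (\<Oplus>\<^bsub>sect X (U \<inter> W)\<^esub>i\<in>{..<n}.
                rstr X U (U \<inter> W) (a i) \<otimes>\<^bsub>sect X (U \<inter> W)\<^esub> rstr X W (U \<inter> W) (b i)))))"

definition kvariety :: "('p, 's, 'k::field) kspace \<Rightarrow> bool" where
  "kvariety X \<longleftrightarrow> finite_type_scheme X \<and> reduced_scheme X \<and> separated_scheme X"

text \<open>
  A morphism \<open>Spec K \<rightarrow> X\<close> over \<open>K\<close> is the same as a point with residue field \<open>K\<close>, i.e. a
  point at which every germ is congruent to a constant modulo the maximal ideal.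
\<close>

definition kpoints :: "('p, 's, 'k::field) kspace \<Rightarrow> 'p set" where
  "kpoints X = {x \<in> kpts X. \<forall>U s. kopen X U \<and> x \<in> U \<and> s \<in> carrier (sect X U) \<longrightarrow>
    (\<exists>c. \<not> unit_at X x U (s \<ominus>\<^bsub>sect X U\<^esub> scal X U c))}"

definition smooth_point :: "('p, 's, 'k::field) kspace \<Rightarrow> 'p \<Rightarrow> bool" where
  "smooth_point X x \<longleftrightarrow>
    (\<exists>U d. affine_open X U \<and> x \<in> U \<and> standard_smooth cring_class_ops (sect X U) (scal X U) d)"

definition etale_morphism ::
  "('p, 's, 'k::field) kspace \<Rightarrow> ('q, 't, 'k) kspace \<Rightarrow> ('p \<Rightarrow> 'q) \<Rightarrow> ('q set \<Rightarrow> 't \<Rightarrow> 's) \<Rightarrow> bool" where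
  "etale_morphism X V f F \<longleftrightarrow> kmorphism X V f F \<and>
    (\<forall>x\<in>kpts X. \<exists>U W. affine_open X U \<and> affine_open V W \<and> x \<in> U \<and> f ` U \<subseteq> W \<and>
      standard_smooth (sect V W) (sect X U) (\<lambda>s. rstr X (preim X f W) U (F W s)) 0)"

definition irreducible_closed :: "'p topology \<Rightarrow> 'p set \<Rightarrow> bool" where
  "irreducible_closed T Z \<longleftrightarrow> closedin T Z \<and> Z \<noteq> {} \<and>
    (\<forall>A B. closedin T A \<and> closedin T B \<and> Z \<subseteq> A \<union> B \<longrightarrow> Z \<subseteq> A \<or> Z \<subseteq> B)"

text \<open>
  Curves are purely one-dimensional varieties.  Without purity, the disjoint union of a
  curve without \<open>K\<close>-points and an isolated \<open>K\<close>-point would have to be admitted, and no field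
  over which a curve without \<open>K\<close>-points exists would be large.
\<close>

definition kcurve :: "('p, 's, 'k::field) kspace \<Rightarrow> bool" where
  "kcurve X \<longleftrightarrow> kvariety X \<and>
    (\<forall>Z. irreducible_closed (space_topology X) Z \<and>
        (\<forall>Z'. irreducible_closed (space_topology X) Z' \<and> Z \<subseteq> Z' \<longrightarrow> Z' = Z) \<longrightarrow>
      (\<exists>Z0. irreducible_closed (space_topology X) Z0 \<and> Z0 \<subset> Z) \<and>
      \<not> (\<exists>Z0 Z1. irreducible_closed (space_topology X) Z0 \<and>
            irreducible_closed (space_topology X) Z1 \<and> Z0 \<subset> Z1 \<and> Z1 \<subset> Z))"

text \<open>
  Quantification over all \<open>K\<close>-varieties is rendered by quantification over those whose
  points and sections are taken from the types below, where all \<^const>\<open>closed_subscheme\<close>s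
  live.  This loses nothing: a \<open>K\<close>-variety has at most \<open>max(|K|, \<aleph>\<^sub>0)\<close> points, and at most
  \<open>max(|K|, \<aleph>\<^sub>0)\<close> sections over each open set, and both types are at least that large, so
  every \<open>K\<close>-variety is isomorphic to one of this kind.
\<close>

type_synonym 'k small_kspace =
  "('k kpoly set set, ('k kpoly set) spec_section, 'k) kspace"


section \<open>Large and perfect fields\<close>

definition large_field :: "'k::field itself \<Rightarrow> bool" where
  "large_field _ \<longleftrightarrow>
    (\<forall>X :: 'k small_kspace. kcurve X \<and> (\<exists>x\<in>kpoints X. smooth_point X x) \<longrightarrow> infinite (kpoints X))"

definition perfect_field :: "'k::field itself \<Rightarrow> bool" where
  "perfect_field _ \<longleftrightarrow> CHAR('k) = 0 \<or> surj (\<lambda>x::'k. x ^ CHAR('k))"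


section \<open>The etale open topology\<close>

definition etale_image :: "('k kpoly set set, ('k kpoly set) spec_section, 'k::field) kspace \<Rightarrow>
    'k kpoly set set set \<Rightarrow> bool" where
  "etale_image V S \<longleftrightarrow>
    (\<exists>(X :: 'k small_kspace) f F. kvariety X \<and> etale_morphism X V f F \<and> S = f ` kpoints X)"

text \<open>The etale images form a basis of the topology, so its open sets are their unions.\<close>

definition etale_open :: "('k::field) small_kspace \<Rightarrow> 'k kpoly set set set \<Rightarrow> bool" where
  "etale_open V = arbitrary union_of etale_image V"

definition affine_points :: "nat \<Rightarrow> 'k list set" where
  "affine_points m = {a. length a = m}"

definition zero_locus :: "nat \<Rightarrow> ('k::field) kpoly set \<Rightarrow> 'k list set" where
  "zero_locus m J =
    {a \<in> affine_points m. \<forall>p\<in>J. mpoly_eval cring_class_ops cring_class_ops id (nth a) p = 0}"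

text \<open>
  The \<open>K\<close>-point of \<open>Spec K[x\<^sub>1,\<dots>,x\<^sub>m]/J\<close> corresponding to a zero \<open>a \<in> K\<^sup>m\<close> of \<open>J\<close>, i.e. the
  ideal of the classes of all polynomials vanishing at \<open>a\<close>.
\<close>

definition point_ideal :: "nat \<Rightarrow> 'k kpoly set \<Rightarrow> ('k::field) list \<Rightarrow> 'k kpoly set set" where
  "point_ideal m J a = {J +>\<^bsub>kpoly_ring m\<^esub> p | p.
    p \<in> carrier (kpoly_ring m) \<and> mpoly_eval cring_class_ops cring_class_ops id (nth a) p = 0}"

definition radical_ideal :: "'a set \<Rightarrow> ('a, 'b) ring_scheme \<Rightarrow> bool" where
  "radical_ideal J R \<longleftrightarrow> ideal J R \<and>
    (\<forall>p\<in>carrier R. \<forall>n::nat. p [^]\<^bsub>R\<^esub> n \<in> J \<longrightarrow> p \<in> J)"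

text \<open>
  Radical ideals \<open>J\<close> correspond to closed subvarieties \<open>V'\<close> of affine \<open>m\<close>-space, with
  \<open>V'(K)\<close> the zero locus of \<open>J\<close> in \<open>K\<^sup>m\<close>.
\<close>

definition etale_open_in :: "nat \<Rightarrow> ('k::field) kpoly set \<Rightarrow> 'k list set \<Rightarrow> bool" where
  "etale_open_in m J S \<longleftrightarrow>
    S \<subseteq> zero_locus m J \<and> etale_open (closed_subscheme m J) (point_ideal m J ` S)"


section \<open>Definable sets\<close>

datatype 'k rterm =
  RVar nat | RPar 'k | RAdd "'k rterm" "'k rterm" | RMul "'k rterm" "'k rterm" | RNeg "'k rterm"

datatype 'k rform =
  FEq "'k rterm" "'k rterm" | FNeg "'k rform" | FConj "'k rform" "'k rform" | FEx nat "'k rform"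

primrec rterm_val :: "(nat \<Rightarrow> 'k::field) \<Rightarrow> 'k rterm \<Rightarrow> 'k" where
  "rterm_val e (RVar i) = e i"
| "rterm_val e (RPar c) = c"
| "rterm_val e (RAdd s t) = rterm_val e s + rterm_val e t"
| "rterm_val e (RMul s t) = rterm_val e s * rterm_val e t"
| "rterm_val e (RNeg t) = - rterm_val e t"

primrec rterm_vars :: "'k rterm \<Rightarrow> nat set" where
  "rterm_vars (RVar i) = {i}"
| "rterm_vars (RPar c) = {}"
| "rterm_vars (RAdd s t) = rterm_vars s \<union> rterm_vars t"
| "rterm_vars (RMul s t) = rterm_vars s \<union> rterm_vars t"
| "rterm_vars (RNeg t) = rterm_vars t"

primrec rform_sat :: "(nat \<Rightarrow> 'k::field) \<Rightarrow> 'k rform \<Rightarrow> bool" where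
  "rform_sat e (FEq s t) \<longleftrightarrow> rterm_val e s = rterm_val e t"
| "rform_sat e (FNeg \<phi>) \<longleftrightarrow> \<not> rform_sat e \<phi>"
| "rform_sat e (FConj \<phi> \<psi>) \<longleftrightarrow> rform_sat e \<phi> \<and> rform_sat e \<psi>"
| "rform_sat e (FEx i \<phi>) \<longleftrightarrow> (\<exists>v. rform_sat (e(i := v)) \<phi>)"

primrec rform_free :: "'k rform \<Rightarrow> nat set" where
  "rform_free (FEq s t) = rterm_vars s \<union> rterm_vars t"
| "rform_free (FNeg \<phi>) = rform_free \<phi>"
| "rform_free (FConj \<phi> \<psi>) = rform_free \<phi> \<union> rform_free \<psi>"
| "rform_free (FEx i \<phi>) = rform_free \<phi> - {i}"

primrec quantifier_free :: "'k rform \<Rightarrow> bool" where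
  "quantifier_free (FEq s t) \<longleftrightarrow> True"
| "quantifier_free (FNeg \<phi>) \<longleftrightarrow> quantifier_free \<phi>"
| "quantifier_free (FConj \<phi> \<psi>) \<longleftrightarrow> quantifier_free \<phi> \<and> quantifier_free \<psi>"
| "quantifier_free (FEx i \<phi>) \<longleftrightarrow> False"

definition definable :: "nat \<Rightarrow> ('k::field) list set \<Rightarrow> bool" where
  "definable m S \<longleftrightarrow>
    (\<exists>\<phi>. rform_free \<phi> \<subseteq> {..<m} \<and> S = {a \<in> affine_points m. rform_sat (nth a) \<phi>})"

definition existentially_definable :: "nat \<Rightarrow> ('k::field) list set \<Rightarrow> bool" where
  "existentially_definable m S \<longleftrightarrow>
    (\<exists>n \<phi>. quantifier_free \<phi> \<and> rform_free \<phi> \<subseteq> {..<m + n} \<and>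
      S = {a \<in> affine_points m. \<exists>b\<in>affine_points n. rform_sat (nth (a @ b)) \<phi>})"

definition ez_set :: "nat \<Rightarrow> ('k::field) list set \<Rightarrow> bool" where
  "ez_set m S \<longleftrightarrow>
    (\<exists>\<T>. finite \<T> \<and> S = \<Union>\<T> \<and>
      (\<forall>T\<in>\<T>. definable m T \<and>
        (\<exists>J. radical_ideal J (kpoly_ring m) \<and> etale_open_in m J T)))"

text \<open>The affine line is the closed subscheme of affine \<open>1\<close>-space defined by the zero ideal.\<close>

abbreviation singletons :: "'k set \<Rightarrow> 'k list set" where
  "singletons S \<equiv> (\<lambda>x. [x]) ` S"

definition etale_open_line :: "('k::field) set \<Rightarrow> bool" where
  "etale_open_line S \<longleftrightarrow> etale_open_in 1 {\<zero>\<^bsub>kpoly_ring 1\<^esub>} (singletons S)"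

end

theory Submission
  imports Defs "HOL-Algebra.Algebraic_Closure_Type" "Jordan_Normal_Form.Determinant"
begin

text \<open>
  An existential formula is a finite disjunction of systems of polynomial equations with one
  inequation. The quantified coordinates are eliminated one at a time: pseudo-division lowers the
  degrees until a single equation \<open>f = 0\<close> is left, and division by \<open>f'\<close> makes its root simple; if
  \<open>f' = 0\<close>, then \<open>f\<close> is a polynomial in \<open>X\<^sup>p\<close>, and perfectness allows replacing \<open>X\<^sup>p\<close> by
  \<open>X\<close>. The set
  thus becomes a finite union of projections of towers over closed subvarieties \<open>V\<close> in which every new
  coordinate is either free or a simple root of a polynomial over the previous ones. Freezing the free
  coordinates at the values taken at a point leaves a tower of separable equations. Over the algebraic
  closure the tower is seen to be reduced (a Nullstellensatz), and its Jacobian matrix is triangular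
  with unit determinant; hence it is a variety that is etale over \<open>V\<close>, and the projection is a union of
  etale images. On the line, a nonzero ideal has a finite zero locus, so only the pieces
  attached to the zero ideal are not finite.\<close>

section \<open>Multivariate polynomials as a type\<close>

text \<open>An etale image needs a variety upstairs, hence a reduced ring, whereas smoothness needs
  explicit generators of its ideal. Reducedness is built in: coordinate rings are polynomial rings
  over \<open>K\<close> modulo all polynomials vanishing on a set of points over the algebraic
  closure (\<open>pideal\<close>). Rational points would not do, since a tower can have too few of
  them. What remains is to show that the tower equations generate this ideal. They do as soon as the
  product \<open>tower_unit\<close> of leading coefficients and derivatives is invertible, and one
  further variable \<open>t\<close> with \<open>H * t = 1\<close> makes it so; the factor
  \<open>q\<close> of \<open>H\<close> encodes the inequation at the same time. Elimination compares
  projections only. Quantified coordinates may therefore be changed by a bijection, and this freedom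
  is what lets Frobenius dispose of inseparable equations. The definitions speak about ring records
  with partial carriers. Polynomial computations are done in the type \<open>'a mp\<close>, where
  ring laws are automatic, and carried over by homomorphisms from a type into a record
  (\<open>class_hom\<close>).\<close>

type_synonym 'a mp = "monom \<Rightarrow>\<^sub>0 'a"

definition mconst :: "'a::zero \<Rightarrow> 'a mp" where
  "mconst c = Poly_Mapping.single 0 c"

definition mvar :: "nat \<Rightarrow> 'a::zero_neq_one mp" where
  "mvar i = Poly_Mapping.single (Poly_Mapping.single i 1) 1"

definition monom_val :: "(nat \<Rightarrow> 'b::comm_ring_1) \<Rightarrow> monom \<Rightarrow> 'b" where
  "monom_val e \<alpha> = (\<Prod>i\<in>Poly_Mapping.keys \<alpha>. e i ^ Poly_Mapping.lookup \<alpha> i)"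

text \<open>The coefficient map \<open>h\<close> is a parameter because one function has to serve
  for evaluation at rational points, evaluation at geometric points, and substitution of polynomials
  for variables (\<open>ret\<close>, \<open>twist\<close>, \<open>flat\<close>,
  \<open>nest\<close>).\<close>

definition mval :: "('a::zero \<Rightarrow> 'b::comm_ring_1) \<Rightarrow> (nat \<Rightarrow> 'b) \<Rightarrow> 'a mp \<Rightarrow> 'b" where
  "mval h e p = (\<Sum>\<alpha>\<in>Poly_Mapping.keys p. h (Poly_Mapping.lookup p \<alpha>) * monom_val e \<alpha>)"

lemma poly_mapping_sum_single:
  "(\<Sum>\<alpha>\<in>Poly_Mapping.keys p. Poly_Mapping.single \<alpha> (Poly_Mapping.lookup p \<alpha>)) = p"
proof (rule poly_mapping_eqI)
  fix k
  have "Poly_Mapping.lookup (\<Sum>\<alpha>\<in>Poly_Mapping.keys p. Poly_Mapping.single \<alpha> (Poly_Mapping.lookup p \<alpha>)) k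
    = (\<Sum>\<alpha>\<in>Poly_Mapping.keys p. if \<alpha> = k then Poly_Mapping.lookup p \<alpha> else 0)"
    by (auto simp: lookup_sum lookup_single when_def intro: sum.cong)
  also have "\<dots> = Poly_Mapping.lookup p k"
    by (simp add: sum.delta' in_keys_iff)
  finally show "Poly_Mapping.lookup (\<Sum>\<alpha>\<in>Poly_Mapping.keys p.
    Poly_Mapping.single \<alpha> (Poly_Mapping.lookup p \<alpha>)) k = Poly_Mapping.lookup p k" .
qed

lemma monom_val_superset:
  assumes "finite A" "Poly_Mapping.keys \<alpha> \<subseteq> A"
  shows "monom_val e \<alpha> = (\<Prod>i\<in>A. e i ^ Poly_Mapping.lookup \<alpha> i)"
  unfolding monom_val_def
  by (rule prod.mono_neutral_left) (use assms in \<open>auto simp: in_keys_iff\<close>)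

lemma monom_val_0 [simp]: "monom_val e 0 = 1"
  by (simp add: monom_val_def)

lemma monom_val_add: "monom_val e (\<alpha> + \<beta>) = monom_val e \<alpha> * monom_val e \<beta>"
proof -
  let ?A = "Poly_Mapping.keys \<alpha> \<union> Poly_Mapping.keys \<beta>"
  have fin: "finite ?A" by simp
  have "monom_val e (\<alpha> + \<beta>) = (\<Prod>i\<in>?A. e i ^ Poly_Mapping.lookup (\<alpha> + \<beta>) i)"
    by (rule monom_val_superset[OF fin]) (rule keys_add)
  also have "\<dots> = (\<Prod>i\<in>?A. e i ^ Poly_Mapping.lookup \<alpha> i) * (\<Prod>i\<in>?A. e i ^ Poly_Mapping.lookup \<beta> i)"
    by (simp add: lookup_add power_add prod.distrib)
  also have "\<dots> = monom_val e \<alpha> * monom_val e \<beta>"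
    using monom_val_superset[OF fin, of \<alpha> e] monom_val_superset[OF fin, of \<beta> e] by simp
  finally show ?thesis .
qed

lemma monom_val_single [simp]: "monom_val e (Poly_Mapping.single i n) = e i ^ n"
  by (cases "n = 0") (auto simp: monom_val_def)

lemma mp_induct_single [case_names zero single add]:
  assumes "P 0" "\<And>\<alpha> c. P (Poly_Mapping.single \<alpha> c)" "\<And>p q. P p \<Longrightarrow> P q \<Longrightarrow> P (p + q)"
  shows "P (p :: 'b \<Rightarrow>\<^sub>0 'a::comm_monoid_add)"
proof -
  have "P (\<Sum>\<alpha>\<in>A. Poly_Mapping.single \<alpha> (Poly_Mapping.lookup p \<alpha>))" if "finite A" for A
    using that by induct (auto intro: assms)
  from this[of "Poly_Mapping.keys p"] show ?thesis
    by (simp add: poly_mapping_sum_single)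
qed

lemma mvar_power: "(mvar i :: 'a::comm_ring_1 mp) ^ n = Poly_Mapping.single (Poly_Mapping.single i n) 1"
proof (induct n)
  case (Suc n)
  have "(mvar i :: 'a mp) ^ Suc n = mvar i * Poly_Mapping.single (Poly_Mapping.single i n) 1"
    by (simp add: Suc)
  also have "\<dots> = Poly_Mapping.single (Poly_Mapping.single i (Suc n)) 1"
    by (simp add: mvar_def mult_single flip: single_add)
  finally show ?case .
qed simp

lemma prod_mvar_power:
  "finite A \<Longrightarrow> (\<Prod>i\<in>A. (mvar i :: 'a::comm_ring_1 mp) ^ n i) =
     Poly_Mapping.single (\<Sum>i\<in>A. Poly_Mapping.single i (n i)) 1"
  by (induct A rule: finite_induct) (simp_all add: mvar_power mult_single)

lemma single_as_prod:
  "Poly_Mapping.single \<alpha> (c :: 'a::comm_ring_1) =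
    mconst c * (\<Prod>i\<in>Poly_Mapping.keys \<alpha>. mvar i ^ Poly_Mapping.lookup \<alpha> i)"
  by (simp add: prod_mvar_power mconst_def mult_single poly_mapping_sum_single)

text \<open>Every term is a constant times powers of variables, so a property closed under sums and
  products only has to be checked on constants and on the variables that occur.\<close>

lemma mp_induct_below:
  fixes P :: "'a::comm_ring_1 mp \<Rightarrow> bool"
  assumes const: "\<And>c. P (mconst c)" and var: "\<And>i. i \<in> V \<Longrightarrow> P (mvar i)"
    and add: "\<And>p q. P p \<Longrightarrow> P q \<Longrightarrow> P (p + q)"
    and mult: "\<And>p q. P p \<Longrightarrow> P q \<Longrightarrow> P (p * q)"
    and V: "\<forall>\<alpha>\<in>Poly_Mapping.keys p. Poly_Mapping.keys \<alpha> \<subseteq> V"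
  shows "P p"
proof -
  have one: "P 1" using const[of 1] by (simp add: mconst_def)
  have zero: "P 0" using const[of 0] by (simp add: mconst_def)
  have pow: "P (q ^ n)" if "P q" for q n
    using that by (induct n) (auto intro: one mult)
  have prod: "P (\<Prod>i\<in>A. mvar i ^ n i)" if "finite A" "A \<subseteq> V" for A n
    using that by (induct A rule: finite_induct) (auto intro!: one mult pow var)
  have "P (\<Sum>\<alpha>\<in>A. Poly_Mapping.single \<alpha> (Poly_Mapping.lookup p \<alpha>))"
    if "finite A" "A \<subseteq> Poly_Mapping.keys p" for A
    using that
  proof (induct A rule: finite_induct)
    case (insert \<alpha> A)
    from insert(4) V have "Poly_Mapping.keys \<alpha> \<subseteq> V" by blast
    then have "P (Poly_Mapping.single \<alpha> (Poly_Mapping.lookup p \<alpha>))"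
      unfolding single_as_prod by (intro mult const prod) auto
    with insert show ?case by (simp add: add)
  qed (simp add: zero)
  from this[of "Poly_Mapping.keys p"] show ?thesis
    by (simp add: poly_mapping_sum_single)
qed

lemma mp_induct [case_names const var add mult]:
  fixes P :: "'a::comm_ring_1 mp \<Rightarrow> bool"
  assumes "\<And>c. P (mconst c)" "\<And>i. P (mvar i)"
    "\<And>p q. P p \<Longrightarrow> P q \<Longrightarrow> P (p + q)" "\<And>p q. P p \<Longrightarrow> P q \<Longrightarrow> P (p * q)"
  shows "P p"
  by (rule mp_induct_below[where V = UNIV]) (auto intro: assms)

lemma mval_superset:
  assumes "h 0 = 0" "finite A" "Poly_Mapping.keys p \<subseteq> A"
  shows "mval h e p = (\<Sum>\<alpha>\<in>A. h (Poly_Mapping.lookup p \<alpha>) * monom_val e \<alpha>)"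
  unfolding mval_def
  by (rule sum.mono_neutral_left) (use assms in \<open>auto simp: in_keys_iff\<close>)

lemma mval_single: "h 0 = 0 \<Longrightarrow> mval h e (Poly_Mapping.single \<alpha> c) = h c * monom_val e \<alpha>"
  by (cases "c = 0") (auto simp: mval_def)

lemma lookup_mconst: "Poly_Mapping.lookup (mconst c) \<alpha> = (if \<alpha> = 0 then c else 0)"
  by (simp add: mconst_def lookup_single when_def)

lemma comm_ring_hom_simps:
  assumes "comm_ring_hom h"
  shows "h 0 = 0" "h 1 = 1" "h (x + y) = h x + h y" "h (x * y) = h x * h y"
    "h (- x) = - h x" "h (x - y) = h x - h y" "h (x ^ n) = h x ^ n"
    "h (sum f A) = (\<Sum>x\<in>A. h (f x))" "h (prod f A) = (\<Prod>x\<in>A. h (f x))" "h (of_nat n) = of_nat n"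
proof -
  interpret comm_ring_hom h by fact
  show "h 0 = 0" "h 1 = 1" "h (x + y) = h x + h y" "h (x * y) = h x * h y"
    "h (- x) = - h x" "h (x - y) = h x - h y" "h (x ^ n) = h x ^ n"
    "h (sum f A) = (\<Sum>x\<in>A. h (f x))" "h (prod f A) = (\<Prod>x\<in>A. h (f x))" "h (of_nat n) = of_nat n"
    by (simp_all add: hom_distribs)
qed

lemma comm_ring_homI:
  assumes "h 1 = 1" "\<And>x y. h (x + y) = h x + h y" "\<And>x y. h (x * y) = h x * h y"
  shows "comm_ring_hom (h :: 'a::comm_ring_1 \<Rightarrow> 'b::comm_ring_1)"
proof -
  have "h 0 = 0" using assms(2)[of 0 0] by simp
  with assms show ?thesis by unfold_locales auto
qed

lemma comm_ring_hom_comp: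
  assumes "comm_ring_hom f" "comm_ring_hom g"
  shows "comm_ring_hom (\<lambda>x. f (g x))"
  by (rule comm_ring_homI) (simp_all add: comm_ring_hom_simps[OF assms(1)] comm_ring_hom_simps[OF assms(2)])

lemma comm_ring_hom_id: "comm_ring_hom (\<lambda>x. x)"
  by (rule comm_ring_homI) simp_all

lemmas comm_ring_hom_0 = comm_ring_hom_simps(1)
lemmas comm_ring_hom_1 = comm_ring_hom_simps(2)

lemma mconst_hom: "comm_ring_hom (mconst :: 'a::comm_ring_1 \<Rightarrow> 'a mp)"
  by (rule comm_ring_homI) (auto simp: mconst_def single_add mult_single)

lemmas mconst_simps = comm_ring_hom_simps[OF mconst_hom]

lemma mconst_01 [simp]: "mconst 0 = 0" "mconst 1 = (1 :: 'a::comm_ring_1 mp)"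
  by (simp_all add: mconst_def)

lemma mval_hom:
  assumes "comm_ring_hom h"
  shows "comm_ring_hom (mval h e :: 'a::comm_ring_1 mp \<Rightarrow> 'b::comm_ring_1)"
proof -
  note hom = comm_ring_hom_simps[OF assms]
  have add: "mval h e (p + q) = mval h e p + mval h e q" for p q
  proof -
    let ?A = "Poly_Mapping.keys p \<union> Poly_Mapping.keys q"
    have "mval h e (p + q) = (\<Sum>\<alpha>\<in>?A. h (Poly_Mapping.lookup (p + q) \<alpha>) * monom_val e \<alpha>)"
      by (rule mval_superset) (auto simp: keys_add hom(1))
    then show ?thesis
      using mval_superset[of h ?A p e, OF hom(1)] mval_superset[of h ?A q e, OF hom(1)]
      by (simp add: lookup_add hom distrib_right sum.distrib)
  qed
  have zero: "mval h e 0 = 0" by (simp add: mval_def)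
  have mult: "mval h e (p * q) = mval h e p * mval h e q" for p q
  proof (induct p rule: mp_induct_single)
    case (single \<alpha> c)
    show ?case
    proof (induct q rule: mp_induct_single)
      case (single \<beta> d)
      show ?case
        by (simp add: mult_single mval_single hom monom_val_add)
    qed (simp_all add: zero add distrib_left)
  qed (simp_all add: zero add distrib_right)
  have one: "mval h e 1 = 1"
    using mval_single[of h e 0 1] by (simp add: hom)
  show ?thesis
    by (rule comm_ring_homI) (simp_all add: one add mult)
qed

lemma mval_mconst [simp]: "h 0 = 0 \<Longrightarrow> mval h e (mconst c) = h c"
  by (simp add: mconst_def mval_single)

lemma mval_mvar [simp]: "h 0 = 0 \<Longrightarrow> h 1 = 1 \<Longrightarrow> mval h e (mvar i) = e i"
  by (simp add: mvar_def mval_single)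

text \<open>The uniqueness half of the universal property of polynomial rings. Almost every identity
  between evaluations and substitutions below is obtained from it rather than by computing with
  coefficients.\<close>

lemma mp_hom_ext:
  assumes f: "comm_ring_hom f" and g: "comm_ring_hom g"
    and "\<And>c. f (mconst c) = g (mconst c)" "\<And>i. f (mvar i) = g (mvar i)"
  shows "f (p :: 'a::comm_ring_1 mp) = g p"
  by (induct p rule: mp_induct) (simp_all add: assms comm_ring_hom_simps[OF f] comm_ring_hom_simps[OF g])

lemma mval_comp:
  assumes g: "comm_ring_hom g" and h: "comm_ring_hom h"
  shows "g (mval h e p) = mval (\<lambda>c. g (h c)) (\<lambda>i. g (e i)) (p :: 'a::comm_ring_1 mp)"
  by (rule mp_hom_ext[OF comm_ring_hom_comp[OF g mval_hom[OF h]] mval_hom[OF comm_ring_hom_comp[OF g h]]])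
    (simp_all add: comm_ring_hom_simps[OF g] comm_ring_hom_simps[OF h])

subsection \<open>Polynomials in the first variables\<close>

definition below :: "nat \<Rightarrow> 'a::zero mp set" where
  "below n = {p. \<forall>\<alpha>\<in>Poly_Mapping.keys p. Poly_Mapping.keys \<alpha> \<subseteq> {..<n}}"

text \<open>Padding with 0 gives each point of affine \<open>n\<close>-space exactly one
  representing environment, so equality of points is equality of functions.\<close>

definition trunc :: "nat \<Rightarrow> (nat \<Rightarrow> 'a::zero) \<Rightarrow> nat \<Rightarrow> 'a" where
  "trunc n e = (\<lambda>i. if i < n then e i else 0)"

text \<open>The retraction onto the polynomials in the first \<open>n\<close> variables that kills
  all later ones. It replaces side conditions on the variables that occur, and it corresponds to
  \<open>trunc\<close> under evaluation.\<close>

definition ret :: "nat \<Rightarrow> 'a::comm_ring_1 mp \<Rightarrow> 'a mp" where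
  "ret n = mval mconst (trunc n mvar)"

lemma ret_hom: "comm_ring_hom (ret n)"
  unfolding ret_def by (rule mval_hom[OF mconst_hom])

lemmas ret_simps = comm_ring_hom_simps[OF ret_hom]

lemma ret_mconst [simp]: "ret n (mconst c) = mconst c"
  by (simp add: ret_def)

lemma ret_mvar: "ret n (mvar i) = (if i < n then mvar i else 0)"
  by (simp add: ret_def trunc_def)

lemma mval_ret:
  assumes h: "comm_ring_hom h"
  shows "mval h e (ret n p) = mval h (trunc n e) p"
  by (rule mp_hom_ext[OF comm_ring_hom_comp[OF mval_hom[OF h] ret_hom] mval_hom[OF h]])
    (simp_all add: comm_ring_hom_simps[OF h] ret_mvar trunc_def comm_ring_hom_0[OF mval_hom[OF h]])

lemma ret_single:
  "ret n (Poly_Mapping.single \<alpha> c) =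
    (if Poly_Mapping.keys \<alpha> \<subseteq> {..<n} then Poly_Mapping.single \<alpha> c else 0)"
proof -
  have *: "ret n (Poly_Mapping.single \<alpha> c) =
    mconst c * (\<Prod>i\<in>Poly_Mapping.keys \<alpha>. (if i < n then mvar i else 0) ^ Poly_Mapping.lookup \<alpha> i)"
    by (simp add: ret_def mval_single monom_val_def trunc_def)
  show ?thesis
  proof (cases "Poly_Mapping.keys \<alpha> \<subseteq> {..<n}")
    case True
    then have "(\<Prod>i\<in>Poly_Mapping.keys \<alpha>. (if i < n then mvar i else 0) ^ Poly_Mapping.lookup \<alpha> i)
      = (\<Prod>i\<in>Poly_Mapping.keys \<alpha>. (mvar i :: 'a mp) ^ Poly_Mapping.lookup \<alpha> i)"
      by (intro prod.cong) auto
    with True show ?thesis by (simp add: *) (simp add: single_as_prod)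
  next
    case False
    then obtain i where "i \<in> Poly_Mapping.keys \<alpha>" "\<not> i < n" by auto
    then have "(\<Prod>i\<in>Poly_Mapping.keys \<alpha>. (if i < n then (mvar i :: 'a mp) else 0) ^ Poly_Mapping.lookup \<alpha> i) = 0"
      by (intro prod_zero) (auto simp: in_keys_iff power_0_left)
    with False show ?thesis by (simp add: *)
  qed
qed

lemma lookup_ret:
  "Poly_Mapping.lookup (ret n p) \<alpha> =
    (if Poly_Mapping.keys \<alpha> \<subseteq> {..<n} then Poly_Mapping.lookup p \<alpha> else 0)"
  by (induct p rule: mp_induct_single) (auto simp: ret_single lookup_single when_def ret_simps lookup_add)

lemma ret_below [simp]: "ret n p \<in> below n"
proof -
  have "Poly_Mapping.keys \<alpha> \<subseteq> {..<n}" if "Poly_Mapping.lookup (ret n p) \<alpha> \<noteq> 0" for \<alpha>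
    using that by (simp add: lookup_ret split: if_splits)
  then show ?thesis
    unfolding below_def by (simp add: in_keys_iff)
qed

lemma ret_id: "p \<in> below n \<Longrightarrow> ret n p = p"
  by (rule poly_mapping_eqI) (auto simp: below_def lookup_ret in_keys_iff)

lemma below_iff: "p \<in> below n \<longleftrightarrow> ret n p = p"
  by (metis ret_id ret_below)

lemma below_mconst [simp]: "mconst (c :: 'a::comm_ring_1) \<in> below n"
  by (simp add: below_iff)

lemma below_mvar [simp]: "i < n \<Longrightarrow> (mvar i :: 'a::comm_ring_1 mp) \<in> below n"
  by (simp add: below_iff ret_mvar)

lemma below_0 [simp]: "(0::'a::comm_ring_1 mp) \<in> below n" and below_1 [simp]: "(1::'a::comm_ring_1 mp) \<in> below n"
  by (simp_all add: below_iff ret_simps)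

lemma below_add: "p \<in> below n \<Longrightarrow> q \<in> below n \<Longrightarrow> p + q \<in> below n"
  and below_mult: "p \<in> below n \<Longrightarrow> q \<in> below n \<Longrightarrow> p * q \<in> below n"
  and below_diff: "p \<in> below n \<Longrightarrow> q \<in> below n \<Longrightarrow> p - q \<in> below n"
  and below_uminus: "p \<in> below n \<Longrightarrow> - p \<in> below n"
  and below_power: "p \<in> below n \<Longrightarrow> p ^ k \<in> below n"
  for p :: "'a::comm_ring_1 mp"
  by (simp_all add: below_iff ret_simps)

lemma below_mono: "m \<le> n \<Longrightarrow> p \<in> below m \<Longrightarrow> p \<in> below n"
  by (fastforce simp: below_def)

lemma trunc_trunc [simp]: "trunc m (trunc n e) = trunc (min m n) e"
  by (auto simp: trunc_def)

lemma ret_ret [simp]: "ret m (ret n p) = ret (min m n) p"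
  by (rule poly_mapping_eqI) (auto simp: lookup_ret)

lemma mval_trunc_below:
  assumes "comm_ring_hom h" "p \<in> below n"
  shows "mval h (trunc n e) p = mval h e p"
  using mval_ret[OF assms(1), of e n p] by (simp add: ret_id[OF assms(2)])

lemma below_induct [consumes 1, case_names const var add mult]:
  fixes p :: "'a::comm_ring_1 mp"
  assumes "p \<in> below n" "\<And>c. P (mconst c)" "\<And>i. i < n \<Longrightarrow> P (mvar i)"
    "\<And>p q. P p \<Longrightarrow> P q \<Longrightarrow> P (p + q)" "\<And>p q. P p \<Longrightarrow> P q \<Longrightarrow> P (p * q)"
  shows "P p"
  by (rule mp_induct_below[where V = "{..<n}"]) (use assms in \<open>auto simp: below_def\<close>)

subsection \<open>Formal partial derivatives\<close>

lift_definition mderiv :: "nat \<Rightarrow> 'a::comm_ring_1 mp \<Rightarrow> 'a mp" is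
  "\<lambda>i p \<alpha>. of_nat (Poly_Mapping.lookup \<alpha> i + 1) * p (\<alpha> + Poly_Mapping.single i 1)"
proof -
  fix i and p :: "monom \<Rightarrow> 'a"
  assume fin: "finite {x. p x \<noteq> 0}"
  have "{x. of_nat (Poly_Mapping.lookup x i + 1) * p (x + Poly_Mapping.single i 1) \<noteq> 0}
    \<subseteq> (\<lambda>x. x - Poly_Mapping.single i 1) ` {x. p x \<noteq> 0}"
  proof
    fix x assume "x \<in> {x. of_nat (Poly_Mapping.lookup x i + 1) * p (x + Poly_Mapping.single i 1) \<noteq> 0}"
    then have "p (x + Poly_Mapping.single i 1) \<noteq> 0" by auto
    then show "x \<in> (\<lambda>x. x - Poly_Mapping.single i 1) ` {x. p x \<noteq> 0}"
      by (intro image_eqI[of _ _ "x + Poly_Mapping.single i 1"]) simp_all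
  qed
  then show "finite {x. of_nat (Poly_Mapping.lookup x i + 1) * p (x + Poly_Mapping.single i 1) \<noteq> 0}"
    by (rule finite_subset) (simp add: fin)
qed

lemma mderiv_add: "mderiv i (p + q) = mderiv i p + mderiv i q"
  by (rule poly_mapping_eqI) (simp add: mderiv.rep_eq lookup_add distrib_left)

lemma mderiv_0 [simp]: "mderiv i 0 = 0"
  by (rule poly_mapping_eqI) (simp add: mderiv.rep_eq)

lemma mderiv_single:
  "mderiv i (Poly_Mapping.single \<alpha> c) =
    Poly_Mapping.single (\<alpha> - Poly_Mapping.single i 1) (of_nat (Poly_Mapping.lookup \<alpha> i) * c)"
proof (rule poly_mapping_eqI)
  fix \<beta>
  let ?e = "Poly_Mapping.single i (1::nat)"
  show "Poly_Mapping.lookup (mderiv i (Poly_Mapping.single \<alpha> c)) \<beta> =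
    Poly_Mapping.lookup (Poly_Mapping.single (\<alpha> - ?e) (of_nat (Poly_Mapping.lookup \<alpha> i) * c)) \<beta>"
  proof (cases "\<alpha> = \<beta> + ?e")
    case True
    then show ?thesis by (simp add: mderiv.rep_eq lookup_add)
  next
    case False
    \<comment> \<open>Subtraction of exponents is cut off at 0, so
      \<open>\<alpha> - ?e = \<beta>\<close> can hold without
      \<open>\<alpha> = \<beta> + ?e\<close>; but then the exponent of variable \<open>i\<close> is
      0 and kills the coefficient.\<close>
    have "\<alpha> - ?e \<noteq> \<beta> \<or> Poly_Mapping.lookup \<alpha> i = 0"
    proof (rule ccontr)
      assume "\<not> ?thesis"
      then have "\<alpha> = \<beta> + ?e"
        by (intro poly_mapping_eqI) (auto simp: lookup_add lookup_minus lookup_single when_def)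
      with False show False by simp
    qed
    with False show ?thesis by (auto simp: mderiv.rep_eq lookup_single when_def)
  qed
qed

lemma mderiv_mult: "mderiv i (p * q) = mderiv i p * q + p * mderiv i q"
proof (induct p rule: mp_induct_single)
  case (single \<alpha> c)
  show ?case
  proof (induct q rule: mp_induct_single)
    case (single \<beta> d)
    let ?e = "Poly_Mapping.single i (1::nat)"
    \<comment> \<open>Cut-off subtraction commutes with adding \<open>\<beta>\<close> only if the
      exponent in \<open>\<alpha>\<close> is positive; otherwise the coefficient is 0 on both
      sides.\<close>
    have l: "Poly_Mapping.single (\<alpha> - ?e + \<beta>) (of_nat (Poly_Mapping.lookup \<alpha> i) * c * d) =
      Poly_Mapping.single (\<alpha> + \<beta> - ?e) (of_nat (Poly_Mapping.lookup \<alpha> i) * c * d)"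
    proof (cases "Poly_Mapping.lookup \<alpha> i = 0")
      case False
      then have "\<alpha> - ?e + \<beta> = \<alpha> + \<beta> - ?e"
        by (intro poly_mapping_eqI) (auto simp: lookup_add lookup_minus lookup_single when_def)
      then show ?thesis by simp
    qed simp
    have r: "Poly_Mapping.single (\<alpha> + (\<beta> - ?e)) (c * (of_nat (Poly_Mapping.lookup \<beta> i) * d)) =
      Poly_Mapping.single (\<alpha> + \<beta> - ?e) (c * (of_nat (Poly_Mapping.lookup \<beta> i) * d))"
    proof (cases "Poly_Mapping.lookup \<beta> i = 0")
      case False
      then have "\<alpha> + (\<beta> - ?e) = \<alpha> + \<beta> - ?e"
        by (intro poly_mapping_eqI) (auto simp: lookup_add lookup_minus lookup_single when_def)
      then show ?thesis by simp
    qed simp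
    have "Poly_Mapping.single (\<alpha> + \<beta> - ?e) (of_nat (Poly_Mapping.lookup (\<alpha> + \<beta>) i) * (c * d)) =
      Poly_Mapping.single (\<alpha> + \<beta> - ?e) (of_nat (Poly_Mapping.lookup \<alpha> i) * c * d) +
      Poly_Mapping.single (\<alpha> + \<beta> - ?e) (c * (of_nat (Poly_Mapping.lookup \<beta> i) * d))"
      by (simp add: lookup_add algebra_simps flip: single_add)
    then show ?case
      using l r by (simp add: mderiv_single mult_single)
  qed (simp_all add: mderiv_add distrib_left)
qed (simp_all add: mderiv_add distrib_right)

lemma mderiv_mconst [simp]: "mderiv i (mconst c) = 0"
  by (simp add: mconst_def mderiv_single)

lemma mderiv_mvar: "mderiv i (mvar j) = (if i = j then 1 else 0)"
  by (simp add: mvar_def mderiv_single lookup_single when_def)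

lemma mderiv_below: "p \<in> below n \<Longrightarrow> n \<le> i \<Longrightarrow> mderiv i p = 0"
  by (induct p rule: below_induct) (auto simp: mderiv_add mderiv_mult mderiv_mvar)

lemma mderiv_poly_mvar:
  assumes "\<And>j. coeff p j \<in> below k"
  shows "mderiv k (poly p (mvar k)) = poly (pderiv p) (mvar k)"
  using assms
proof (induct p)
  case (pCons a p)
  have "coeff p j \<in> below k" for j
    using pCons(3)[of "Suc j"] by simp
  with pCons have "mderiv k (poly p (mvar k)) = poly (pderiv p) (mvar k)" by blast
  moreover have "mderiv k a = 0"
    using pCons(3)[of 0] by (intro mderiv_below) auto
  ultimately show ?case
    by (simp add: mderiv_add mderiv_mult mderiv_mvar pderiv_pCons)
qed simp

lemma below_poly_mvar:
  fixes p :: "'a::comm_ring_1 mp poly"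
  assumes "\<And>j. coeff p j \<in> below k" "i < n" "k \<le> n"
  shows "poly p (mvar i) \<in> below n"
  using assms(1)
proof (induct p)
  case (pCons a p)
  have "coeff p j \<in> below k" for j
    using pCons(3)[of "Suc j"] by simp
  with pCons have "poly p (mvar i) \<in> below n" by blast
  moreover have "a \<in> below n"
    using pCons(3)[of 0] below_mono[OF assms(3)] by auto
  ultimately show ?case using assms(2) by (simp add: below_add below_mult)
qed simp

text \<open>Passage to a univariate polynomial in the last variable, where degrees, leading
  coefficients and pseudo-division are available.\<close>

lemma below_Suc_poly:
  fixes P :: "'a::comm_ring_1 mp"
  assumes "P \<in> below (Suc k)"
  obtains p where "P = poly p (mvar k)" "\<And>j. coeff p j \<in> below k"
proof -
  have "\<exists>p. P = poly p (mvar k) \<and> (\<forall>j. coeff p j \<in> below k)"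
    using assms
  proof (induct P rule: below_induct)
    case (const c)
    show ?case by (rule exI[of _ "[:mconst c:]"]) (simp add: coeff_pCons split: nat.split)
  next
    case (var i)
    show ?case
    proof (cases "i = k")
      case True
      then show ?thesis by (intro exI[of _ "[:0, 1:]"]) (simp add: coeff_pCons split: nat.split)
    next
      case False
      with var show ?thesis by (intro exI[of _ "[:mvar i:]"]) (simp add: coeff_pCons split: nat.split)
    qed
  next
    case (add p q)
    then obtain p' q' where "p = poly p' (mvar k)" "\<forall>j. coeff p' j \<in> below k"
      "q = poly q' (mvar k)" "\<forall>j. coeff q' j \<in> below k" by blast
    then show ?case by (intro exI[of _ "p' + q'"]) (auto intro: below_add)
  next
    case (mult p q)
    then obtain p' q' where "p = poly p' (mvar k)" "\<forall>j. coeff p' j \<in> below k"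
      "q = poly q' (mvar k)" "\<forall>j. coeff q' j \<in> below k" by blast
    moreover have "(\<Sum>i\<in>A. f i) \<in> below k" if "\<And>i. f i \<in> below k" for A :: "nat set" and f :: "nat \<Rightarrow> 'a mp"
      using that by (induct A rule: infinite_finite_induct) (auto intro: below_add)
    ultimately show ?case
      by (intro exI[of _ "p' * q'"]) (simp add: coeff_mult below_mult)
  qed
  with that show thesis by blast
qed

section \<open>Elimination of one variable over a perfect field\<close>

lemmas mval_simps = comm_ring_hom_simps[OF mval_hom]

abbreviation ev :: "(nat \<Rightarrow> 'a::comm_ring_1) \<Rightarrow> 'a mp \<Rightarrow> 'a" where
  "ev e \<equiv> mval (\<lambda>x. x) e"

lemmas ev_hom = mval_hom[OF comm_ring_hom_id]
lemmas ev_simps = comm_ring_hom_simps[OF ev_hom]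

lemma map_poly_simps:
  fixes h :: "'a::idom \<Rightarrow> 'b::idom"
  assumes "comm_ring_hom h"
  shows "map_poly h 0 = 0" "map_poly h 1 = 1" "map_poly h (p + q) = map_poly h p + map_poly h q"
    "map_poly h (p * q) = map_poly h p * map_poly h q" "map_poly h (p - q) = map_poly h p - map_poly h q"
    "map_poly h (smult c p) = smult (h c) (map_poly h p)" "map_poly h (Polynomial.monom c n) = Polynomial.monom (h c) n"
    "map_poly h (pCons c p) = pCons (h c) (map_poly h p)"
    "coeff (map_poly h p) j = h (coeff p j)" "map_poly h (pderiv p) = pderiv (map_poly h p)"
    "map_poly h (p ^ k) = map_poly h p ^ k" "poly (map_poly h p) (h x) = h (poly p x)"
proof -
  note h = comm_ring_hom_simps[OF assms]
  show c: "coeff (map_poly h p) j = h (coeff p j)" for p j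
    by (simp add: coeff_map_poly h)
  show "map_poly h 0 = 0" by simp
  show one: "map_poly h 1 = 1" by (rule poly_eqI) (simp add: c h)
  show add: "map_poly h (p + q) = map_poly h p + map_poly h q" for p q
    by (rule poly_eqI) (simp add: c h)
  show mult: "map_poly h (p * q) = map_poly h p * map_poly h q" for p q
    by (rule poly_eqI) (simp add: c h coeff_mult)
  show "map_poly h (p - q) = map_poly h p - map_poly h q"
    by (rule poly_eqI) (simp add: c h)
  show "map_poly h (smult a p) = smult (h a) (map_poly h p)" for a
    by (rule poly_eqI) (simp add: c h)
  show "map_poly h (Polynomial.monom a n) = Polynomial.monom (h a) n" for a
    by (rule poly_eqI) (simp add: c h)
  show pCons: "map_poly h (pCons a p) = pCons (h a) (map_poly h p)" for a p
    by (rule poly_eqI) (simp add: c h coeff_pCons split: nat.split)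
  show "map_poly h (p ^ k) = map_poly h p ^ k"
    by (induct k) (simp_all add: one mult)
  show "poly (map_poly h p) (h x) = h (poly p x)"
    by (induct p) (simp_all add: pCons h)
  show "map_poly h (pderiv p) = pderiv (map_poly h p)"
    by (rule poly_eqI) (simp add: c coeff_pderiv h del: of_nat_Suc)
qed

text \<open>The leading coefficient is required not to vanish so that the pseudo-division by \<open>f\<close> can be
  inverted, and the derivative so that \<open>f = 0\<close> is etale over the base.\<close>

definition simple_root :: "('a::field \<Rightarrow> 'b::field) \<Rightarrow> nat \<Rightarrow> 'a mp poly \<Rightarrow> (nat \<Rightarrow> 'b) \<Rightarrow> bool" where
  "simple_root h k f e \<longleftrightarrow>
    (let g = map_poly (mval h (trunc k e)) f in
      poly g (e k) = 0 \<and> poly (pderiv g) (e k) \<noteq> 0 \<and> mval h (trunc k e) (lead_coeff f) \<noteq> 0)"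

text \<open>\<open>None\<close> marks a free coordinate. Free coordinates keep their place in the
  list, so that position \<open>i\<close> always describes coordinate \<open>k + i\<close>.\<close>

fun otower :: "nat \<Rightarrow> 'a::field mp poly option list \<Rightarrow> (nat \<Rightarrow> 'a) \<Rightarrow> bool" where
  "otower k [] e \<longleftrightarrow> True"
| "otower k (None # \<tau>) e \<longleftrightarrow> otower (Suc k) \<tau> e"
| "otower k (Some f # \<tau>) e \<longleftrightarrow> simple_root (\<lambda>x. x) k f e \<and> otower (Suc k) \<tau> e"

text \<open>The equations \<open>C\<close> concern the base alone, but the inequation may involve
  every coordinate and hence cannot be split off as a condition on the base.\<close>

definition basic :: "nat \<Rightarrow> 'a::field mp list \<Rightarrow> 'a mp poly option list \<Rightarrow> 'a mp \<Rightarrow> (nat \<Rightarrow> 'a) \<Rightarrow> bool" where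
  "basic m C \<tau> q e \<longleftrightarrow> (\<forall>c\<in>set C. ev (trunc m e) c = 0) \<and> otower m \<tau> e \<and> ev (trunc (m + length \<tau>) e) q \<noteq> 0"

text \<open>The projection to the first \<open>m\<close> coordinates, written as a predicate on
  environments: all later coordinates are quantified at once.\<close>

definition fiber :: "nat \<Rightarrow> ((nat \<Rightarrow> 'a::zero) \<Rightarrow> bool) \<Rightarrow> (nat \<Rightarrow> 'a) \<Rightarrow> bool" where
  "fiber m P e \<longleftrightarrow> (\<exists>e'. trunc m e' = trunc m e \<and> P e')"

text \<open>Only projections are compared, not \<open>P\<close> itself with the basic sets. This
  leaves room for a change of the quantified coordinates.\<close>

definition eliminable :: "nat \<Rightarrow> nat \<Rightarrow> ((nat \<Rightarrow> 'a::field) \<Rightarrow> bool) \<Rightarrow> bool" where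
  "eliminable m n P \<longleftrightarrow> (\<exists>B. finite B \<and> (\<forall>(C, \<tau>, q)\<in>B. length \<tau> = n) \<and>
    (\<forall>e. fiber m P e \<longleftrightarrow> (\<exists>(C, \<tau>, q)\<in>B. fiber m (basic m C \<tau> q) e)))"

text \<open>The state during the treatment of coordinate \<open>m\<close>: the coordinates above it
  already form a tower, while \<open>m\<close> itself is still subject to an arbitrary list
  \<open>Ps\<close> of equations over the base.\<close>

definition mixed :: "nat \<Rightarrow> 'a::field mp list \<Rightarrow> 'a mp poly list \<Rightarrow> 'a mp poly option list \<Rightarrow> 'a mp \<Rightarrow>
    (nat \<Rightarrow> 'a) \<Rightarrow> bool" where
  "mixed m C Ps \<tau> q e \<longleftrightarrow> (\<forall>c\<in>set C. ev (trunc m e) c = 0) \<and>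
    (\<forall>p\<in>set Ps. poly (map_poly (ev (trunc m e)) p) (e m) = 0) \<and>
    otower (Suc m) \<tau> e \<and> ev (trunc (Suc m + length \<tau>) e) q \<noteq> 0"

text \<open>With base \<open>4\<close>, two polynomials of degree less than \<open>d\<close> together weigh less than one of degree
  \<open>d\<close>, so that pseudo-division by the derivative, which replaces \<open>p\<close> by a remainder and \<open>p'\<close>,
  makes progress.\<close>

definition weight :: "'a::zero poly \<Rightarrow> nat" where
  "weight p = 1 + (\<Sum>j\<in>{j. coeff p j \<noteq> 0}. 4 ^ j)"

section \<open>The termination weight of a univariate polynomial\<close>

lemma finite_supp [simp]: "finite {j. coeff p j \<noteq> 0}"
  by (rule finite_subset[of _ "{..degree p}"]) (auto intro: le_degree)

lemma weight_pos: "0 < weight p"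
  by (simp add: weight_def)

lemma weight_lead: "p \<noteq> 0 \<Longrightarrow> 4 ^ degree p < weight p"
  using member_le_sum[of "degree p" "{j. coeff p j \<noteq> 0}" "\<lambda>j. (4::nat) ^ j"]
  by (simp add: weight_def)

text \<open>The geometric sum \<open>3 * (4^0 + ... + 4^(d-1)) + 1 = 4^d\<close>, plus three times
  the summand 1 of the weight.\<close>

lemma weight_less:
  assumes "r = 0 \<or> degree r < d"
  shows "3 * weight r \<le> 2 + 4 ^ d"
proof -
  have "3 * (\<Sum>j<d. 4 ^ j) + 1 = (4::nat) ^ d"
    by (induct d) auto
  moreover have "(\<Sum>j\<in>{j. coeff r j \<noteq> 0}. (4::nat) ^ j) \<le> (\<Sum>j<d. 4 ^ j)"
    using assms by (intro sum_mono2) (auto dest: le_degree)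
  ultimately show ?thesis by (simp add: weight_def)
qed

text \<open>Deleting any term counts as progress, not only the leading one. The weight sums over the
  whole support for this reason: in positive characteristic the leading term of the derivative may
  stem from a lower term of \<open>p\<close>.\<close>

lemma weight_remove:
  fixes p :: "'a::ab_group_add poly"
  assumes "coeff p j \<noteq> 0"
  shows "weight (p - Polynomial.monom (coeff p j) j) < weight p"
proof -
  have "{i. coeff (p - Polynomial.monom (coeff p j) j) i \<noteq> 0} = {i. coeff p i \<noteq> 0} - {j}"
    by auto
  moreover have "(\<Sum>i\<in>{i. coeff p i \<noteq> 0} - {j}. (4::nat) ^ i) < (\<Sum>i\<in>{i. coeff p i \<noteq> 0}. 4 ^ i)"
    using assms by (intro sum_strict_mono2) auto
  ultimately show ?thesis by (simp add: weight_def)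
qed

lemma eliminable_iff:
  assumes "eliminable m n Q" "\<And>e. fiber m P e \<longleftrightarrow> fiber m Q e"
  shows "eliminable m n P"
  using assms by (simp add: eliminable_def)

lemma eliminable_disj:
  assumes "eliminable m n P" "eliminable m n Q"
  shows "eliminable m n (\<lambda>e. P e \<or> Q e)"
proof -
  from assms obtain A B where "finite A" "finite B"
    "\<forall>(C, \<tau>, q)\<in>A. length \<tau> = n" "\<forall>(C, \<tau>, q)\<in>B. length \<tau> = n"
    "\<forall>e. fiber m P e \<longleftrightarrow> (\<exists>(C, \<tau>, q)\<in>A. fiber m (basic m C \<tau> q) e)"
    "\<forall>e. fiber m Q e \<longleftrightarrow> (\<exists>(C, \<tau>, q)\<in>B. fiber m (basic m C \<tau> q) e)"
    unfolding eliminable_def by metis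
  moreover have "fiber m (\<lambda>e. P e \<or> Q e) e \<longleftrightarrow> fiber m P e \<or> fiber m Q e" for e
    by (auto simp: fiber_def)
  ultimately show ?thesis
    unfolding eliminable_def by (intro exI[of _ "A \<union> B"]) (auto)
qed

lemma eliminable_basic: "length \<tau> = n \<Longrightarrow> eliminable m n (basic m C \<tau> q)"
  unfolding eliminable_def by (rule exI[of _ "{(C, \<tau>, q)}"]) auto

text \<open>One step of pseudo-division of \<open>p\<close> by \<open>q\<close>. It cancels the
  leading term without dividing, and at points where \<open>q\<close> vanishes and its leading
  coefficient does not, it has the same zeros as \<open>p\<close>.\<close>

definition lead_step :: "'a::comm_ring_1 poly \<Rightarrow> 'a poly \<Rightarrow> 'a poly" where
  "lead_step p q = smult (lead_coeff q) p - Polynomial.monom (lead_coeff p) (degree p - degree q) * q"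

lemma lead_step_degree:
  assumes "degree q \<le> degree p"
  shows "lead_step p q = 0 \<or> degree (lead_step p q) < degree p"
\<comment> \<open>For constants there is no smaller degree to reach, so the difference has to be
  exactly 0.\<close>
proof (cases "degree p = 0")
  case True
  with assms have "degree q = 0" by simp
  with True obtain a b where "p = [:a:]" "q = [:b:]" by (metis degree_eq_zeroE)
  then show ?thesis by (simp add: lead_step_def monom_0)
next
  case False
  have "coeff (lead_step p q) j = 0" if "degree p \<le> j" for j
  proof (cases "j = degree p")
    case True
    with assms show ?thesis by (simp add: lead_step_def coeff_monom_mult)
  next
    case False
    with that assms have "degree p < j" "degree q < j - (degree p - degree q)" by auto
    then show ?thesis by (simp add: lead_step_def coeff_monom_mult coeff_eq_0)
  qed
  then show ?thesis using False
    by (metis coeff_eq_0 leading_coeff_0_iff linorder_not_less)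
qed

lemma map_poly_lead_step:
  fixes h :: "'a::idom \<Rightarrow> 'b::idom"
  assumes "comm_ring_hom h"
  shows "map_poly h (lead_step p q) = smult (h (lead_coeff q)) (map_poly h p) -
    Polynomial.monom (h (lead_coeff p)) (degree p - degree q) * map_poly h q"
  by (simp add: lead_step_def map_poly_simps[OF assms])

lemma trunc_Suc_eq: "trunc m e' = trunc m e \<longleftrightarrow> (\<forall>i<m. e' i = e i)"
  by (auto simp: trunc_def fun_eq_iff)

section \<open>Frobenius and the twist of the quantified coordinates\<close>

lemma CHAR_mp: "CHAR('a::comm_ring_1 mp) = CHAR('a)"
proof (rule CHAR_eqI)
  have of_nat: "(of_nat n :: 'a mp) = mconst (of_nat n)" for n
    by (simp add: mconst_simps)
  show "of_nat CHAR('a) = (0 :: 'a mp)" by (simp add: of_nat)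
  show "CHAR('a) dvd n" if "of_nat n = (0 :: 'a mp)" for n
    using that lookup_mconst[of "of_nat n :: 'a" 0] by (simp add: of_nat of_nat_eq_0_iff_char_dvd)
qed

lemma frobenius_hom:
  assumes "prime CHAR('a::comm_ring_1)"
  shows "comm_ring_hom (\<lambda>x :: 'a. x ^ CHAR('a))"
  by (rule comm_ring_homI) (simp_all add: freshmans_dream[OF assms refl] power_mult_distrib)

text \<open>Over a perfect field of characteristic \<open>p\<close> the quantified coordinates may be replaced by their
  \<open>p\<close>-th powers. This turns a polynomial in \<open>X\<^sup>p\<close> into one in \<open>X\<close>, at the price of twisting all other
  conditions.\<close>

definition twist :: "nat \<Rightarrow> 'a::comm_ring_1 mp \<Rightarrow> 'a mp" where
  "twist m = mval (\<lambda>c. mconst (c ^ CHAR('a))) (\<lambda>i. if i < m then mvar i ^ CHAR('a) else mvar i)"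

lemma twist_hom:
  assumes "prime CHAR('a::comm_ring_1)"
  shows "comm_ring_hom (twist m :: 'a mp \<Rightarrow> _)"
  unfolding twist_def
  by (rule mval_hom) (rule comm_ring_hom_comp[OF mconst_hom frobenius_hom[OF assms]])

lemma twist_mvar:
  assumes "prime CHAR('a::comm_ring_1)"
  shows "twist m (mvar i) = (if i < m then mvar i ^ CHAR('a) else (mvar i :: 'a mp))"
  using prime_gt_0_nat[OF assms] by (simp add: twist_def power_0_left)

lemma twist_mconst:
  assumes "prime CHAR('a::comm_ring_1)"
  shows "twist m (mconst c) = mconst (c ^ CHAR('a) :: 'a)"
  using prime_gt_0_nat[OF assms] by (simp add: twist_def power_0_left)

text \<open>Raising the remaining variables to the \<open>p\<close>-th power as well turns
  \<open>twist m P\<close> into \<open>P^p\<close>, and \<open>P^p = 0\<close> only for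
  \<open>P = 0\<close>.\<close>

lemma twist_eq_0:
  assumes p: "prime CHAR('a::idom)" and "twist m P = (0 :: 'a mp)"
  shows "P = 0"
proof -
  let ?s = "mval mconst (\<lambda>i. if i < m then mvar i else mvar i ^ CHAR('a)) :: 'a mp \<Rightarrow> 'a mp"
  have "?s (twist m P) = P ^ CHAR('a mp)"
  proof (rule mp_hom_ext[OF comm_ring_hom_comp[OF mval_hom[OF mconst_hom] twist_hom[OF p]] frobenius_hom])
    show "prime CHAR('a mp)" using p by (simp add: CHAR_mp)
  qed (simp_all add: p twist_mconst twist_mvar CHAR_mp mconst_simps mval_simps[OF mconst_hom])
  with assms(2) have "P ^ CHAR('a mp) = 0" by (simp add: mval_simps[OF mconst_hom])
  then show ?thesis by simp
qed

text \<open>Both sides are ring homomorphisms in \<open>P\<close>. On a base variable the power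
  comes from the twist, on a later variable from the point \<open>e'\<close>.\<close>

lemma ev_twist:
  fixes e e' :: "nat \<Rightarrow> 'a::field"
  assumes p: "prime CHAR('a)"
    and lt: "\<And>i. i < m \<Longrightarrow> e' i = e i" and ge: "\<And>i. m \<le> i \<Longrightarrow> e' i = e i ^ CHAR('a)" and "m \<le> k"
  shows "ev (trunc k e') (twist m P) = ev (trunc k e) P ^ CHAR('a)"
proof (rule mp_hom_ext[where f = "\<lambda>P. ev (trunc k e') (twist m P)" and g = "\<lambda>P. ev (trunc k e) P ^ CHAR('a)",
      OF comm_ring_hom_comp[OF ev_hom twist_hom[OF p]] comm_ring_hom_comp[OF frobenius_hom[OF p] ev_hom]])
  fix i
  show "ev (trunc k e') (twist m (mvar i)) = ev (trunc k e) (mvar i) ^ CHAR('a)"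
    using \<open>m \<le> k\<close> lt[of i] ge[of i] prime_gt_0_nat[OF p]
    by (auto simp: twist_mvar[OF p] ev_simps trunc_def power_0_left)
qed (simp add: twist_mconst[OF p])

lemma map_poly_comp:
  assumes "h 0 = 0" "g 0 = 0"
  shows "map_poly h (map_poly g p) = map_poly (\<lambda>x. h (g x)) p"
  by (rule poly_eqI) (simp add: coeff_map_poly assms)

lemma simple_root_twist:
  fixes e e' :: "nat \<Rightarrow> 'a::field"
  assumes p: "prime CHAR('a)"
    and e: "\<And>i. i < m \<Longrightarrow> e' i = e i" "\<And>i. m \<le> i \<Longrightarrow> e' i = e i ^ CHAR('a)" and "m \<le> k"
  shows "simple_root (\<lambda>x. x) k (map_poly (twist m) f) e' \<longleftrightarrow> simple_root (\<lambda>x. x) k f e"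
proof -
  let ?F = "\<lambda>x::'a. x ^ CHAR('a)"
  have pos: "CHAR('a) > 0" using prime_gt_0_nat[OF p] .
  define g where "g = map_poly (ev (trunc k e)) f"
  define g' where "g' = map_poly (ev (trunc k e')) (map_poly (twist m) f)"
  have t0: "twist m 0 = (0 :: 'a mp)" by (rule comm_ring_hom_0[OF twist_hom[OF p]])
  have g': "g' = map_poly ?F g"
    unfolding g_def g'_def using pos
    by (subst map_poly_comp) (simp_all add: t0 ev_simps map_poly_comp power_0_left ev_twist[OF p e assms(4)])
  note F = map_poly_simps[OF frobenius_hom[OF p]]
  have "poly g' (e' k) = poly g (e k) ^ CHAR('a)"
    using F(12)[of g "e k"] by (simp add: g' e(2)[OF assms(4)])
  moreover have "poly (pderiv g') (e' k) = poly (pderiv g) (e k) ^ CHAR('a)"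
    using F(12)[of "pderiv g" "e k"] by (simp add: g' e(2)[OF assms(4)] F(10))
  \<comment> \<open>Injectivity of the twist keeps the degree, so the leading coefficient of the
    twisted polynomial is the twisted leading coefficient.\<close>
  moreover have "lead_coeff (map_poly (twist m) f) = twist m (lead_coeff f)"
  proof -
    have "degree (map_poly (twist m) f) = degree f"
    proof (cases "f = 0")
      case False
      then have "lead_coeff f \<noteq> 0" by simp
      then have "twist m (lead_coeff f) \<noteq> 0" using twist_eq_0[OF p, of m "lead_coeff f"] by blast
      then show ?thesis by (intro map_poly_degree_eq)
    qed simp
    then show ?thesis by (simp add: coeff_map_poly t0)
  qed
  ultimately show ?thesis
    using pos by (simp add: simple_root_def Let_def ev_twist[OF p e assms(4)] flip: g_def g'_def)
qed

lemma otower_twist: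
  fixes e e' :: "nat \<Rightarrow> 'a::field"
  assumes p: "prime CHAR('a)"
    and e: "\<And>i. i < m \<Longrightarrow> e' i = e i" "\<And>i. m \<le> i \<Longrightarrow> e' i = e i ^ CHAR('a)" and "m \<le> k"
  shows "otower k (map (map_option (map_poly (twist m))) \<tau>) e' \<longleftrightarrow> otower k \<tau> e"
  using assms(4)
proof (induct \<tau> arbitrary: k)
  case (Cons a \<tau>)
  then show ?case
    by (cases a) (simp_all add: simple_root_twist[OF p e])
qed simp

text \<open>Summing over the support of \<open>P\<close> rather than up to a degree allows
  reindexing exponents and does not depend on whether \<open>h\<close> kills the leading
  coefficient.\<close>

lemma poly_map_poly_supp:
  fixes h :: "'a::zero \<Rightarrow> 'b::comm_ring_1"
  assumes "h 0 = 0"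
  shows "poly (map_poly h P) x = (\<Sum>j\<in>{j. coeff P j \<noteq> 0}. h (coeff P j) * x ^ j)"
proof -
  have "poly (map_poly h P) x = (\<Sum>j\<le>degree P. h (coeff P j) * x ^ j)"
    by (induct P) (simp_all add: map_poly_pCons assms sum.atMost_Suc_shift sum_distrib_left
        mult_ac degree_pCons_eq_if del: sum.atMost_Suc)
  also have "\<dots> = (\<Sum>j\<in>{j. coeff P j \<noteq> 0}. h (coeff P j) * x ^ j)"
    by (rule sum.mono_neutral_right) (auto simp: assms intro: le_degree)
  finally show ?thesis .
qed

text \<open>\<open>Q\<close> is the polynomial with \<open>P(X) = Q(X^p)\<close>. Taking
  \<open>p\<close>-th powers of the coordinates from \<open>m\<close> on carries the solutions for
  \<open>P\<close> to those of the twisted problem for \<open>Q\<close> and fixes the base point, so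
  both have the same projection. Eliminability for \<open>Q\<close> is a premise, to be supplied by
  the induction on the weight.\<close>

lemma eliminable_mixed_frobenius:
  fixes P :: "'a::field mp poly"
  assumes p: "prime CHAR('a)" and perfect: "surj (\<lambda>x::'a. x ^ CHAR('a))"
    and supp: "\<And>j. coeff P j \<noteq> 0 \<Longrightarrow> CHAR('a) dvd j" and deg: "degree P \<ge> 1"
  obtains Q :: "'a mp poly" where "weight Q < weight P"
    "\<And>m n C \<tau> q. length \<tau> = n \<Longrightarrow> (\<And>C \<tau> q. length \<tau> = n \<Longrightarrow> eliminable m (Suc n) (mixed m C [Q] \<tau> q)) \<Longrightarrow>
      eliminable m (Suc n) (mixed m C [P] \<tau> q)"
proof -
  let ?p = "CHAR('a)"
  have p1: "?p > 1" using prime_gt_1_nat[OF p] .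
  define Q where "Q = (\<Sum>j\<le>degree P. Polynomial.monom (coeff P (?p * j)) j)"
  have cQ: "coeff Q j = coeff P (?p * j)" for j
  proof -
    have "coeff P (?p * j) = 0" if "\<not> j \<le> degree P"
    proof -
      have "1 * j \<le> ?p * j" using p1 by (intro mult_right_mono) auto
      with that show ?thesis by (intro coeff_eq_0) linarith
    qed
    then show ?thesis by (auto simp: Q_def coeff_sum)
  qed
  have inj: "inj_on ((*) ?p) A" for A
    using p1 by (auto simp: inj_on_def)
  have "(\<Sum>j\<in>{j. coeff Q j \<noteq> 0}. (4::nat) ^ j) < (\<Sum>j\<in>{j. coeff P j \<noteq> 0}. 4 ^ j)"
  proof -
    \<comment> \<open>Replacing each exponent \<open>p * j\<close> by \<open>j\<close> never
      increases a summand of the weight, and it decreases the one of the top exponent, which is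
      positive.\<close>
    obtain d where d: "degree P = ?p * d"
      using supp[of "degree P"] deg by (metis dvdE leading_coeff_0_iff degree_0 not_one_le_zero)
    have "(\<Sum>j\<in>{j. coeff Q j \<noteq> 0}. (4::nat) ^ j) < (\<Sum>j\<in>{j. coeff Q j \<noteq> 0}. 4 ^ (?p * j))"
    proof (rule sum_strict_mono_ex1)
      show "\<forall>j\<in>{j. coeff Q j \<noteq> 0}. (4::nat) ^ j \<le> 4 ^ (?p * j)"
        using p1 by (auto intro!: power_increasing)
      have "coeff Q d \<noteq> 0" using deg by (auto simp: cQ simp flip: d)
      moreover have "d > 0" using d deg by (cases d) auto
      then have "(4::nat) ^ d < 4 ^ (?p * d)" using p1 by (intro power_strict_increasing) auto
      ultimately show "\<exists>j\<in>{j. coeff Q j \<noteq> 0}. (4::nat) ^ j < 4 ^ (?p * j)" by blast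
    qed simp
    also have "\<dots> = (\<Sum>j\<in>((*) ?p) ` {j. coeff Q j \<noteq> 0}. 4 ^ j)"
      by (simp add: sum.reindex[OF inj])
    also have "\<dots> \<le> (\<Sum>j\<in>{j. coeff P j \<noteq> 0}. 4 ^ j)"
      by (rule sum_mono2) (auto simp: cQ)
    finally show ?thesis .
  qed
  then have w: "weight Q < weight P" by (simp add: weight_def)
  have PQ: "poly (map_poly h P) x = poly (map_poly h Q) (x ^ ?p)" if h: "h 0 = 0" for h :: "'a mp \<Rightarrow> 'a" and x
  proof -
    have "{j. coeff P j \<noteq> 0} = ((*) ?p) ` {j. coeff Q j \<noteq> 0}"
      using supp by (force simp: cQ)
    then show ?thesis
      by (simp add: poly_map_poly_supp[where h = h, OF h] sum.reindex[OF inj] cQ power_mult)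
  qed
  have main: "eliminable m (Suc n) (mixed m C [P] \<tau> q)"
    if n: "length \<tau> = n" and G: "\<And>C \<tau> q. length \<tau> = n \<Longrightarrow> eliminable m (Suc n) (mixed m C [Q] \<tau> q)" for m n C \<tau> q
  proof -
    let ?\<tau> = "map (map_option (map_poly (twist m))) \<tau>"
    have eq: "mixed m C [P] \<tau> q e \<longleftrightarrow> mixed m C [Q] ?\<tau> (twist m q) e'"
      if e: "\<And>i. i < m \<Longrightarrow> e' i = e i" "\<And>i. m \<le> i \<Longrightarrow> e' i = e i ^ ?p" for e e'
    proof -
      have "trunc m e' = trunc m e" using e by (auto simp: trunc_def)
      moreover have "ev (trunc (Suc (m + length \<tau>)) e') (twist m q) = ev (trunc (Suc (m + length \<tau>)) e) q ^ ?p"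
        by (rule ev_twist[OF p e]) auto
      moreover have "otower (Suc m) ?\<tau> e' = otower (Suc m) \<tau> e"
        by (rule otower_twist[OF p e]) auto
      ultimately show ?thesis
        using p1 by (simp add: mixed_def PQ ev_simps e(2)[of m])
    qed
    show ?thesis
    proof (rule eliminable_iff[OF G])
      show "length ?\<tau> = n" using n by simp
      fix e
      show "fiber m (mixed m C [P] \<tau> q) e \<longleftrightarrow> fiber m (mixed m C [Q] ?\<tau> (twist m q)) e"
      proof
        assume "fiber m (mixed m C [P] \<tau> q) e"
        then obtain e1 where e1: "trunc m e1 = trunc m e" "mixed m C [P] \<tau> q e1" by (auto simp: fiber_def)
        define e' where "e' = (\<lambda>i. if i < m then e1 i else e1 i ^ ?p)"
        have "mixed m C [Q] ?\<tau> (twist m q) e'" using eq[of e' e1] e1 by (simp add: e'_def)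
        moreover have "trunc m e' = trunc m e" using e1 by (simp add: trunc_Suc_eq e'_def)
        ultimately show "fiber m (mixed m C [Q] ?\<tau> (twist m q)) e" by (auto simp: fiber_def)
      next
        assume "fiber m (mixed m C [Q] ?\<tau> (twist m q)) e"
        then obtain e1 where e1: "trunc m e1 = trunc m e" "mixed m C [Q] ?\<tau> (twist m q) e1" by (auto simp: fiber_def)
        \<comment> \<open>Perfectness enters here: the way back from the twisted problem takes
          \<open>p\<close>-th roots of the quantified coordinates.\<close>
        have "\<exists>r. \<forall>x::'a. r x ^ ?p = x" using perfect by (metis surjD)
        then obtain r where r: "\<And>x::'a. r x ^ ?p = x" by blast
        define e' where "e' = (\<lambda>i. if i < m then e1 i else r (e1 i))"
        have "mixed m C [P] \<tau> q e'" using eq[of e1 e'] e1 by (simp add: e'_def r)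
        moreover have "trunc m e' = trunc m e" using e1 by (simp add: trunc_Suc_eq e'_def)
        ultimately show "fiber m (mixed m C [P] \<tau> q) e" by (auto simp: fiber_def)
      qed
    qed
  qed
  show thesis
    by (rule that[OF w]) (rule main)
qed

section \<open>Reduction of the equations in one coordinate to a single separable one\<close>

lemma perfect_surj:
  assumes "perfect_field TYPE('k::field)" "CHAR('k) > 0"
  shows "surj (\<lambda>x::'k. x ^ CHAR('k))"
  using assms by (simp add: perfect_field_def)

text \<open>A further inequation on the base is absorbed into \<open>q\<close> by a product. In this
  way case distinctions on leading coefficients never create a second inequation.\<close>

lemma mixed_mult:
  "mixed m C Ps \<tau> (q * ret m c) e \<longleftrightarrow> mixed m C Ps \<tau> q e \<and> ev (trunc m e) c \<noteq> 0"
proof -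
  have "ev (trunc (Suc m + length \<tau>) e) (ret m c) = ev (trunc m e) c"
    by (simp add: mval_ret[OF comm_ring_hom_id] min_def)
  then show ?thesis by (auto simp: mixed_def ev_simps)
qed

lemma eliminable_subst: "eliminable m n Q \<Longrightarrow> (\<And>e. P e \<longleftrightarrow> Q e) \<Longrightarrow> eliminable m n P"
  by (rule eliminable_iff) (auto simp: fiber_def)

text \<open>A Euclidean algorithm with parameters, by induction on the total weight. Each division
  splits into the locus where the leading coefficient of the divisor vanishes, where a term can be
  deleted, and its complement, where pseudo-division loses no information.\<close>

lemma eliminable_mixed:
  fixes Ps :: "'k::field mp poly list"
  assumes perfect: "perfect_field TYPE('k)"
  shows "length \<tau> = n \<Longrightarrow> eliminable m (Suc n) (mixed m C Ps \<tau> q)"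
proof (induct "sum_list (map weight Ps)" arbitrary: Ps C \<tau> q rule: less_induct)
  case less
  note IH = less(1) and n = less(2)
  let ?ev = "\<lambda>e. ev (trunc m e) :: 'k mp \<Rightarrow> 'k"
  let ?val = "\<lambda>p e. poly (map_poly (?ev e) p) (e m)"
  note evp = map_poly_simps[OF ev_hom]
  have ls: "?val (lead_step p r) e = ?ev e (lead_coeff r) * ?val p e
      - ?ev e (lead_coeff p) * e m ^ (degree p - degree r) * ?val r e" for p r :: "'k mp poly" and e
    by (simp add: map_poly_lead_step[OF ev_hom] poly_monom)
  have rm: "?val (p - Polynomial.monom (coeff p j) j) e = ?val p e - ?ev e (coeff p j) * e m ^ j" for p :: "'k mp poly" and e j
    by (simp add: evp poly_monom)
  have split: "eliminable m (Suc n) (\<lambda>e. mixed m C Ps \<tau> q e \<and> ?ev e c = 0)"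
    if "eliminable m (Suc n) (mixed m (c # C) Ps \<tau> q)" for C c Ps q
    using that by (rule eliminable_subst) (auto simp: mixed_def)
  show ?case
  proof (cases "\<exists>p\<in>set Ps. degree p = 0")
    case True
    then obtain c As Bs where Ps: "Ps = As @ [:c:] # Bs"
      by (metis split_list degree_eq_zeroE)
    \<comment> \<open>A constant polynomial is a condition on the base. The summand 1 in
      \<open>weight\<close> lets even the zero polynomial count, so moving it to \<open>C\<close> is
      progress.\<close>
    have "eliminable m (Suc n) (mixed m (c # C) (As @ Bs) \<tau> q)"
      by (rule IH) (simp_all add: Ps n weight_pos)
    then show ?thesis
      by (rule eliminable_subst) (auto simp: mixed_def Ps evp)
  next
    case False
    then have deg: "degree p \<ge> 1" if "p \<in> set Ps" for p using that by (metis less_one not_le)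
    consider "Ps = []" | p where "Ps = [p]" | p r Rs where "set Ps = set (p # r # Rs)" "degree r \<le> degree p"
      "sum_list (map weight Ps) = sum_list (map weight (p # r # Rs))"
    proof (cases Ps)
      case (Cons a As)
      show ?thesis
      proof (cases As)
        case Nil
        with Cons that show ?thesis by blast
      next
        case As: (Cons b Bs)
        show ?thesis
        proof (cases "degree b \<le> degree a")
          case True
          with Cons As that(3)[of a b Bs] show ?thesis by simp
        next
          case False
          with Cons As that(3)[of b a Bs] show ?thesis by (simp add: insert_commute)
        qed
      qed
    qed (use that in blast)
    then show ?thesis
    proof cases
      case 1
      have "eliminable m (Suc n) (basic m C (None # \<tau>) q)" by (rule eliminable_basic) (simp add: n)
      then show ?thesis by (rule eliminable_subst) (simp add: mixed_def basic_def 1)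
    next
      case (3 p r Rs)
      have degs: "degree p \<ge> 1" "degree r \<ge> 1" using deg 3 by auto
      \<comment> \<open>Where the leading coefficient of \<open>r\<close> vanishes, its leading term
        is dropped (X); elsewhere \<open>p\<close> is replaced by its pseudo-remainder step
        (Y).\<close>
      let ?c = "lead_coeff r" and ?r = "r - Polynomial.monom (lead_coeff r) (degree r)"
      have "weight ?r < weight r" using degs by (intro weight_remove) auto
      then have "eliminable m (Suc n) (mixed m (?c # C) (p # ?r # Rs) \<tau> q)"
        by (intro IH) (simp_all add: 3 n)
      then have X: "eliminable m (Suc n) (\<lambda>e. mixed m C Ps \<tau> q e \<and> ?ev e ?c = 0)"
        by (rule eliminable_subst) (auto simp: mixed_def 3 rm simp del: poly_diff)
      have Y: "eliminable m (Suc n) (\<lambda>e. mixed m C Ps \<tau> q e \<and> ?ev e ?c \<noteq> 0)"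
      proof -
        have "3 * weight (lead_step p r) \<le> 2 + 4 ^ degree p"
          by (rule weight_less) (rule lead_step_degree[OF 3(2)])
        moreover have "4 ^ degree p < weight p"
          using degs by (intro weight_lead) auto
        ultimately have "weight (lead_step p r) < weight p" by linarith
        then have "eliminable m (Suc n) (mixed m C (lead_step p r # r # Rs) \<tau> (q * ret m ?c))"
          by (intro IH) (simp_all add: 3 n)
        then show ?thesis
          by (rule eliminable_subst) (auto simp: mixed_mult, auto simp: mixed_def 3 ls)
      qed
      show ?thesis
        by (rule eliminable_subst[OF eliminable_disj[OF X Y]]) auto
    next
      case (2 p)
      have d: "degree p \<ge> 1" using deg 2 by auto
      let ?c = "lead_coeff p" and ?p' = "p - Polynomial.monom (lead_coeff p) (degree p)"
      have "eliminable m (Suc n) (mixed m (?c # C) [?p'] \<tau> q)"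
      proof (rule IH)
        have "weight ?p' < weight p" using d by (intro weight_remove) auto
        then show "sum_list (map weight [?p']) < sum_list (map weight Ps)" by (simp add: 2)
      qed (rule n)
      then have A: "eliminable m (Suc n) (\<lambda>e. mixed m C Ps \<tau> q e \<and> ?ev e ?c = 0)"
        by (rule eliminable_subst) (auto simp: mixed_def 2 rm simp del: poly_diff)
      show ?thesis
      proof (cases "pderiv p = 0")
        case True
        have of_nat: "(of_nat j :: 'k mp) = mconst (of_nat j)" for j
          by (simp add: mconst_simps)
        \<comment> \<open>If the derivative is 0, every exponent that occurs is 0 in
          \<open>K\<close>. Since the degree is positive, this also shows that the characteristic is
          not 0.\<close>
        have dvd: "CHAR('k) dvd j" if "coeff p j \<noteq> 0" for j
        proof (cases j)
          case (Suc i)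
          have "of_nat (Suc i) * coeff p (Suc i) = 0"
            using True by (metis coeff_0 coeff_pderiv)
          with that Suc have "of_nat j = (0 :: 'k mp)" by (simp del: of_nat_Suc)
          then have "CHAR('k mp) dvd j" by (simp only: of_nat_eq_0_iff_char_dvd)
          then show ?thesis by (simp add: CHAR_mp)
        qed simp
        have "CHAR('k) dvd degree p" using d by (intro dvd) auto
        then have "CHAR('k) > 0" using d by (metis dvd_0_left_iff gr0I not_one_le_zero)
        then have "prime CHAR('k)" "surj (\<lambda>x::'k. x ^ CHAR('k))"
          by (rule prime_CHAR_semidom) (rule perfect_surj[OF perfect \<open>CHAR('k) > 0\<close>])
        from eliminable_mixed_frobenius[OF this dvd d] obtain Q :: "'k mp poly" where Q: "weight Q < weight p"
          "\<And>m n C \<tau> q. length \<tau> = n \<Longrightarrow> (\<And>C \<tau> q. length \<tau> = n \<Longrightarrow> eliminable m (Suc n) (mixed m C [Q] \<tau> q)) \<Longrightarrow>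
            eliminable m (Suc n) (mixed m C [p] \<tau> q)"
          by blast
        show ?thesis unfolding 2
          by (rule Q(2)[OF n], rule IH) (simp_all add: 2 Q(1))
      next
        case False
        define r where "r = pderiv p"
        have "degree r \<le> degree p - 1"
          unfolding r_def by (rule degree_le) (auto simp: coeff_pderiv coeff_eq_0)
        then have deg_r: "degree r < degree p" using d by linarith
        \<comment> \<open>The exponent in \<open>p\<close> from which the leading term of the
          derivative \<open>r\<close> stems. As \<open>j\<close> is nonzero in \<open>K\<close>, the
          leading coefficient of \<open>r\<close> vanishes at a point exactly when
          \<open>coeff p j\<close> does, and then this term can be deleted from
          \<open>p\<close>.\<close>
        define j where "j = Suc (degree r)"
        have lr: "lead_coeff r = of_nat j * coeff p j" unfolding r_def j_def by (simp add: coeff_pderiv r_def)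
        have "lead_coeff r \<noteq> 0" using False by (simp add: r_def)
        then have cj: "coeff p j \<noteq> 0" and "of_nat j \<noteq> (0 :: 'k mp)" by (auto simp: lr)
        then have ofj: "of_nat j \<noteq> (0 :: 'k)" by (simp only: of_nat_eq_0_iff_char_dvd CHAR_mp) simp
        let ?p2 = "p - Polynomial.monom (coeff p j) j"
        have "eliminable m (Suc n) (mixed m (coeff p j # C) [?p2] \<tau> q)"
          by (rule IH) (simp_all add: 2 n weight_remove[OF cj])
        then have B: "eliminable m (Suc n) (\<lambda>e. mixed m C Ps \<tau> q e \<and> ?ev e (lead_coeff r) = 0)"
          by (rule eliminable_subst) (auto simp: mixed_def 2 rm lr ev_simps ofj simp del: poly_diff)
        have "eliminable m (Suc n) (mixed m C [lead_step p r, r] \<tau> (q * ret m (lead_coeff r)))"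
        proof (rule IH)
          \<comment> \<open>With \<open>d = degree p\<close>, the two new polynomials weigh at most
            \<open>(2 + 4^d) / 3\<close> each, together at most \<open>4^d\<close> because
            \<open>4 <= 4^d\<close>; and \<open>4^d < weight p\<close>.\<close>
          have "3 * weight (lead_step p r) \<le> 2 + 4 ^ degree p"
            by (rule weight_less, rule lead_step_degree) (use deg_r in simp)
          moreover have "3 * weight r \<le> 2 + 4 ^ degree p"
            by (rule weight_less) (use deg_r in simp)
          moreover have "4 ^ degree p < weight p"
            using d by (intro weight_lead) auto
          moreover have "(4::nat) \<le> 4 ^ degree p" using d self_le_power[of "4::nat" "degree p"] by simp
          ultimately show "sum_list (map weight [lead_step p r, r]) < sum_list (map weight Ps)"
            by (simp add: 2)
        qed (rule n)
        then have C: "eliminable m (Suc n) (\<lambda>e. mixed m C Ps \<tau> q e \<and> ?val r e = 0 \<and> ?ev e (lead_coeff r) \<noteq> 0)"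
          by (rule eliminable_subst) (auto simp: mixed_mult, auto simp: mixed_def 2 ls)
        \<comment> \<open>On what is left, neither the derivative nor the leading coefficient of
          \<open>p\<close> vanishes, so the coordinate is a simple root and the tower grows by one
          step.\<close>
        have "eliminable m (Suc n) (basic m C (Some p # \<tau>) q)" by (rule eliminable_basic) (simp add: n)
        then have D: "eliminable m (Suc n) (\<lambda>e. mixed m C Ps \<tau> q e \<and> ?val r e \<noteq> 0 \<and> ?ev e ?c \<noteq> 0)"
          by (rule eliminable_subst) (auto simp: mixed_def basic_def simple_root_def Let_def 2 r_def evp)
        show ?thesis
          by (rule eliminable_subst[OF eliminable_disj[OF eliminable_disj[OF A B] eliminable_disj[OF C D]]]) auto
      qed
    qed
  qed
qed

text \<open>The coefficients are retracted first, so that \<open>f\<close> is read over the first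
  \<open>k\<close> variables only, in agreement with \<open>trunc k\<close> in
  \<open>simple_root\<close>.\<close>

definition emb :: "nat \<Rightarrow> 'a::comm_ring_1 mp poly \<Rightarrow> 'a mp" where
  "emb k f = poly (map_poly (ret k) f) (mvar k)"

lemma emb_below: "emb k f \<in> below (Suc k)"
  unfolding emb_def by (rule below_poly_mvar[where k = k]) (simp_all add: coeff_map_poly ret_simps)

lemma mval_emb:
  fixes h :: "'a::idom \<Rightarrow> 'b::idom"
  assumes h: "comm_ring_hom h"
  shows "mval h e (emb k f) = poly (map_poly (mval h (trunc k e)) f) (e k)"
proof -
  have "mval h e (emb k f) = poly (map_poly (mval h e) (map_poly (ret k) f)) (e k)"
    using map_poly_simps(12)[OF mval_hom[OF h], of e "map_poly (ret k) f" "mvar k"]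
    by (simp add: emb_def comm_ring_hom_0[OF h] comm_ring_hom_1[OF h])
  also have "map_poly (mval h e) (map_poly (ret k) f) = map_poly (mval h (trunc k e)) f"
    by (subst map_poly_comp) (simp_all add: mval_ret[OF h] ret_simps mval_simps[OF h])
  finally show ?thesis .
qed

lemma simple_root_iff:
  assumes h: "comm_ring_hom h"
  shows "simple_root h k f e \<longleftrightarrow> mval h e (emb k f) = 0 \<and> mval h e (emb k (pderiv f)) \<noteq> 0 \<and>
    mval h e (ret k (lead_coeff f)) \<noteq> 0"
  by (simp add: simple_root_def Let_def mval_emb[OF h] mval_ret[OF h] map_poly_simps[OF mval_hom[OF h]])

section \<open>Elimination of all quantified coordinates\<close>

lemma eliminable_finite_disj:
  assumes "finite B" "\<And>b. b \<in> B \<Longrightarrow> eliminable m n (P b)"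
  shows "eliminable m n (\<lambda>e. \<exists>b\<in>B. P b e)"
  using assms
proof (induct B rule: finite_induct)
  case empty
  show ?case unfolding eliminable_def by (rule exI[of _ "{}"]) (auto simp: fiber_def)
next
  case (insert b B)
  then show ?case using eliminable_disj[of m n "P b" "\<lambda>e. \<exists>b\<in>B. P b e"] by simp
qed

lemma fiber_Suc: "fiber m P e \<longleftrightarrow> fiber m (fiber (Suc m) P) e"
  unfolding fiber_def trunc_Suc_eq by (metis less_Suc_eq)

text \<open>Equations on a base of dimension \<open>m + 1\<close> are univariate equations in
  coordinate \<open>m\<close> over a base of dimension \<open>m\<close>, which is the situation of
  \<open>mixed\<close>.\<close>

lemma eliminable_basic_Suc:
  fixes C :: "'k::field mp list"
  assumes perfect: "perfect_field TYPE('k)" and n: "length \<tau> = n"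
  shows "eliminable m (Suc n) (basic (Suc m) C \<tau> q)"
proof -
  have "\<exists>c'. \<forall>e. ev (trunc (Suc m) e) c = poly (map_poly (ev (trunc m e)) c') (e m)" for c :: "'k mp"
  proof -
    obtain c' where c': "ret (Suc m) c = poly c' (mvar m)" "\<And>j. coeff c' j \<in> below m"
      using below_Suc_poly[OF ret_below] by blast
    have "map_poly (ret m) c' = c'"
      by (rule poly_eqI) (simp add: coeff_map_poly ret_simps ret_id[OF c'(2)])
    then have "emb m c' = ret (Suc m) c" by (simp add: emb_def c')
    then have "ev (trunc (Suc m) e) c = poly (map_poly (ev (trunc m e)) c') (e m)" for e
      using mval_ret[OF comm_ring_hom_id, of e "Suc m" c] mval_emb[OF comm_ring_hom_id, of e m c'] by simp
    then show ?thesis by blast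
  qed
  then obtain F where F: "\<And>(c :: 'k mp) e. ev (trunc (Suc m) e) c = poly (map_poly (ev (trunc m e)) (F c)) (e m)"
    by metis
  show ?thesis
    by (rule eliminable_subst[OF eliminable_mixed[OF perfect n, of m "[]" "map F C" q]])
      (simp add: basic_def mixed_def F)
qed

text \<open>The last coordinates go first: the induction hypothesis for \<open>Suc m\<close> builds
  a tower above coordinate \<open>m\<close>, whose base equations still involve \<open>m\<close>.
  Treating that coordinate then leaves the tower above it in place up to twists.\<close>

theorem eliminable_system:
  fixes q :: "'k::field mp"
  assumes perfect: "perfect_field TYPE('k)"
  shows "eliminable m n (\<lambda>e. (\<forall>p\<in>set Ps. ev (trunc (m + n) e) p = 0) \<and> ev (trunc (m + n) e) q \<noteq> 0)"
proof (induct n arbitrary: m)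
  case 0
  show ?case by (rule eliminable_subst[OF eliminable_basic[of "[]"]]) (auto simp: basic_def)
next
  case (Suc n)
  let ?P = "\<lambda>e. (\<forall>p\<in>set Ps. ev (trunc (m + Suc n) e) p = 0) \<and> ev (trunc (m + Suc n) e) q \<noteq> 0"
  define T where "T b = basic (Suc m) (fst b) (fst (snd b)) (snd (snd b))"
    for b :: "'k mp list \<times> 'k mp poly option list \<times> 'k mp"
  from Suc[of "Suc m"] obtain B where "finite B" and "\<forall>(C, \<tau>, q)\<in>B. length \<tau> = n"
    and "\<forall>e. fiber (Suc m) ?P e \<longleftrightarrow> (\<exists>(C, \<tau>, q)\<in>B. fiber (Suc m) (basic (Suc m) C \<tau> q) e)"
    unfolding eliminable_def by auto
  then have B: "finite B" "\<And>b. b \<in> B \<Longrightarrow> length (fst (snd b)) = n"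
    "\<And>e. fiber (Suc m) ?P e \<longleftrightarrow> (\<exists>b\<in>B. fiber (Suc m) (T b) e)"
    by (auto simp: T_def case_prod_beta)
  have "eliminable m (Suc n) (\<lambda>e. \<exists>b\<in>B. T b e)"
    unfolding T_def by (rule eliminable_finite_disj[OF B(1) eliminable_basic_Suc[OF perfect B(2)]])
  then show ?case
  proof (rule eliminable_iff)
    fix e
    have "fiber m ?P e \<longleftrightarrow> fiber m (fiber (Suc m) ?P) e" by (rule fiber_Suc)
    also have "fiber (Suc m) ?P = (\<lambda>e. \<exists>b\<in>B. fiber (Suc m) (T b) e)"
      by (rule ext) (rule B(3))
    also have "fiber m (\<lambda>e. \<exists>b\<in>B. fiber (Suc m) (T b) e) e \<longleftrightarrow> (\<exists>b\<in>B. fiber m (fiber (Suc m) (T b)) e)"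
      unfolding fiber_def by blast
    also have "\<dots> \<longleftrightarrow> (\<exists>b\<in>B. fiber m (T b) e)"
      by (simp flip: fiber_Suc)
    also have "\<dots> \<longleftrightarrow> fiber m (\<lambda>e. \<exists>b\<in>B. T b e) e"
      unfolding fiber_def by blast
    finally show "fiber m ?P e \<longleftrightarrow> fiber m (\<lambda>e. \<exists>b\<in>B. T b e) e" .
  qed
qed

section \<open>Definability\<close>

lemma rterm_val_cong: "(\<And>i. i \<in> rterm_vars t \<Longrightarrow> e i = e' i) \<Longrightarrow> rterm_val e t = rterm_val e' t"
  by (induct t) auto

lemma rform_sat_cong: "(\<And>i. i \<in> rform_free \<phi> \<Longrightarrow> e i = e' i) \<Longrightarrow> rform_sat e \<phi> = rform_sat e' \<phi>"
proof (induct \<phi> arbitrary: e e')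
  case (FEq s t)
  then show ?case using rterm_val_cong[of s e e'] rterm_val_cong[of t e e'] by simp
next
  case (FEx i \<phi>)
  have "rform_sat (e(i := v)) \<phi> = rform_sat (e'(i := v)) \<phi>" for v
    by (rule FEx(1)) (use FEx(2) in auto)
  then show ?case by simp
next
  case (FNeg \<phi>)
  from FNeg(1)[of e e'] FNeg(2) show ?case by simp
next
  case (FConj \<phi> \<psi>)
  from FConj(1)[of e e'] FConj(2)[of e e'] FConj(3) show ?case by simp
qed

section \<open>Quantifier-free formulas as disjunctions of polynomial systems\<close>

primrec rterm_mp :: "'k::field rterm \<Rightarrow> 'k mp" where
  "rterm_mp (RVar i) = mvar i"
| "rterm_mp (RPar c) = mconst c"
| "rterm_mp (RAdd s t) = rterm_mp s + rterm_mp t"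
| "rterm_mp (RMul s t) = rterm_mp s * rterm_mp t"
| "rterm_mp (RNeg t) = - rterm_mp t"

lemma ev_rterm_mp: "ev e (rterm_mp t) = rterm_val e t"
  by (induct t) (simp_all add: ev_simps)

definition system :: "('k::field mp list \<times> 'k mp) set \<Rightarrow> (nat \<Rightarrow> 'k) \<Rightarrow> bool" where
  "system B e \<longleftrightarrow> (\<exists>(Ps, q)\<in>B. (\<forall>p\<in>set Ps. ev e p = 0) \<and> ev e q \<noteq> 0)"

text \<open>Conjunction distributes over the disjunctions, and two inequations merge into one
  product since a field has no zero divisors.\<close>

lemma system_conj:
  assumes "finite A" "finite B"
  shows "\<exists>D. finite D \<and> (\<forall>e. system D e \<longleftrightarrow> system A e \<and> system B e)"
proof (intro exI conjI allI)
  let ?D = "(\<lambda>((Ps, q), (Rs, r)). (Ps @ Rs, q * r)) ` (A \<times> B)"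
  show "finite ?D" using assms by simp
  fix e
  show "system ?D e \<longleftrightarrow> system A e \<and> system B e"
    unfolding system_def by (fastforce simp: ev_simps split: prod.splits)
qed

text \<open>The formula and its negation are treated together, as the induction passes through
  \<open>FNeg\<close>.\<close>

lemma system_quantifier_free:
  "quantifier_free \<phi> \<Longrightarrow> (\<exists>B. finite B \<and> (\<forall>e. rform_sat e \<phi> \<longleftrightarrow> system B e)) \<and>
    (\<exists>B. finite B \<and> (\<forall>e. \<not> rform_sat e \<phi> \<longleftrightarrow> system B e))"
proof (induct \<phi>)
  case (FEq s t)
  let ?p = "rterm_mp s - rterm_mp t"
  show ?case
    by (intro conjI exI[of _ "{([?p], 1)}"] exI[of _ "{([], ?p)}"])
      (auto simp: system_def ev_simps ev_rterm_mp)
next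
  case (FNeg \<phi>)
  then show ?case by auto
next
  case (FConj \<phi> \<psi>)
  then obtain A B A' B' where fin: "finite A" "finite B" "finite A'" "finite B'"
    and sat: "\<And>e. rform_sat e \<phi> \<longleftrightarrow> system A e" "\<And>e. rform_sat e \<psi> \<longleftrightarrow> system B e"
    "\<And>e. \<not> rform_sat e \<phi> \<longleftrightarrow> system A' e" "\<And>e. \<not> rform_sat e \<psi> \<longleftrightarrow> system B' e"
    by auto
  have un: "system (A' \<union> B') e \<longleftrightarrow> system A' e \<or> system B' e" for e
    by (auto simp: system_def)
  obtain D where D: "finite D" "\<And>e. system D e \<longleftrightarrow> system A e \<and> system B e"
    using system_conj[OF fin(1,2)] by blast
  show ?case
  proof (intro conjI)
    show "\<exists>B. finite B \<and> (\<forall>e. rform_sat e (FConj \<phi> \<psi>) \<longleftrightarrow> system B e)"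
      by (intro exI[of _ D]) (simp add: D sat(1,2))
    show "\<exists>B. finite B \<and> (\<forall>e. \<not> rform_sat e (FConj \<phi> \<psi>) \<longleftrightarrow> system B e)"
      by (intro exI[of _ "A' \<union> B'"]) (auto simp: fin un simp flip: sat(3,4))
  qed
qed simp

text \<open>\<open>nth\<close> is unspecified beyond the end of a list; the padding by 0 matches
  \<open>trunc\<close>.\<close>

definition lenv :: "'k::zero list \<Rightarrow> nat \<Rightarrow> 'k" where
  "lenv a = (\<lambda>i. if i < length a then a ! i else 0)"

lemma existentially_definable_basic:
  fixes S :: "'k::field list set"
  assumes perfect: "perfect_field TYPE('k)" and S: "existentially_definable m S"
  obtains B where "finite B" "S = (\<Union>(C, \<tau>, q)\<in>B. {a \<in> affine_points m. fiber m (basic m C \<tau> q) (lenv a)})"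
proof -
  from S obtain n \<phi> where \<phi>: "quantifier_free \<phi>" "rform_free \<phi> \<subseteq> {..<m + n}"
    "S = {a \<in> affine_points m. \<exists>b\<in>affine_points n. rform_sat (nth (a @ b)) \<phi>}"
    unfolding existentially_definable_def by blast
  obtain A where A: "finite A" "\<And>e. rform_sat e \<phi> \<longleftrightarrow> system A e"
    using system_quantifier_free[OF \<phi>(1)] by blast
  have "eliminable m n (\<lambda>e. system A (trunc (m + n) e))"
  proof (rule eliminable_subst)
    show "eliminable m n (\<lambda>e. \<exists>b\<in>A. (\<forall>p\<in>set (fst b). ev (trunc (m + n) e) p = 0) \<and> ev (trunc (m + n) e) (snd b) \<noteq> 0)"
      by (rule eliminable_finite_disj[OF A(1) eliminable_system[OF perfect]])
  qed (auto simp: system_def case_prod_beta)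
  then obtain B where B: "finite B"
    "\<And>e. fiber m (\<lambda>e. system A (trunc (m + n) e)) e \<longleftrightarrow> (\<exists>(C, \<tau>, q)\<in>B. fiber m (basic m C \<tau> q) e)"
    unfolding eliminable_def by blast
  have "(\<exists>b\<in>affine_points n. rform_sat (nth (a @ b)) \<phi>) \<longleftrightarrow> fiber m (\<lambda>e. system A (trunc (m + n) e)) (lenv a)"
    if a: "a \<in> affine_points m" for a
  proof
    assume "\<exists>b\<in>affine_points n. rform_sat (nth (a @ b)) \<phi>"
    then obtain b where b: "length b = n" "rform_sat (nth (a @ b)) \<phi>" by (auto simp: affine_points_def)
    have "rform_sat (lenv (a @ b)) \<phi>"
      using b(2) by (rule iffD1[OF rform_sat_cong, rotated]) (use \<phi>(2) b(1) a in \<open>auto simp: lenv_def affine_points_def\<close>)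
    moreover have "trunc (m + n) (lenv (a @ b)) = lenv (a @ b)"
      using a b(1) by (auto simp: lenv_def affine_points_def trunc_def)
    moreover have "trunc m (lenv (a @ b)) = trunc m (lenv a)"
      using a by (auto simp: lenv_def affine_points_def trunc_def nth_append)
    ultimately show "fiber m (\<lambda>e. system A (trunc (m + n) e)) (lenv a)"
      unfolding fiber_def A(2)[symmetric] by (intro exI[of _ "lenv (a @ b)"]) simp
  next
    assume "fiber m (\<lambda>e. system A (trunc (m + n) e)) (lenv a)"
    then obtain e where e: "trunc m e = trunc m (lenv a)" "rform_sat (trunc (m + n) e) \<phi>"
      by (auto simp: fiber_def A(2))
    define b where "b = map (\<lambda>i. e (m + i)) [0..<n]"
    have "(a @ b) ! i = trunc (m + n) e i" if "i < m + n" for i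
      using that e(1) a unfolding trunc_Suc_eq
      by (auto simp: b_def nth_append lenv_def affine_points_def trunc_def)
    then have "rform_sat (nth (a @ b)) \<phi> = rform_sat (trunc (m + n) e) \<phi>"
      by (intro rform_sat_cong) (use \<phi>(2) in auto)
    then have "rform_sat (nth (a @ b)) \<phi>" using e(2) by simp
    then show "\<exists>b\<in>affine_points n. rform_sat (nth (a @ b)) \<phi>"
      by (intro bexI[of _ b]) (auto simp: b_def affine_points_def)
  qed
  then have "S = (\<Union>(C, \<tau>, q)\<in>B. {a \<in> affine_points m. fiber m (basic m C \<tau> q) (lenv a)})"
    unfolding \<phi>(3) by (simp add: B(2) case_prod_beta) blast
  with B(1) show thesis by (rule that)
qed

text \<open>Definability of a predicate on padded environments. Its closure properties replace the
  writing of explicit formulas.\<close>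

definition pdef :: "nat \<Rightarrow> ((nat \<Rightarrow> 'k::field) \<Rightarrow> bool) \<Rightarrow> bool" where
  "pdef N P \<longleftrightarrow> (\<exists>\<phi>. rform_free \<phi> \<subseteq> {..<N} \<and> (\<forall>e. rform_sat e \<phi> \<longleftrightarrow> P (trunc N e)))"

lemma below_rterm:
  "p \<in> below N \<Longrightarrow> \<exists>t. rterm_vars t \<subseteq> {..<N} \<and> (\<forall>e. rterm_val e t = ev e p)"
proof (induct p rule: below_induct)
  case (const c)
  show ?case by (rule exI[of _ "RPar c"]) simp
next
  case (var i)
  then show ?case by (intro exI[of _ "RVar i"]) simp
next
  case (add p q)
  then obtain s t where "rterm_vars s \<subseteq> {..<N} \<and> (\<forall>e. rterm_val e s = ev e p)"
    "rterm_vars t \<subseteq> {..<N} \<and> (\<forall>e. rterm_val e t = ev e q)" by blast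
  then show ?case by (intro exI[of _ "RAdd s t"]) (simp add: ev_simps)
next
  case (mult p q)
  then obtain s t where "rterm_vars s \<subseteq> {..<N} \<and> (\<forall>e. rterm_val e s = ev e p)"
    "rterm_vars t \<subseteq> {..<N} \<and> (\<forall>e. rterm_val e t = ev e q)" by blast
  then show ?case by (intro exI[of _ "RMul s t"]) (simp add: ev_simps)
qed

lemma pdef_zero: "pdef N (\<lambda>e. ev e p = 0)"
proof -
  obtain t where t: "rterm_vars t \<subseteq> {..<N}" "\<And>e. rterm_val e t = ev e (ret N p)"
    using below_rterm[OF ret_below] by blast
  then show ?thesis
    unfolding pdef_def
    by (intro exI[of _ "FEq t (RPar 0)"]) (simp add: mval_ret[OF comm_ring_hom_id])
qed

lemma pdef_neg: "pdef N P \<Longrightarrow> pdef N (\<lambda>e. \<not> P e)"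
  unfolding pdef_def by (metis rform_sat.simps(2) rform_free.simps(2))

lemma pdef_conj: "pdef N P \<Longrightarrow> pdef N Q \<Longrightarrow> pdef N (\<lambda>e. P e \<and> Q e)"
  unfolding pdef_def by (metis rform_sat.simps(3) rform_free.simps(3) Un_least)

lemma pdef_True: "pdef N (\<lambda>e. True)"
  using pdef_zero[of N 0] by (simp add: ev_simps)

lemma pdef_ball: "(\<And>x. x \<in> set xs \<Longrightarrow> pdef N (P x)) \<Longrightarrow> pdef N (\<lambda>e. \<forall>x\<in>set xs. P x e)"
  by (induct xs) (auto simp: pdef_True intro: pdef_conj)

lemma pdef_ex:
  assumes "pdef (Suc N) P"
  shows "pdef N (\<lambda>e. \<exists>v. P (e(N := v)))"
proof -
  from assms obtain \<phi> where \<phi>: "rform_free \<phi> \<subseteq> {..<Suc N}" "\<And>e. rform_sat e \<phi> \<longleftrightarrow> P (trunc (Suc N) e)"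
    unfolding pdef_def by blast
  have "trunc (Suc N) (e(N := v)) = (trunc N e)(N := v)" for e :: "nat \<Rightarrow> 'a" and v
    by (auto simp: trunc_def fun_eq_iff)
  with \<phi> show ?thesis
    unfolding pdef_def by (intro exI[of _ "FEx N \<phi>"]) (auto simp: less_Suc_eq)
qed

text \<open>One quantifier for each coordinate from \<open>m + n - 1\<close> down to
  \<open>m\<close>. The coordinates beyond these are irrelevant, since \<open>P\<close> only sees
  the truncated environment.\<close>

lemma pdef_fiber:
  "pdef (m + n) P \<Longrightarrow> pdef m (fiber m (\<lambda>e. P (trunc (m + n) e)))"
proof (induct n arbitrary: P)
  case 0
  have "fiber m (\<lambda>e. P (trunc m e)) (trunc m e) \<longleftrightarrow> P (trunc m e)" for e
    by (auto simp: fiber_def)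
  with 0 show ?case by (simp add: pdef_def)
next
  case (Suc n)
  have "pdef (m + n) (\<lambda>e. \<exists>v. P (e(m + n := v)))"
    by (rule pdef_ex) (use Suc(2) in simp)
  from Suc(1)[OF this]
  have "pdef m (fiber m (\<lambda>e. \<exists>v. P ((trunc (m + n) e)(m + n := v))))" .
  moreover have "fiber m (\<lambda>e. \<exists>v. P ((trunc (m + n) e)(m + n := v))) = fiber m (\<lambda>e. P (trunc (m + Suc n) e))"
  proof
    fix e
    have t: "trunc (m + Suc n) (e(m + n := v)) = (trunc (m + n) e)(m + n := v)" for e :: "nat \<Rightarrow> 'a" and v
      by (auto simp: trunc_def fun_eq_iff)
    have "trunc m (e(m + n := v)) = trunc m e" for e :: "nat \<Rightarrow> 'a" and v
      by (auto simp: trunc_def fun_eq_iff)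
    then show "fiber m (\<lambda>e. \<exists>v. P ((trunc (m + n) e)(m + n := v))) e = fiber m (\<lambda>e. P (trunc (m + Suc n) e)) e"
      unfolding fiber_def t[symmetric] by (metis fun_upd_triv)
  qed
  ultimately show ?case by simp
qed

lemma otower_trunc:
  fixes e :: "nat \<Rightarrow> 'k::field"
  shows "k + length \<tau> \<le> N \<Longrightarrow> otower k \<tau> (trunc N e) = otower k \<tau> e"
proof (induct \<tau> arbitrary: k)
  case (Cons a \<tau>)
  have "trunc k (trunc N e) = trunc k e" "trunc N e k = e k" using Cons(2) by (auto simp: trunc_def)
  then have "simple_root (\<lambda>x. x) k f (trunc N e) = simple_root (\<lambda>x. x) k f e" for f :: "'k mp poly"
    by (simp add: simple_root_def)
  with Cons show ?case by (cases a) auto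
qed simp

lemma pdef_otower:
  fixes \<tau> :: "'k::field mp poly option list"
  shows "pdef N (otower k \<tau>)"
proof (induct \<tau> arbitrary: k)
  case Nil
  show ?case using pdef_True by simp
next
  case (Cons a \<tau>)
  have "pdef N (simple_root (\<lambda>x. x) k f)" for f :: "'k mp poly"
    unfolding simple_root_iff[OF comm_ring_hom_id] by (intro pdef_conj pdef_neg pdef_zero)
  with Cons show ?case by (cases a) (simp_all add: pdef_conj)
qed

lemma definable_basic:
  fixes q :: "'k::field mp"
  shows "definable m {a \<in> affine_points m. fiber m (basic m C \<tau> q) (lenv a)}"
proof -
  let ?N = "m + length \<tau>"
  have "pdef ?N (\<lambda>e. (\<forall>c\<in>set C. ev e (ret m c) = 0) \<and> otower m \<tau> e \<and> \<not> ev e (ret ?N q) = 0)"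
    by (intro pdef_conj pdef_neg pdef_zero pdef_ball pdef_otower)
  from pdef_fiber[OF this]
  have "pdef m (fiber m (basic m C \<tau> q))"
  proof (rule back_subst[where P = "pdef m"], intro arg_cong[where f = "fiber m"] ext)
    fix e :: "nat \<Rightarrow> 'k"
    have "trunc (min m ?N) e = trunc m e" by simp
    then show "((\<forall>c\<in>set C. ev (trunc ?N e) (ret m c) = 0) \<and> otower m \<tau> (trunc ?N e) \<and>
      \<not> ev (trunc ?N e) (ret ?N q) = 0) = basic m C \<tau> q e"
      by (simp add: basic_def mval_ret[OF comm_ring_hom_id] otower_trunc)
  qed
  then obtain \<phi> where \<phi>: "rform_free \<phi> \<subseteq> {..<m}" "\<And>e. rform_sat e \<phi> \<longleftrightarrow> fiber m (basic m C \<tau> q) (trunc m e)"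
    unfolding pdef_def by blast
  have "rform_sat (nth a) \<phi> \<longleftrightarrow> fiber m (basic m C \<tau> q) (lenv a)" if "a \<in> affine_points m" for a
  proof -
    have "trunc m (nth a) = lenv a" using that by (auto simp: trunc_def lenv_def affine_points_def)
    then show ?thesis by (simp add: \<phi>(2))
  qed
  with \<phi>(1) show ?thesis unfolding definable_def by blast
qed

section \<open>Fractions and the structure sheaf\<close>

lemma openin_zariski [simp]: "openin (topology (zariski_open R)) = zariski_open R"
  by (rule topology_inverse') (rule istopology_zariski_open)

lemma zariski_open_Int: "zariski_open R S \<Longrightarrow> zariski_open R T \<Longrightarrow> zariski_open R (S \<inter> T)"
  using istopology_zariski_open[of R] by (simp add: istopology_def)

lemma zariski_open_prime: "zariski_open R U \<Longrightarrow> P \<in> U \<Longrightarrow> primeideal P R"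
  by (auto simp: zariski_open_def)

lemma (in cring) zariski_open_primes: "zariski_open R {P. primeideal P R}"
proof -
  have "\<not> {\<one>} \<subseteq> P" if "primeideal P R" for P
  proof -
    interpret P: primeideal P R by fact
    show ?thesis using P.I_notcarr P.one_imp_carrier by auto
  qed
  then show ?thesis unfolding zariski_open_def by (intro exI[of _ "{\<one>}"]) auto
qed

lemma (in cring) topspace_zariski [simp]: "topspace (topology (zariski_open R)) = {P. primeideal P R}"
proof
  show "topspace (topology (zariski_open R)) \<subseteq> {P. primeideal P R}"
    by (auto simp: topspace_def dest: zariski_open_prime)
  show "{P. primeideal P R} \<subseteq> topspace (topology (zariski_open R))"
    by (rule openin_subset) (simp add: zariski_open_primes)
qed

lemma zariski_open_basic: "s \<in> carrier R \<Longrightarrow> zariski_open R {P. primeideal P R \<and> s \<notin> P}"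
  unfolding zariski_open_def by (intro exI[of _ "{s}"]) auto

text \<open>\<open>frac_add\<close> and \<open>frac_mult\<close> are unions over all
  representatives. Once the class is independent of the representatives, the union collapses to a
  single class.\<close>

lemma UN_pairs_const:
  assumes "(a, s) \<in> A" "(b, t) \<in> B"
    and "\<And>a s b t. (a, s) \<in> A \<Longrightarrow> (b, t) \<in> B \<Longrightarrow> F a s b t = c"
  shows "(\<Union>(a, s)\<in>A. \<Union>(b, t)\<in>B. F a s b t) = c"
  using assms by fastforce

locale prime_fractions = cring R + primeideal P R for P and R (structure)
begin

lemma compl_mult: "s \<in> carrier R - P \<Longrightarrow> t \<in> carrier R - P \<Longrightarrow> s \<otimes> t \<in> carrier R - P"
  using I_prime by auto

lemma compl_one: "\<one> \<in> carrier R - P"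
  using I_notcarr one_imp_carrier by auto

lemma one_notin: "\<one> \<notin> P"
  using compl_one by blast

lemma mem_frac:
  "(b, t) \<in> frac R P a s \<longleftrightarrow> b \<in> carrier R \<and> t \<in> carrier R - P \<and>
    (\<exists>u\<in>carrier R - P. u \<otimes> (a \<otimes> t) = u \<otimes> (b \<otimes> s))"
  by (simp add: frac_def)

lemma frac_self: "a \<in> carrier R \<Longrightarrow> s \<in> carrier R - P \<Longrightarrow> (a, s) \<in> frac R P a s"
  using compl_one by (auto simp: mem_frac)

lemma frac_subset:
  assumes "a \<in> carrier R" "b \<in> carrier R" "s \<in> carrier R - P" "t \<in> carrier R - P"
    and u: "u \<in> carrier R - P" "u \<otimes> (a \<otimes> t) = u \<otimes> (b \<otimes> s)"
  shows "frac R P b t \<subseteq> frac R P a s"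
proof
  fix x assume "x \<in> frac R P b t"
  then obtain d r v where x: "x = (d, r)" and dr: "d \<in> carrier R" "r \<in> carrier R - P"
    and v: "v \<in> carrier R - P" "v \<otimes> (b \<otimes> r) = v \<otimes> (d \<otimes> t)"
    by (cases x) (auto simp: mem_frac)
  have cl: "a \<in> carrier R" "b \<in> carrier R" "s \<in> carrier R" "t \<in> carrier R" "d \<in> carrier R"
    "r \<in> carrier R" "u \<in> carrier R" "v \<in> carrier R"
    using assms dr v by auto
  \<comment> \<open>The usual transitivity of equality of fractions: besides \<open>u\<close> and
    \<open>v\<close> the middle denominator \<open>t\<close> is needed as a factor, and the product
    avoids \<open>P\<close> because \<open>P\<close> is prime.\<close>
  have "u \<otimes> v \<otimes> t \<otimes> (a \<otimes> r) = v \<otimes> r \<otimes> (u \<otimes> (a \<otimes> t))" using cl by (simp add: m_ac)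
  also have "\<dots> = u \<otimes> s \<otimes> (v \<otimes> (b \<otimes> r))" unfolding u(2) using cl by (simp add: m_ac)
  also have "\<dots> = u \<otimes> v \<otimes> t \<otimes> (d \<otimes> s)" unfolding v(2) using cl by (simp add: m_ac)
  finally have "u \<otimes> v \<otimes> t \<otimes> (a \<otimes> r) = u \<otimes> v \<otimes> t \<otimes> (d \<otimes> s)" .
  moreover have "u \<otimes> v \<otimes> t \<in> carrier R - P" using u v assms by (intro compl_mult) auto
  ultimately show "x \<in> frac R P a s" using dr by (auto simp: x mem_frac)
qed

lemma frac_eqI:
  assumes "a \<in> carrier R" "b \<in> carrier R" "s \<in> carrier R - P" "t \<in> carrier R - P"
    and "u \<in> carrier R - P" "u \<otimes> (a \<otimes> t) = u \<otimes> (b \<otimes> s)"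
  shows "frac R P a s = frac R P b t"
  using frac_subset[OF assms] frac_subset[OF assms(2,1,4,3,5) assms(6)[symmetric]] by blast

lemma frac_eqI1:
  assumes "a \<in> carrier R" "b \<in> carrier R" "s \<in> carrier R - P" "t \<in> carrier R - P" "a \<otimes> t = b \<otimes> s"
  shows "frac R P a s = frac R P b t"
  by (rule frac_eqI[OF assms(1-4) compl_one]) (simp add: assms(5))

lemma frac_eqD:
  assumes "frac R P a s = frac R P b t" "b \<in> carrier R" "t \<in> carrier R - P"
  obtains u where "u \<in> carrier R - P" "u \<otimes> (a \<otimes> t) = u \<otimes> (b \<otimes> s)"
  using frac_self[OF assms(2,3)] unfolding assms(1)[symmetric] by (auto simp: mem_frac)

lemma frac_mem_eq:
  assumes "a \<in> carrier R" "s \<in> carrier R - P" "(b, t) \<in> frac R P a s"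
  shows "b \<in> carrier R" "t \<in> carrier R - P" "frac R P b t = frac R P a s"
proof -
  show b: "b \<in> carrier R" and t: "t \<in> carrier R - P" using assms(3) by (auto simp: mem_frac)
  obtain u where u: "u \<in> carrier R - P" "u \<otimes> (a \<otimes> t) = u \<otimes> (b \<otimes> s)"
    using assms(3) by (auto simp: mem_frac)
  show "frac R P b t = frac R P a s"
    using frac_eqI[OF assms(1) b assms(2) t u] by simp
qed

lemma frac_mult_frac:
  assumes "a \<in> carrier R" "b \<in> carrier R" "s \<in> carrier R - P" "t \<in> carrier R - P"
  shows "frac_mult R P (frac R P a s) (frac R P b t) = frac R P (a \<otimes> b) (s \<otimes> t)"
proof -
  have w: "frac R P (a' \<otimes> b') (s' \<otimes> t') = frac R P (a \<otimes> b) (s \<otimes> t)"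
    if pr: "a' \<in> carrier R" "s' \<in> carrier R - P" "frac R P a' s' = frac R P a s"
      "b' \<in> carrier R" "t' \<in> carrier R - P" "frac R P b' t' = frac R P b t" for a' b' s' t'
  proof -
    obtain u where u: "u \<in> carrier R - P" "u \<otimes> (a' \<otimes> s) = u \<otimes> (a \<otimes> s')"
      using frac_eqD[OF pr(3) assms(1,3)] .
    obtain v where v: "v \<in> carrier R - P" "v \<otimes> (b' \<otimes> t) = v \<otimes> (b \<otimes> t')"
      using frac_eqD[OF pr(6) assms(2,4)] .
    have cl: "a \<in> carrier R" "b \<in> carrier R" "s \<in> carrier R" "t \<in> carrier R" "a' \<in> carrier R"
      "b' \<in> carrier R" "s' \<in> carrier R" "t' \<in> carrier R" "u \<in> carrier R" "v \<in> carrier R"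
      using assms pr u v by auto
    have "u \<otimes> v \<otimes> (a' \<otimes> b' \<otimes> (s \<otimes> t)) = (u \<otimes> (a' \<otimes> s)) \<otimes> (v \<otimes> (b' \<otimes> t))"
      using cl by (simp add: m_ac)
    also have "\<dots> = u \<otimes> v \<otimes> (a \<otimes> b \<otimes> (s' \<otimes> t'))"
      unfolding u(2) v(2) using cl by (simp add: m_ac)
    finally show ?thesis
      using cl assms pr u(1) v(1) by (intro frac_eqI[where u = "u \<otimes> v"] compl_mult) auto
  qed
  show ?thesis unfolding frac_mult_def
  proof (rule UN_pairs_const)
    show "(a, s) \<in> frac R P a s" "(b, t) \<in> frac R P b t" using assms frac_self by auto
    fix a' s' b' t' assume h: "(a', s') \<in> frac R P a s" "(b', t') \<in> frac R P b t"
    show "frac R P (a' \<otimes> b') (s' \<otimes> t') = frac R P (a \<otimes> b) (s \<otimes> t)"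
      by (rule w[OF frac_mem_eq[OF assms(1,3) h(1)] frac_mem_eq[OF assms(2,4) h(2)]])
  qed
qed

lemma frac_add_frac:
  assumes "a \<in> carrier R" "b \<in> carrier R" "s \<in> carrier R - P" "t \<in> carrier R - P"
  shows "frac_add R P (frac R P a s) (frac R P b t) = frac R P (a \<otimes> t \<oplus> b \<otimes> s) (s \<otimes> t)"
proof -
  have w: "frac R P (a' \<otimes> t' \<oplus> b' \<otimes> s') (s' \<otimes> t') = frac R P (a \<otimes> t \<oplus> b \<otimes> s) (s \<otimes> t)"
    if pr: "a' \<in> carrier R" "s' \<in> carrier R - P" "frac R P a' s' = frac R P a s"
      "b' \<in> carrier R" "t' \<in> carrier R - P" "frac R P b' t' = frac R P b t" for a' b' s' t'
  proof -
    obtain u where u: "u \<in> carrier R - P" "u \<otimes> (a' \<otimes> s) = u \<otimes> (a \<otimes> s')"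
      using frac_eqD[OF pr(3) assms(1,3)] .
    obtain v where v: "v \<in> carrier R - P" "v \<otimes> (b' \<otimes> t) = v \<otimes> (b \<otimes> t')"
      using frac_eqD[OF pr(6) assms(2,4)] .
    have cl: "a \<in> carrier R" "b \<in> carrier R" "s \<in> carrier R" "t \<in> carrier R" "a' \<in> carrier R"
      "b' \<in> carrier R" "s' \<in> carrier R" "t' \<in> carrier R" "u \<in> carrier R" "v \<in> carrier R"
      using assms pr u v by auto
    have "u \<otimes> v \<otimes> ((a' \<otimes> t' \<oplus> b' \<otimes> s') \<otimes> (s \<otimes> t)) =
      (u \<otimes> (a' \<otimes> s)) \<otimes> (v \<otimes> (t \<otimes> t')) \<oplus> (v \<otimes> (b' \<otimes> t)) \<otimes> (u \<otimes> (s \<otimes> s'))"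
      using cl by (simp add: m_ac l_distr r_distr)
    also have "\<dots> = u \<otimes> v \<otimes> ((a \<otimes> t \<oplus> b \<otimes> s) \<otimes> (s' \<otimes> t'))"
      unfolding u(2) v(2) using cl by (simp add: m_ac l_distr r_distr)
    finally show ?thesis
      using cl assms pr u(1) v(1) by (intro frac_eqI[where u = "u \<otimes> v"] compl_mult) auto
  qed
  show ?thesis unfolding frac_add_def
  proof (rule UN_pairs_const)
    show "(a, s) \<in> frac R P a s" "(b, t) \<in> frac R P b t" using assms frac_self by auto
    fix a' s' b' t' assume h: "(a', s') \<in> frac R P a s" "(b', t') \<in> frac R P b t"
    show "frac R P (a' \<otimes> t' \<oplus> b' \<otimes> s') (s' \<otimes> t') = frac R P (a \<otimes> t \<oplus> b \<otimes> s) (s \<otimes> t)"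
      by (rule w[OF frac_mem_eq[OF assms(1,3) h(1)] frac_mem_eq[OF assms(2,4) h(2)]])
  qed
qed

end

text \<open>The local ring as a ring record, so that ring laws for sections can be verified
  pointwise.\<close>

definition loc :: "('a, 'b) ring_scheme \<Rightarrow> 'a set \<Rightarrow> ('a \<times> 'a) set ring" where
  "loc R P = \<lparr>carrier = {frac R P a s | a s. a \<in> carrier R \<and> s \<in> carrier R - P},
    monoid.mult = frac_mult R P, one = frac R P \<one>\<^bsub>R\<^esub> \<one>\<^bsub>R\<^esub>,
    zero = frac R P \<zero>\<^bsub>R\<^esub> \<one>\<^bsub>R\<^esub>, add = frac_add R P\<rparr>"

lemma loc_simps:
  "x \<in> carrier (loc R P) \<longleftrightarrow> (\<exists>a s. x = frac R P a s \<and> a \<in> carrier R \<and> s \<in> carrier R - P)"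
  "monoid.mult (loc R P) = frac_mult R P" "add (loc R P) = frac_add R P"
  "one (loc R P) = frac R P \<one>\<^bsub>R\<^esub> \<one>\<^bsub>R\<^esub>" "zero (loc R P) = frac R P \<zero>\<^bsub>R\<^esub> \<one>\<^bsub>R\<^esub>"
  by (auto simp: loc_def)

context prime_fractions
begin

lemma frac_uminus:
  assumes "a \<in> carrier R" "s \<in> carrier R - P"
  shows "frac_add R P (frac R P (\<ominus> a) s) (frac R P a s) = frac R P \<zero> \<one>"
proof -
  have cl: "a \<in> carrier R" "s \<in> carrier R" using assms by auto
  have "frac_add R P (frac R P (\<ominus> a) s) (frac R P a s) = frac R P ((\<ominus> a) \<otimes> s \<oplus> a \<otimes> s) (s \<otimes> s)"
    using assms by (intro frac_add_frac) auto
  also have "\<dots> = frac R P \<zero> \<one>"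
    using cl assms by (intro frac_eqI1) (auto simp: l_minus l_neg one_notin dest: I_prime)
  finally show ?thesis .
qed

lemma loc_cring: "cring (loc R P)"
proof (rule cringI)
  show "abelian_group (loc R P)"
  proof (rule abelian_groupI)
    fix x y assume "x \<in> carrier (loc R P)" "y \<in> carrier (loc R P)"
    then obtain a s b t where x: "x = frac R P a s" "a \<in> carrier R" "s \<in> carrier R - P"
      and y: "y = frac R P b t" "b \<in> carrier R" "t \<in> carrier R - P" by (auto simp: loc_simps)
    have st: "s \<otimes> t \<in> carrier R - P" using x y compl_mult by blast
    have cl: "a \<in> carrier R" "b \<in> carrier R" "s \<in> carrier R" "t \<in> carrier R" using x y by auto
    show "x \<oplus>\<^bsub>loc R P\<^esub> y \<in> carrier (loc R P)"
      using x y st cl by (auto simp: loc_simps frac_add_frac)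
    show "x \<oplus>\<^bsub>loc R P\<^esub> y = y \<oplus>\<^bsub>loc R P\<^esub> x"
      using x y cl by (simp add: loc_simps frac_add_frac m_comm a_comm)
    fix z assume "z \<in> carrier (loc R P)"
    then obtain d r where z: "z = frac R P d r" "d \<in> carrier R" "r \<in> carrier R - P"
      by (auto simp: loc_simps)
    have tr: "t \<otimes> r \<in> carrier R - P" using z y compl_mult by blast
    have cl: "a \<in> carrier R" "b \<in> carrier R" "s \<in> carrier R" "t \<in> carrier R" "d \<in> carrier R" "r \<in> carrier R"
      using x y z by auto
    show "x \<oplus>\<^bsub>loc R P\<^esub> y \<oplus>\<^bsub>loc R P\<^esub> z = x \<oplus>\<^bsub>loc R P\<^esub> (y \<oplus>\<^bsub>loc R P\<^esub> z)"
      unfolding loc_simps x(1) y(1) z(1)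
      using x(3) y(3) z(3) st tr cl
      by (simp add: frac_add_frac del: Diff_iff) (simp add: l_distr r_distr m_ac a_ac)
  next
    show "\<zero>\<^bsub>loc R P\<^esub> \<in> carrier (loc R P)" using compl_one by (auto simp: loc_simps)
  next
    fix x assume "x \<in> carrier (loc R P)"
    then obtain a s where x: "x = frac R P a s" "a \<in> carrier R" "s \<in> carrier R - P"
      by (auto simp: loc_simps)
    show "\<zero>\<^bsub>loc R P\<^esub> \<oplus>\<^bsub>loc R P\<^esub> x = x"
      using x compl_one by (simp add: loc_simps frac_add_frac)
    show "\<exists>y\<in>carrier (loc R P). y \<oplus>\<^bsub>loc R P\<^esub> x = \<zero>\<^bsub>loc R P\<^esub>"
      using x by (intro bexI[of _ "frac R P (\<ominus> a) s"]) (auto simp: loc_simps frac_uminus)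
  qed
  show "Group.comm_monoid (loc R P)"
  proof (rule comm_monoidI)
    fix x y assume "x \<in> carrier (loc R P)" "y \<in> carrier (loc R P)"
    then obtain a s b t where x: "x = frac R P a s" "a \<in> carrier R" "s \<in> carrier R - P"
      and y: "y = frac R P b t" "b \<in> carrier R" "t \<in> carrier R - P" by (auto simp: loc_simps)
    have st: "s \<otimes> t \<in> carrier R - P" using x y compl_mult by blast
    have cl: "a \<in> carrier R" "b \<in> carrier R" "s \<in> carrier R" "t \<in> carrier R" using x y by auto
    show "x \<otimes>\<^bsub>loc R P\<^esub> y \<in> carrier (loc R P)"
      using x y st cl by (auto simp: loc_simps frac_mult_frac)
    show "x \<otimes>\<^bsub>loc R P\<^esub> y = y \<otimes>\<^bsub>loc R P\<^esub> x"
      using x y cl by (simp add: loc_simps frac_mult_frac m_comm)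
    fix z assume "z \<in> carrier (loc R P)"
    then obtain d r where z: "z = frac R P d r" "d \<in> carrier R" "r \<in> carrier R - P"
      by (auto simp: loc_simps)
    have tr: "t \<otimes> r \<in> carrier R - P" using z y compl_mult by blast
    have cl: "a \<in> carrier R" "b \<in> carrier R" "s \<in> carrier R" "t \<in> carrier R" "d \<in> carrier R" "r \<in> carrier R"
      using x y z by auto
    show "x \<otimes>\<^bsub>loc R P\<^esub> y \<otimes>\<^bsub>loc R P\<^esub> z = x \<otimes>\<^bsub>loc R P\<^esub> (y \<otimes>\<^bsub>loc R P\<^esub> z)"
      unfolding loc_simps x(1) y(1) z(1)
      using x(3) y(3) z(3) st tr cl
      by (simp add: frac_mult_frac del: Diff_iff) (simp add: m_ac)
  next
    show "\<one>\<^bsub>loc R P\<^esub> \<in> carrier (loc R P)" using compl_one by (auto simp: loc_simps)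
  next
    fix x assume "x \<in> carrier (loc R P)"
    then obtain a s where x: "x = frac R P a s" "a \<in> carrier R" "s \<in> carrier R - P"
      by (auto simp: loc_simps)
    show "\<one>\<^bsub>loc R P\<^esub> \<otimes>\<^bsub>loc R P\<^esub> x = x"
      using x compl_one by (simp add: loc_simps frac_mult_frac)
  qed
  fix x y z assume "x \<in> carrier (loc R P)" "y \<in> carrier (loc R P)" "z \<in> carrier (loc R P)"
  then obtain a s b t d r where x: "x = frac R P a s" "a \<in> carrier R" "s \<in> carrier R - P"
    and y: "y = frac R P b t" "b \<in> carrier R" "t \<in> carrier R - P"
    and z: "z = frac R P d r" "d \<in> carrier R" "r \<in> carrier R - P" by (auto simp: loc_simps)
  have cl: "a \<in> carrier R" "b \<in> carrier R" "s \<in> carrier R" "t \<in> carrier R" "d \<in> carrier R" "r \<in> carrier R"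
    using x y z by auto
  have st: "s \<otimes> t \<in> carrier R - P" "s \<otimes> r \<in> carrier R - P" "t \<otimes> r \<in> carrier R - P"
    using x y z compl_mult by blast+
  show "(x \<oplus>\<^bsub>loc R P\<^esub> y) \<otimes>\<^bsub>loc R P\<^esub> z = x \<otimes>\<^bsub>loc R P\<^esub> z \<oplus>\<^bsub>loc R P\<^esub> y \<otimes>\<^bsub>loc R P\<^esub> z"
    unfolding loc_simps x(1) y(1) z(1)
    using x y z st cl
    by (simp add: frac_add_frac frac_mult_frac del: Diff_iff)
      (intro frac_eqI1 compl_mult; simp add: l_distr r_distr m_ac del: Diff_iff)
qed

end

lemma (in cring) prime_fractionsI: "primeideal P R \<Longrightarrow> prime_fractions P R"
  by (simp add: prime_fractions_def is_cring)

section \<open>Rings of sections and the sheaf property\<close>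

lemma spec_simps [simp]:
  "space_topology (spec R c) = topology (zariski_open R)"
  "carrier (sect (spec R c) U) = spec_sections R U"
  "monoid.mult (sect (spec R c) U) = (\<lambda>\<phi> \<psi>. \<lambda>P\<in>U. frac_mult R P (\<phi> P) (\<psi> P))"
  "one (sect (spec R c) U) = (\<lambda>P\<in>U. frac R P \<one>\<^bsub>R\<^esub> \<one>\<^bsub>R\<^esub>)"
  "zero (sect (spec R c) U) = (\<lambda>P\<in>U. frac R P \<zero>\<^bsub>R\<^esub> \<one>\<^bsub>R\<^esub>)"
  "add (sect (spec R c) U) = (\<lambda>\<phi> \<psi>. \<lambda>P\<in>U. frac_add R P (\<phi> P) (\<psi> P))"
  "rstr (spec R c) U W = (\<lambda>\<phi>. restrict \<phi> W)"
  "scal (spec R c) U k = (\<lambda>P\<in>U. frac R P (c k) \<one>\<^bsub>R\<^esub>)"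
  by (auto simp: spec_def)

lemma sectionsE:
  assumes "\<phi> \<in> spec_sections R U" "P \<in> U"
  obtains W a s where "zariski_open R W" "P \<in> W" "W \<subseteq> U" "a \<in> carrier R" "s \<in> carrier R"
    "\<And>Q. Q \<in> W \<Longrightarrow> s \<notin> Q" "\<And>Q. Q \<in> W \<Longrightarrow> \<phi> Q = frac R Q a s"
proof -
  from assms obtain W a s where "zariski_open R W \<and> P \<in> W \<and> W \<subseteq> U \<and>
      a \<in> carrier R \<and> s \<in> carrier R \<and> (\<forall>Q\<in>W. s \<notin> Q \<and> \<phi> Q = frac R Q a s)"
    unfolding spec_sections_def by blast
  then show thesis by (intro that[of W a s]) auto
qed

lemma sectionsI:
  assumes "\<phi> \<in> extensional U"
    and "\<And>P. P \<in> U \<Longrightarrow> \<exists>W a s. zariski_open R W \<and> P \<in> W \<and> W \<subseteq> U \<and>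
      a \<in> carrier R \<and> s \<in> carrier R \<and> (\<forall>Q\<in>W. s \<notin> Q \<and> \<phi> Q = frac R Q a s)"
  shows "\<phi> \<in> spec_sections R U"
  using assms unfolding spec_sections_def by blast

lemma sections_ext: "\<phi> \<in> spec_sections R U \<Longrightarrow> \<phi> \<in> extensional U"
  by (simp add: spec_sections_def)

lemma section_in_loc: "\<phi> \<in> spec_sections R U \<Longrightarrow> P \<in> U \<Longrightarrow> \<phi> P \<in> carrier (loc R P)"
  by (erule (1) sectionsE) (auto simp: loc_simps)

lemma sections_restrict:
  assumes \<phi>: "\<phi> \<in> spec_sections R U" and W: "zariski_open R W" "W \<subseteq> U"
  shows "restrict \<phi> W \<in> spec_sections R W"
proof (rule sectionsI)
  fix P assume P: "P \<in> W"
  then have "P \<in> U" using W by blast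
  from sectionsE[OF \<phi> this] obtain W' a s where *: "zariski_open R W'" "P \<in> W'" "W' \<subseteq> U" "a \<in> carrier R" "s \<in> carrier R"
    "\<And>Q. Q \<in> W' \<Longrightarrow> s \<notin> Q" "\<And>Q. Q \<in> W' \<Longrightarrow> \<phi> Q = frac R Q a s" by metis
  show "\<exists>W' a s. zariski_open R W' \<and> P \<in> W' \<and> W' \<subseteq> W \<and>
      a \<in> carrier R \<and> s \<in> carrier R \<and> (\<forall>Q\<in>W'. s \<notin> Q \<and> restrict \<phi> W Q = frac R Q a s)"
    using * P by (intro exI[of _ "W \<inter> W'"] exI[of _ a] exI[of _ s]) (auto intro: zariski_open_Int W)
qed simp

lemma sections_const:
  assumes "zariski_open R U" "a \<in> carrier R" "s \<in> carrier R" "\<And>P. P \<in> U \<Longrightarrow> s \<notin> P"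
  shows "(\<lambda>P\<in>U. frac R P a s) \<in> spec_sections R U"
  by (rule sectionsI) (use assms in auto)

context cring
begin

text \<open>Sums and products share this argument: intersect the two neighbourhoods and multiply the
  denominators.\<close>

lemma sections_bin:
  assumes \<phi>: "\<phi> \<in> spec_sections R U" and \<psi>: "\<psi> \<in> spec_sections R U"
    and F: "\<And>Q a s b t. primeideal Q R \<Longrightarrow> a \<in> carrier R \<Longrightarrow> b \<in> carrier R \<Longrightarrow> s \<in> carrier R - Q \<Longrightarrow>
      t \<in> carrier R - Q \<Longrightarrow> F Q (frac R Q a s) (frac R Q b t) = frac R Q (A a s b t) (s \<otimes> t)"
    and A: "\<And>a s b t. a \<in> carrier R \<Longrightarrow> b \<in> carrier R \<Longrightarrow> s \<in> carrier R \<Longrightarrow> t \<in> carrier R \<Longrightarrow> A a s b t \<in> carrier R"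
  shows "(\<lambda>P\<in>U. F P (\<phi> P) (\<psi> P)) \<in> spec_sections R U"
proof (rule sectionsI)
  fix P assume P: "P \<in> U"
  obtain W a s where W: "zariski_open R W" "P \<in> W" "W \<subseteq> U" "a \<in> carrier R" "s \<in> carrier R"
    "\<And>Q. Q \<in> W \<Longrightarrow> s \<notin> Q" "\<And>Q. Q \<in> W \<Longrightarrow> \<phi> Q = frac R Q a s"
    using sectionsE[OF \<phi> P] by metis
  obtain T b t where T: "zariski_open R T" "P \<in> T" "T \<subseteq> U" "b \<in> carrier R" "t \<in> carrier R"
    "\<And>Q. Q \<in> T \<Longrightarrow> t \<notin> Q" "\<And>Q. Q \<in> T \<Longrightarrow> \<psi> Q = frac R Q b t"
    using sectionsE[OF \<psi> P] by metis
  have "s \<otimes> t \<notin> Q \<and> (\<lambda>P\<in>U. F P (\<phi> P) (\<psi> P)) Q = frac R Q (A a s b t) (s \<otimes> t)" if Q: "Q \<in> W \<inter> T" for Q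
  proof -
    have pr: "primeideal Q R" using zariski_open_prime[OF W(1)] Q by blast
    interpret prime_fractions Q R by (rule prime_fractionsI[OF pr])
    have st: "s \<in> carrier R - Q" "t \<in> carrier R - Q" using W T Q by auto
    have "s \<otimes> t \<notin> Q" using compl_mult[OF st] by blast
    moreover have "(\<lambda>P\<in>U. F P (\<phi> P) (\<psi> P)) Q = F Q (frac R Q a s) (frac R Q b t)"
      using Q W T by auto
    ultimately show ?thesis using F[OF pr W(4) T(4) st] by simp
  qed
  then show "\<exists>W a s. zariski_open R W \<and> P \<in> W \<and> W \<subseteq> U \<and>
      a \<in> carrier R \<and> s \<in> carrier R \<and> (\<forall>Q\<in>W. s \<notin> Q \<and> (\<lambda>P\<in>U. F P (\<phi> P) (\<psi> P)) Q = frac R Q a s)"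
    using W T A by (intro exI[of _ "W \<inter> T"] exI[of _ "A a s b t"] exI[of _ "s \<otimes> t"]) (auto intro: zariski_open_Int)
qed simp

lemma sections_mult:
  assumes "\<phi> \<in> spec_sections R U" "\<psi> \<in> spec_sections R U"
  shows "(\<lambda>P\<in>U. frac_mult R P (\<phi> P) (\<psi> P)) \<in> spec_sections R U"
  by (rule sections_bin[OF assms, where A = "\<lambda>a s b t. a \<otimes> b"],
      rule prime_fractions.frac_mult_frac[OF prime_fractionsI]) simp_all

lemma sections_add:
  assumes "\<phi> \<in> spec_sections R U" "\<psi> \<in> spec_sections R U"
  shows "(\<lambda>P\<in>U. frac_add R P (\<phi> P) (\<psi> P)) \<in> spec_sections R U"
  by (rule sections_bin[OF assms, where A = "\<lambda>a s b t. a \<otimes> t \<oplus> b \<otimes> s"],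
      rule prime_fractions.frac_add_frac[OF prime_fractionsI]) simp_all

lemma loc_cringI: "primeideal P R \<Longrightarrow> cring (loc R P)"
  by (rule prime_fractions.loc_cring[OF prime_fractionsI])

lemma sections_uminus:
  assumes U: "zariski_open R U" and \<phi>: "\<phi> \<in> spec_sections R U"
  shows "(\<lambda>P\<in>U. \<ominus>\<^bsub>loc R P\<^esub> (\<phi> P)) \<in> spec_sections R U"
proof (rule sectionsI)
  fix P assume P: "P \<in> U"
  obtain W a s where W: "zariski_open R W" "P \<in> W" "W \<subseteq> U" "a \<in> carrier R" "s \<in> carrier R"
    "\<And>Q. Q \<in> W \<Longrightarrow> s \<notin> Q" "\<And>Q. Q \<in> W \<Longrightarrow> \<phi> Q = frac R Q a s"
    using sectionsE[OF \<phi> P] by metis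
  have "\<ominus>\<^bsub>loc R Q\<^esub> (frac R Q a s) = frac R Q (\<ominus> a) s" if Q: "Q \<in> W" for Q
  proof -
    have pr: "primeideal Q R" using zariski_open_prime[OF W(1)] Q by blast
    interpret prime_fractions Q R by (rule prime_fractionsI[OF pr])
    interpret L: cring "loc R Q" by (rule loc_cring)
    have s: "s \<in> carrier R - Q" using W Q by auto
    show ?thesis
    proof (rule L.minus_equality)
      show "frac R Q (\<ominus> a) s \<oplus>\<^bsub>loc R Q\<^esub> frac R Q a s = \<zero>\<^bsub>loc R Q\<^esub>"
        using frac_uminus[OF W(4) s] by (simp add: loc_simps)
    qed (use W s in \<open>auto simp: loc_simps(1)\<close>)
  qed
  then show "\<exists>W a s. zariski_open R W \<and> P \<in> W \<and> W \<subseteq> U \<and>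
      a \<in> carrier R \<and> s \<in> carrier R \<and> (\<forall>Q\<in>W. s \<notin> Q \<and> (\<lambda>P\<in>U. \<ominus>\<^bsub>loc R P\<^esub> (\<phi> P)) Q = frac R Q a s)"
    using W by (intro exI[of _ W] exI[of _ "\<ominus> a"] exI[of _ s]) auto
qed simp

lemma sections_eqI:
  assumes "\<phi> \<in> spec_sections R U" "\<psi> \<in> spec_sections R U" "\<And>P. P \<in> U \<Longrightarrow> \<phi> P = \<psi> P"
  shows "\<phi> = \<psi>"
  using assms by (intro extensionalityI[of _ U]) (auto dest: sections_ext)

lemma one_notin_open: "zariski_open R U \<Longrightarrow> P \<in> U \<Longrightarrow> \<one> \<notin> P"
  using prime_fractions.one_notin[OF prime_fractionsI] zariski_open_prime by blast

text \<open>A section is determined by its values, which lie in the rings \<open>loc R P\<close>;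
  each ring axiom is inherited from these.\<close>

lemma cring_sections:
  assumes U: "zariski_open R U"
  shows "cring (sect (spec R c) U)"
proof -
  let ?S = "sect (spec R c) U"
  have L: "cring (loc R P)" if "P \<in> U" for P
    using loc_cringI zariski_open_prime[OF U that] .
  have pt: "(\<phi> \<oplus>\<^bsub>?S\<^esub> \<psi>) P = \<phi> P \<oplus>\<^bsub>loc R P\<^esub> \<psi> P" "(\<phi> \<otimes>\<^bsub>?S\<^esub> \<psi>) P = \<phi> P \<otimes>\<^bsub>loc R P\<^esub> \<psi> P"
    "\<zero>\<^bsub>?S\<^esub> P = \<zero>\<^bsub>loc R P\<^esub>" "\<one>\<^bsub>?S\<^esub> P = \<one>\<^bsub>loc R P\<^esub>" if "P \<in> U" for P \<phi> \<psi>
    using that by (simp_all add: loc_simps)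
  have add: "\<phi> \<oplus>\<^bsub>?S\<^esub> \<psi> \<in> carrier ?S" and mult: "\<phi> \<otimes>\<^bsub>?S\<^esub> \<psi> \<in> carrier ?S"
    if "\<phi> \<in> carrier ?S" "\<psi> \<in> carrier ?S" for \<phi> \<psi>
    using that sections_add sections_mult by auto
  have zero: "\<zero>\<^bsub>?S\<^esub> \<in> carrier ?S" and one: "\<one>\<^bsub>?S\<^esub> \<in> carrier ?S"
    using sections_const[OF U _ _ one_notin_open[OF U]] by simp_all
  have eqI: "\<phi> = \<psi>" if "\<phi> \<in> carrier ?S" "\<psi> \<in> carrier ?S" "\<And>P. P \<in> U \<Longrightarrow> \<phi> P = \<psi> P" for \<phi> \<psi>
    using that sections_eqI by simp
  have val: "\<phi> P \<in> carrier (loc R P)" if "\<phi> \<in> carrier ?S" "P \<in> U" for \<phi> P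
    using that section_in_loc by simp
  note [simp del] = spec_simps
  show ?thesis
  proof (rule cringI)
    show "abelian_group ?S"
    proof (rule abelian_groupI)
      fix x y z assume x: "x \<in> carrier ?S" and y: "y \<in> carrier ?S"
      show "x \<oplus>\<^bsub>?S\<^esub> y \<in> carrier ?S" by (rule add[OF x y])
      show "x \<oplus>\<^bsub>?S\<^esub> y = y \<oplus>\<^bsub>?S\<^esub> x"
      proof (rule eqI[OF add[OF x y] add[OF y x]])
        fix P assume P: "P \<in> U"
        interpret P: cring "loc R P" by (rule L[OF P])
        show "(x \<oplus>\<^bsub>?S\<^esub> y) P = (y \<oplus>\<^bsub>?S\<^esub> x) P" by (simp add: pt P P.a_comm val x y)
      qed
      assume z: "z \<in> carrier ?S"
      show "x \<oplus>\<^bsub>?S\<^esub> y \<oplus>\<^bsub>?S\<^esub> z = x \<oplus>\<^bsub>?S\<^esub> (y \<oplus>\<^bsub>?S\<^esub> z)"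
      proof (rule eqI)
        fix P assume P: "P \<in> U"
        interpret P: cring "loc R P" by (rule L[OF P])
        show "(x \<oplus>\<^bsub>?S\<^esub> y \<oplus>\<^bsub>?S\<^esub> z) P = (x \<oplus>\<^bsub>?S\<^esub> (y \<oplus>\<^bsub>?S\<^esub> z)) P" by (simp add: pt P P.a_assoc val x y z)
      qed (auto intro: add x y z)
    next
      show "\<zero>\<^bsub>?S\<^esub> \<in> carrier ?S" by (rule zero)
    next
      fix x assume x: "x \<in> carrier ?S"
      show "\<zero>\<^bsub>?S\<^esub> \<oplus>\<^bsub>?S\<^esub> x = x"
      proof (rule eqI[OF add[OF zero x] x])
        fix P assume P: "P \<in> U"
        interpret P: cring "loc R P" by (rule L[OF P])
        show "(\<zero>\<^bsub>?S\<^esub> \<oplus>\<^bsub>?S\<^esub> x) P = x P" by (simp add: pt P val x)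
      qed
      let ?y = "\<lambda>P\<in>U. \<ominus>\<^bsub>loc R P\<^esub> (x P)"
      have y: "?y \<in> carrier ?S" using sections_uminus[OF U, of x] x by (simp add: spec_simps)
      have "?y \<oplus>\<^bsub>?S\<^esub> x = \<zero>\<^bsub>?S\<^esub>"
      proof (rule eqI[OF add[OF y x] zero])
        fix P assume P: "P \<in> U"
        interpret P: cring "loc R P" by (rule L[OF P])
        show "(?y \<oplus>\<^bsub>?S\<^esub> x) P = \<zero>\<^bsub>?S\<^esub> P" by (simp add: pt P P.l_neg val x)
      qed
      with y show "\<exists>y\<in>carrier ?S. y \<oplus>\<^bsub>?S\<^esub> x = \<zero>\<^bsub>?S\<^esub>" by blast
    qed
    show "Group.comm_monoid ?S"
    proof (rule comm_monoidI)
      fix x y z assume x: "x \<in> carrier ?S" and y: "y \<in> carrier ?S"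
      show "x \<otimes>\<^bsub>?S\<^esub> y \<in> carrier ?S" by (rule mult[OF x y])
      show "x \<otimes>\<^bsub>?S\<^esub> y = y \<otimes>\<^bsub>?S\<^esub> x"
      proof (rule eqI[OF mult[OF x y] mult[OF y x]])
        fix P assume P: "P \<in> U"
        interpret P: cring "loc R P" by (rule L[OF P])
        show "(x \<otimes>\<^bsub>?S\<^esub> y) P = (y \<otimes>\<^bsub>?S\<^esub> x) P" by (simp add: pt P P.m_comm val x y)
      qed
      assume z: "z \<in> carrier ?S"
      show "x \<otimes>\<^bsub>?S\<^esub> y \<otimes>\<^bsub>?S\<^esub> z = x \<otimes>\<^bsub>?S\<^esub> (y \<otimes>\<^bsub>?S\<^esub> z)"
      proof (rule eqI)
        fix P assume P: "P \<in> U"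
        interpret P: cring "loc R P" by (rule L[OF P])
        show "(x \<otimes>\<^bsub>?S\<^esub> y \<otimes>\<^bsub>?S\<^esub> z) P = (x \<otimes>\<^bsub>?S\<^esub> (y \<otimes>\<^bsub>?S\<^esub> z)) P" by (simp add: pt P P.m_assoc val x y z)
      qed (auto intro: mult x y z)
    next
      show "\<one>\<^bsub>?S\<^esub> \<in> carrier ?S" by (rule one)
    next
      fix x assume x: "x \<in> carrier ?S"
      show "\<one>\<^bsub>?S\<^esub> \<otimes>\<^bsub>?S\<^esub> x = x"
      proof (rule eqI[OF mult[OF one x] x])
        fix P assume P: "P \<in> U"
        interpret P: cring "loc R P" by (rule L[OF P])
        show "(\<one>\<^bsub>?S\<^esub> \<otimes>\<^bsub>?S\<^esub> x) P = x P" by (simp add: pt P val x)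
      qed
    qed
    fix x y z assume x: "x \<in> carrier ?S" and y: "y \<in> carrier ?S" and z: "z \<in> carrier ?S"
    show "(x \<oplus>\<^bsub>?S\<^esub> y) \<otimes>\<^bsub>?S\<^esub> z = x \<otimes>\<^bsub>?S\<^esub> z \<oplus>\<^bsub>?S\<^esub> y \<otimes>\<^bsub>?S\<^esub> z"
    proof (rule eqI)
      fix P assume P: "P \<in> U"
      interpret P: cring "loc R P" by (rule L[OF P])
      show "((x \<oplus>\<^bsub>?S\<^esub> y) \<otimes>\<^bsub>?S\<^esub> z) P = (x \<otimes>\<^bsub>?S\<^esub> z \<oplus>\<^bsub>?S\<^esub> y \<otimes>\<^bsub>?S\<^esub> z) P"
        by (simp add: pt P P.l_distr val x y z)
    qed (auto intro: mult add x y z)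
  qed
qed

lemma frac_scal_hom:
  assumes c: "c \<in> Ring.ring_hom (cring_class_ops :: 'k::field ring) R" and U: "zariski_open R U"
  shows "scal (spec R c) U \<in> Ring.ring_hom cring_class_ops (sect (spec R c) U)"
proof (rule ring_hom_memI)
  have cl: "c x \<in> carrier R" for x using ring_hom_closed[OF c] by (simp add: carrier_class)
  have one: "c 1 = \<one>" using ring_hom_one[OF c] by (simp add: one_class)
  have add: "c (x + y) = c x \<oplus> c y" for x y
    using ring_hom_add[OF c, of x y] by (simp add: carrier_class plus_class)
  have mult: "c (x * y) = c x \<otimes> c y" for x y
    using ring_hom_mult[OF c, of x y] by (simp add: carrier_class times_class)
  have pf: "prime_fractions P R" if "P \<in> U" for P
    using prime_fractionsI zariski_open_prime[OF U that] .
  fix x y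
  show "scal (spec R c) U x \<in> carrier (sect (spec R c) U)"
    using sections_const[OF U cl _ one_notin_open[OF U]] by simp
  have "frac R P (c x \<otimes> c y) \<one> = frac_mult R P (frac R P (c x) \<one>) (frac R P (c y) \<one>)"
    "frac R P (c x \<oplus> c y) \<one> = frac_add R P (frac R P (c x) \<one>) (frac R P (c y) \<one>)" if "P \<in> U" for P
    using prime_fractions.frac_mult_frac[OF pf[OF that] cl cl, of "\<one>" "\<one>" x y]
      prime_fractions.frac_add_frac[OF pf[OF that] cl cl, of "\<one>" "\<one>" x y]
      prime_fractions.compl_one[OF pf[OF that]] by (simp_all add: cl del: Diff_iff)
  then show "scal (spec R c) U (x \<otimes>\<^bsub>cring_class_ops\<^esub> y) = scal (spec R c) U x \<otimes>\<^bsub>sect (spec R c) U\<^esub> scal (spec R c) U y"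
    and "scal (spec R c) U (x \<oplus>\<^bsub>cring_class_ops\<^esub> y) = scal (spec R c) U x \<oplus>\<^bsub>sect (spec R c) U\<^esub> scal (spec R c) U y"
    by (simp_all add: times_class plus_class mult add cong: restrict_cong)
  show "scal (spec R c) U \<one>\<^bsub>cring_class_ops\<^esub> = \<one>\<^bsub>sect (spec R c) U\<^esub>"
    by (simp add: one_class one)
qed

lemma sheaf_spec:
  assumes c: "c \<in> Ring.ring_hom (cring_class_ops :: 'k::field ring) R"
  shows "sheaf_of_algebras (spec R c)"
  unfolding sheaf_of_algebras_def
proof (intro conjI allI impI)
  fix U assume "kopen (spec R c) U"
  then have U: "zariski_open R U" by simp
  show "cring (sect (spec R c) U)" by (rule cring_sections[OF U])
  show "scal (spec R c) U \<in> Ring.ring_hom cring_class_ops (sect (spec R c) U)"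
    by (rule frac_scal_hom[OF c U])
  show "\<forall>s\<in>carrier (sect (spec R c) U). rstr (spec R c) U U s = s"
    by (auto dest: sections_ext simp: extensional_restrict)
next
  fix U W assume "kopen (spec R c) U \<and> kopen (spec R c) W \<and> W \<subseteq> U"
  then have U: "zariski_open R U" and W: "zariski_open R W" "W \<subseteq> U" by auto
  show "rstr (spec R c) U W \<in> Ring.ring_hom (sect (spec R c) U) (sect (spec R c) W)"
  proof (rule ring_hom_memI)
    fix x y assume "x \<in> carrier (sect (spec R c) U)"
    then show "rstr (spec R c) U W x \<in> carrier (sect (spec R c) W)"
      using W by (simp add: sections_restrict)
  qed (use W in \<open>auto simp: restrict_def fun_eq_iff\<close>)
  fix k show "rstr (spec R c) U W (scal (spec R c) U k) = scal (spec R c) W k"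
    using W by (simp add: Int_absorb1)
next
  fix U W T assume "kopen (spec R c) U \<and> kopen (spec R c) W \<and> kopen (spec R c) T \<and> W \<subseteq> U \<and> T \<subseteq> W"
  then show "\<forall>s\<in>carrier (sect (spec R c) U). rstr (spec R c) W T (rstr (spec R c) U W s) = rstr (spec R c) U T s"
    by (simp add: Int_absorb1)
next
  fix \<U> s
  assume "(\<forall>U\<in>\<U>. kopen (spec R c) U \<and> s U \<in> carrier (sect (spec R c) U)) \<and>
    (\<forall>U\<in>\<U>. \<forall>W\<in>\<U>. rstr (spec R c) U (U \<inter> W) (s U) = rstr (spec R c) W (U \<inter> W) (s W))"
  then have op: "\<And>U. U \<in> \<U> \<Longrightarrow> zariski_open R U" and s: "\<And>U. U \<in> \<U> \<Longrightarrow> s U \<in> spec_sections R U"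
    and glue: "\<And>U W. U \<in> \<U> \<Longrightarrow> W \<in> \<U> \<Longrightarrow> restrict (s U) (U \<inter> W) = restrict (s W) (U \<inter> W)" by auto
  have glue_at: "s U P = s W P" if "U \<in> \<U>" "W \<in> \<U>" "P \<in> U" "P \<in> W" for U W P
    using fun_cong[OF glue[OF that(1,2)], of P] that by simp
  \<comment> \<open>The value at \<open>P\<close> is taken from an arbitrary member of the cover
    containing \<open>P\<close>; by the gluing condition the choice does not matter.\<close>
  define t where "t = (\<lambda>P\<in>\<Union>\<U>. s (SOME U. U \<in> \<U> \<and> P \<in> U) P)"
  have t: "t P = s U P" if "U \<in> \<U>" "P \<in> U" for U P
  proof -
    have some: "(SOME U. U \<in> \<U> \<and> P \<in> U) \<in> \<U> \<and> P \<in> (SOME U. U \<in> \<U> \<and> P \<in> U)"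
      by (rule someI[of "\<lambda>U. U \<in> \<U> \<and> P \<in> U"]) (use that in blast)
    then have "s (SOME U. U \<in> \<U> \<and> P \<in> U) P = s U P" by (intro glue_at) (use that some in simp_all)
    then show ?thesis using that by (auto simp: t_def)
  qed
  have tr: "restrict t U = s U" if "U \<in> \<U>" for U
    using t[OF that] sections_ext[OF s[OF that]] by (intro extensionalityI[of _ U]) auto
  have tS: "t \<in> spec_sections R (\<Union>\<U>)"
  proof (rule sectionsI)
    show "t \<in> extensional (\<Union>\<U>)" by (simp add: t_def)
    fix P assume "P \<in> \<Union>\<U>"
    then obtain U where U: "U \<in> \<U>" "P \<in> U" by blast
    obtain W a r where W: "zariski_open R W" "P \<in> W" "W \<subseteq> U" "a \<in> carrier R" "r \<in> carrier R"
      "\<And>Q. Q \<in> W \<Longrightarrow> r \<notin> Q" "\<And>Q. Q \<in> W \<Longrightarrow> s U Q = frac R Q a r"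
      using sectionsE[OF s[OF U(1)] U(2)] by metis
    have "\<forall>Q\<in>W. r \<notin> Q \<and> t Q = frac R Q a r"
      using W(6,7) t[OF U(1) subsetD[OF W(3)]] by simp
    then show "\<exists>W a r. zariski_open R W \<and> P \<in> W \<and> W \<subseteq> \<Union>\<U> \<and> a \<in> carrier R \<and> r \<in> carrier R \<and>
        (\<forall>Q\<in>W. r \<notin> Q \<and> t Q = frac R Q a r)"
      using W U by (intro exI[of _ W] exI[of _ a] exI[of _ r]) auto
  qed
  show "\<exists>!t. t \<in> carrier (sect (spec R c) (\<Union>\<U>)) \<and> (\<forall>U\<in>\<U>. rstr (spec R c) (\<Union>\<U>) U t = s U)"
  proof (rule ex1I[of _ t])
    show "t \<in> carrier (sect (spec R c) (\<Union>\<U>)) \<and> (\<forall>U\<in>\<U>. rstr (spec R c) (\<Union>\<U>) U t = s U)"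
      using tS tr by simp
    fix r assume r: "r \<in> carrier (sect (spec R c) (\<Union>\<U>)) \<and> (\<forall>U\<in>\<U>. rstr (spec R c) (\<Union>\<U>) U r = s U)"
    show "r = t"
    proof (rule sections_eqI[OF _ tS])
      show "r \<in> spec_sections R (\<Union>\<U>)" using r by simp
      fix P assume "P \<in> \<Union>\<U>"
      then obtain U where U: "U \<in> \<U>" "P \<in> U" by blast
      then have "restrict r U P = s U P" using r by simp
      with U t show "r P = t P" by simp
    qed
  qed
qed

end

section \<open>Global sections\<close>

context cring
begin

lemma ideal_cringI:
  assumes "I \<subseteq> carrier R" "\<zero> \<in> I" "\<And>a b. a \<in> I \<Longrightarrow> b \<in> I \<Longrightarrow> a \<oplus> b \<in> I"
    and mult: "\<And>a x. a \<in> I \<Longrightarrow> x \<in> carrier R \<Longrightarrow> x \<otimes> a \<in> I"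
  shows "ideal I R"
proof (rule idealI)
  show "ring R" by (rule ring_axioms)
  show "subgroup I (add_monoid R)"
  proof
    fix x assume x: "x \<in> I"
    then have "\<ominus> x = (\<ominus> \<one>) \<otimes> x" using assms(1) by (auto simp: l_minus)
    then have "\<ominus> x \<in> I" using mult[OF x, of "\<ominus> \<one>"] by simp
    then show "inv\<^bsub>add_monoid R\<^esub> x \<in> I" by (simp add: a_inv_def)
  qed (use assms in auto)
  fix a x assume "a \<in> I" "x \<in> carrier R"
  then show "x \<otimes> a \<in> I" by (rule mult)
  then show "a \<otimes> x \<in> I" using \<open>a \<in> I\<close> \<open>x \<in> carrier R\<close> assms(1) m_comm[of a x] by auto
qed

text \<open>Zorn's lemma for the ideals above \<open>I\<close> that avoid 1; a maximal one among
  them is a maximal ideal, hence prime.\<close>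

lemma ideal_in_prime:
  assumes I: "ideal I R" "\<one> \<notin> I"
  obtains P where "primeideal P R" "I \<subseteq> P"
proof -
  let ?A = "{J. ideal J R \<and> I \<subseteq> J \<and> \<one> \<notin> J}"
  have "\<exists>M\<in>?A. \<forall>J\<in>?A. M \<subseteq> J \<longrightarrow> J = M"
  proof (rule subset_Zorn_nonempty)
    show "?A \<noteq> {}" using I by blast
    fix C assume C: "C \<noteq> {}" "subset.chain ?A C"
    then have "subset.chain {I. ideal I R} C" by (auto simp: subset.chain_def)
    from chain_Union_is_ideal[OF this] C(1) have "ideal (\<Union>C) R" by simp
    with C show "\<Union>C \<in> ?A" unfolding subset.chain_def by auto
  qed
  then obtain M where M: "ideal M R" "I \<subseteq> M" "\<one> \<notin> M"
    and max: "\<And>J. ideal J R \<Longrightarrow> M \<subseteq> J \<Longrightarrow> \<one> \<notin> J \<Longrightarrow> J = M" by auto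
  have "maximalideal M R"
  proof (rule maximalidealI[OF M(1)])
    show "carrier R \<noteq> M" using M(3) one_closed by blast
    fix J assume "ideal J R" "M \<subseteq> J" "J \<subseteq> carrier R"
    then show "J = M \<or> J = carrier R" using max[of J] ideal.one_imp_carrier by blast
  qed
  then show thesis using maximalideal_prime M(2) that by blast
qed

text \<open>An inverse germ yields \<open>u * a * b = u * s * t\<close> with the right side outside
  \<open>P\<close>. Conversely the fraction can be inverted wherever its numerator lies outside the
  prime. Rational points and locality of morphisms are both decided by this criterion.\<close>

lemma unit_at_spec_iff:
  assumes U: "zariski_open R U" "P \<in> U" and f: "f \<in> spec_sections R U" "f P = frac R P a s"
    and a: "a \<in> carrier R" "s \<in> carrier R - P"
  shows "unit_at (spec R c) P U f \<longleftrightarrow> a \<notin> P"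
proof
  interpret prime_fractions P R by (rule prime_fractionsI[OF zariski_open_prime[OF U]])
  assume "unit_at (spec R c) P U f"
  then obtain W where W: "zariski_open R W" "P \<in> W" "W \<subseteq> U" "restrict f W \<in> Units (sect (spec R c) W)"
    unfolding unit_at_def by auto
  from W(4) obtain g where g: "g \<in> spec_sections R W"
    "restrict f W \<otimes>\<^bsub>sect (spec R c) W\<^esub> g = \<one>\<^bsub>sect (spec R c) W\<^esub>"
    unfolding Units_def by auto
  from fun_cong[OF g(2), of P] W(2) have *: "frac_mult R P (f P) (g P) = frac R P \<one> \<one>" by simp
  obtain b t where b: "g P = frac R P b t" "b \<in> carrier R" "t \<in> carrier R - P"
    using section_in_loc[OF g(1) W(2)] by (auto simp: loc_simps)
  have "frac R P (a \<otimes> b) (s \<otimes> t) = frac R P \<one> \<one>"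
    using * frac_mult_frac[OF a(1) b(2) a(2) b(3)] by (simp add: f(2) b(1))
  then obtain u where u: "u \<in> carrier R - P" "u \<otimes> (a \<otimes> b \<otimes> \<one>) = u \<otimes> (\<one> \<otimes> (s \<otimes> t))"
    by (rule frac_eqD) (auto simp: one_notin)
  show "a \<notin> P"
  proof
    assume "a \<in> P"
    then have "u \<otimes> (a \<otimes> b \<otimes> \<one>) \<in> P" using u b a by (intro I_l_closed I_r_closed) auto
    moreover have "u \<otimes> (\<one> \<otimes> (s \<otimes> t)) \<in> carrier R - P"
      using u(1) a(2) b(3) by (intro compl_mult compl_one) auto
    ultimately show False using u(2) by simp
  qed
next
  interpret prime_fractions P R by (rule prime_fractionsI[OF zariski_open_prime[OF U]])
  assume aP: "a \<notin> P"
  obtain W b t where W: "zariski_open R W" "P \<in> W" "W \<subseteq> U" "b \<in> carrier R" "t \<in> carrier R"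
    "\<And>Q. Q \<in> W \<Longrightarrow> t \<notin> Q" "\<And>Q. Q \<in> W \<Longrightarrow> f Q = frac R Q b t"
    using sectionsE[OF f(1) U(2)] by metis
  have tP: "t \<in> carrier R - P" using W by auto
  have "frac R P a s = frac R P b t" using W(7)[OF W(2)] f(2) by simp
  then obtain u where u: "u \<in> carrier R - P" "u \<otimes> (a \<otimes> t) = u \<otimes> (b \<otimes> s)"
    by (rule frac_eqD[OF _ W(4) tP])
  have bP: "b \<notin> P"
  proof
    assume "b \<in> P"
    then have "u \<otimes> (b \<otimes> s) \<in> P" using u a by (intro I_l_closed I_r_closed) auto
    moreover have "u \<otimes> (a \<otimes> t) \<in> carrier R - P" using u(1) tP a aP by (intro compl_mult) auto
    ultimately show False using u(2) by simp
  qed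
  \<comment> \<open>Near \<open>P\<close> the section is \<open>b/t\<close>; on the part of
    \<open>W\<close> where \<open>b\<close> lies outside the prime, \<open>t/b\<close> is an
    inverse.\<close>
  let ?T = "W \<inter> {Q. primeideal Q R \<and> b \<notin> Q}"
  have T: "zariski_open R ?T" by (intro zariski_open_Int W(1) zariski_open_basic W(4))
  let ?g = "\<lambda>Q\<in>?T. frac R Q t b"
  have g: "?g \<in> spec_sections R ?T" by (rule sections_const[OF T W(5,4)]) auto
  have fT: "restrict f ?T \<in> spec_sections R ?T" by (rule sections_restrict[OF f(1) T]) (use W in auto)
  have prod: "frac_mult R Q (f Q) (frac R Q t b) = frac R Q \<one> \<one>" if Q: "Q \<in> ?T" for Q
  proof -
    interpret Q: prime_fractions Q R using Q by (intro prime_fractionsI) auto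
    have tb: "t \<in> carrier R - Q" "b \<in> carrier R - Q" using Q W by auto
    have "frac_mult R Q (frac R Q b t) (frac R Q t b) = frac R Q (b \<otimes> t) (t \<otimes> b)"
      by (rule Q.frac_mult_frac[OF W(4,5) tb])
    also have "\<dots> = frac R Q \<one> \<one>"
      using W Q.compl_mult[OF tb] Q.compl_one by (intro Q.frac_eqI1) (auto simp: m_comm)
    finally show ?thesis using W(7) Q by simp
  qed
  interpret S: cring "sect (spec R c) ?T" by (rule cring_sections[OF T])
  have "restrict f ?T \<otimes>\<^bsub>sect (spec R c) ?T\<^esub> ?g = \<one>\<^bsub>sect (spec R c) ?T\<^esub>"
    using prod by (auto intro!: restrict_ext)
  moreover have "?g \<otimes>\<^bsub>sect (spec R c) ?T\<^esub> restrict f ?T = \<one>\<^bsub>sect (spec R c) ?T\<^esub>"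
    using calculation S.m_comm[of "restrict f ?T" ?g] fT g by (simp del: spec_simps(3-8))
  ultimately have "restrict f ?T \<in> Units (sect (spec R c) ?T)"
    unfolding Units_def using fT g by (auto simp del: spec_simps(3-8))
  then show "unit_at (spec R c) P U f"
    unfolding unit_at_def using T W bP zariski_open_prime[OF U]
    by (intro exI[of _ ?T]) (auto simp del: spec_simps(3-6))
qed

end

text \<open>The intersection of all primes is the nilradical, so the condition means that the ring
  is reduced. It is stated in the form in which it is applied.\<close>

locale jacobson_free = cring R for R (structure) +
  assumes Inter_primes: "\<And>a. a \<in> carrier R \<Longrightarrow> (\<And>P. primeideal P R \<Longrightarrow> a \<in> P) \<Longrightarrow> a = \<zero>"
begin

definition glob :: "'a \<Rightarrow> 'a set \<Rightarrow> ('a \<times> 'a) set" where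
  "glob a = (\<lambda>P\<in>{P. primeideal P R}. frac R P a \<one>)"

lemma glob_section: "a \<in> carrier R \<Longrightarrow> glob a \<in> spec_sections R {P. primeideal P R}"
  unfolding glob_def
  using one_notin_open[OF zariski_open_primes] by (intro sections_const[OF zariski_open_primes]) auto

text \<open>The denominators \<open>d\<close> for which \<open>d * f\<close> comes from a ring
  element form an ideal \<open>I\<close>. If \<open>f = a/s\<close> where \<open>h\<close> does not
  vanish, then \<open>s * h\<close> belongs to \<open>I\<close>; hence \<open>I\<close> lies in no
  prime and contains 1, which gives \<open>f\<close> itself.\<close>

lemma glob_surj:
  assumes f: "f \<in> spec_sections R {P. primeideal P R}"
  obtains a where "a \<in> carrier R" "f = glob a"
proof -
  define I where "I = {d \<in> carrier R. \<exists>b\<in>carrier R. \<forall>Q. primeideal Q R \<longrightarrow>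
    frac_mult R Q (frac R Q d \<one>) (f Q) = frac R Q b \<one>}"
  have fQ: "f Q \<in> carrier (loc R Q)" if "primeideal Q R" for Q
    using section_in_loc[OF f] that by simp
  have I: "ideal I R"
  proof (rule ideal_cringI)
    show "I \<subseteq> carrier R" by (auto simp: I_def)
    show "\<zero> \<in> I"
    proof -
      have "frac_mult R Q (frac R Q \<zero> \<one>) (f Q) = frac R Q \<zero> \<one>" if "primeideal Q R" for Q
      proof -
        interpret L: cring "loc R Q" by (rule loc_cringI[OF that])
        show ?thesis using L.l_null[OF fQ[OF that]] by (simp add: loc_simps)
      qed
      then show ?thesis by (auto simp: I_def)
    qed
    fix d e assume "d \<in> I" "e \<in> I"
    then obtain b g where b: "d \<in> carrier R" "b \<in> carrier R" "e \<in> carrier R" "g \<in> carrier R"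
      "\<And>Q. primeideal Q R \<Longrightarrow> frac_mult R Q (frac R Q d \<one>) (f Q) = frac R Q b \<one>"
      "\<And>Q. primeideal Q R \<Longrightarrow> frac_mult R Q (frac R Q e \<one>) (f Q) = frac R Q g \<one>"
      by (auto simp: I_def)
    have "frac_mult R Q (frac R Q (d \<oplus> e) \<one>) (f Q) = frac R Q (b \<oplus> g) \<one>" if Q: "primeideal Q R" for Q
    proof -
      interpret Q: prime_fractions Q R by (rule prime_fractionsI[OF Q])
      interpret L: cring "loc R Q" by (rule loc_cringI[OF Q])
      have mem: "frac R Q d \<one> \<in> carrier (loc R Q)" "frac R Q e \<one> \<in> carrier (loc R Q)"
        using b Q.compl_one by (auto simp: loc_simps)
      have add: "frac_add R Q (frac R Q x \<one>) (frac R Q y \<one>) = frac R Q (x \<oplus> y) \<one>"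
        if "x \<in> carrier R" "y \<in> carrier R" for x y
        using that Q.frac_add_frac[OF that Q.compl_one Q.compl_one] by simp
      show ?thesis
        using L.l_distr[OF mem fQ[OF Q]] b(5,6)[OF Q] by (simp add: loc_simps add b)
    qed
    then show "d \<oplus> e \<in> I" using b by (auto simp: I_def)
  next
    fix d x assume "d \<in> I" and x: "x \<in> carrier R"
    then obtain b where b: "d \<in> carrier R" "b \<in> carrier R"
      "\<And>Q. primeideal Q R \<Longrightarrow> frac_mult R Q (frac R Q d \<one>) (f Q) = frac R Q b \<one>"
      by (auto simp: I_def)
    have "frac_mult R Q (frac R Q (x \<otimes> d) \<one>) (f Q) = frac R Q (x \<otimes> b) \<one>" if Q: "primeideal Q R" for Q
    proof -
      interpret Q: prime_fractions Q R by (rule prime_fractionsI[OF Q])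
      interpret L: cring "loc R Q" by (rule loc_cringI[OF Q])
      have mem: "frac R Q d \<one> \<in> carrier (loc R Q)" "frac R Q x \<one> \<in> carrier (loc R Q)"
        using b x Q.compl_one by (auto simp: loc_simps)
      have mult: "frac_mult R Q (frac R Q y \<one>) (frac R Q z \<one>) = frac R Q (y \<otimes> z) \<one>"
        if "y \<in> carrier R" "z \<in> carrier R" for y z
        using that Q.frac_mult_frac[OF that Q.compl_one Q.compl_one] by simp
      show ?thesis
        using L.m_assoc[OF mem(2,1) fQ[OF Q]] b(3)[OF Q] by (simp add: loc_simps mult b x)
    qed
    then show "x \<otimes> d \<in> I" using b x by (auto simp: I_def)
  qed
  have not_prime: "\<exists>d\<in>I. d \<notin> P" if P: "primeideal P R" for P
  proof -
    interpret P: prime_fractions P R by (rule prime_fractionsI[OF P])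
    have "P \<in> {P. primeideal P R}" using P by simp
    from sectionsE[OF f this] obtain W a s where W: "zariski_open R W" "P \<in> W" "a \<in> carrier R" "s \<in> carrier R"
      "\<And>Q. Q \<in> W \<Longrightarrow> s \<notin> Q" "\<And>Q. Q \<in> W \<Longrightarrow> f Q = frac R Q a s" by metis
    obtain E where E: "E \<subseteq> carrier R" "W = {P. primeideal P R \<and> \<not> E \<subseteq> P}"
      using W(1) unfolding zariski_open_def by blast
    obtain h where h: "h \<in> E" "h \<notin> P" using W(2) E by blast
    have hR: "h \<in> carrier R" using h E by blast
    have Dh: "Q \<in> W" if "primeideal Q R" "h \<notin> Q" for Q using that h E by blast
    have "frac_mult R Q (frac R Q (s \<otimes> h) \<one>) (f Q) = frac R Q (a \<otimes> h) \<one>" if Q: "primeideal Q R" for Q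
    proof -
      interpret Q: prime_fractions Q R by (rule prime_fractionsI[OF Q])
      have "Q \<in> {P. primeideal P R}" using Q by simp
      from sectionsE[OF f this] obtain T b t where T: "zariski_open R T" "Q \<in> T" "b \<in> carrier R" "t \<in> carrier R"
        "\<And>Q. Q \<in> T \<Longrightarrow> t \<notin> Q" "\<And>Q. Q \<in> T \<Longrightarrow> f Q = frac R Q b t" by metis
      obtain F where F: "F \<subseteq> carrier R" "T = {P. primeideal P R \<and> \<not> F \<subseteq> P}"
        using T(1) unfolding zariski_open_def by blast
      obtain g where g: "g \<in> F" "g \<notin> Q" using T(2) F by blast
      have gR: "g \<in> carrier R" using g F by blast
      have Dg: "Q' \<in> T" if "primeideal Q' R" "g \<notin> Q'" for Q' using that g F by blast
      \<comment> \<open>A prime containing \<open>h\<close> or \<open>g\<close> contains the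
        product. At any other prime both fractions represent \<open>f\<close>, so their cross
        difference lies in that prime. Reducedness turns membership in all primes into
        vanishing.\<close>
      have "h \<otimes> g \<otimes> (a \<otimes> t \<ominus> b \<otimes> s) = \<zero>"
      proof (rule Inter_primes)
        fix Q' assume Q': "primeideal Q' R"
        interpret Q': prime_fractions Q' R by (rule prime_fractionsI[OF Q'])
        show "h \<otimes> g \<otimes> (a \<otimes> t \<ominus> b \<otimes> s) \<in> Q'"
        proof (cases "h \<in> Q' \<or> g \<in> Q'")
          case True
          then have "h \<otimes> g \<in> Q'" using hR gR Q'.I_l_closed Q'.I_r_closed by blast
          then show ?thesis by (rule Q'.I_r_closed) (use W T in simp)
        next
          case False
          then have QW: "Q' \<in> W" "Q' \<in> T" using Dh[OF Q'] Dg[OF Q'] by auto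
          then have "frac R Q' a s = frac R Q' b t" using W(6) T(6) by metis
          then obtain u where u: "u \<in> carrier R - Q'" "u \<otimes> (a \<otimes> t) = u \<otimes> (b \<otimes> s)"
            by (rule Q'.frac_eqD) (use T QW in auto)
          have "u \<otimes> (a \<otimes> t \<ominus> b \<otimes> s) = u \<otimes> (a \<otimes> t) \<ominus> u \<otimes> (b \<otimes> s)"
            using u(1) W T by (simp add: a_minus_def r_distr r_minus)
          also have "\<dots> = \<zero>" using u W T by (simp add: r_neg a_minus_def)
          finally have "u \<otimes> (a \<otimes> t \<ominus> b \<otimes> s) \<in> Q'" using Q'.zero_closed by simp
          then have "a \<otimes> t \<ominus> b \<otimes> s \<in> Q'" using Q'.I_prime[of u "a \<otimes> t \<ominus> b \<otimes> s"] u W T by auto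
          then show ?thesis using hR gR by (intro Q'.I_l_closed) auto
        qed
      qed (use hR gR W T in auto)
      then have "h \<otimes> g \<otimes> (a \<otimes> t) \<ominus> h \<otimes> g \<otimes> (b \<otimes> s) = \<zero>"
        using hR gR W T by (simp add: a_minus_def r_distr r_minus)
      then have eq: "h \<otimes> g \<otimes> (a \<otimes> t) = h \<otimes> g \<otimes> (b \<otimes> s)"
        using hR gR W T by (simp add: r_right_minus_eq)
      have tQ: "t \<in> carrier R - Q" using T by auto
      have "frac_mult R Q (frac R Q (s \<otimes> h) \<one>) (f Q) = frac R Q (s \<otimes> h \<otimes> b) (\<one> \<otimes> t)"
        unfolding T(6)[OF T(2)] by (rule Q.frac_mult_frac) (use W hR T tQ Q.compl_one in auto)
      also have "\<dots> = frac R Q (a \<otimes> h) \<one>"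
      proof (rule Q.frac_eqI[where u = g])
        have "g \<otimes> (s \<otimes> h \<otimes> b \<otimes> \<one>) = h \<otimes> g \<otimes> (b \<otimes> s)" using gR hR W T by (simp add: m_ac)
        also have "\<dots> = g \<otimes> (a \<otimes> h \<otimes> (\<one> \<otimes> t))" unfolding eq[symmetric] using gR hR W T by (simp add: m_ac)
        finally show "g \<otimes> (s \<otimes> h \<otimes> b \<otimes> \<one>) = g \<otimes> (a \<otimes> h \<otimes> (\<one> \<otimes> t))" .
      qed (use W hR gR g T tQ Q.compl_one in auto)
      finally show ?thesis .
    qed
    then have "s \<otimes> h \<in> I" using W hR by (auto simp: I_def)
    moreover have "s \<otimes> h \<notin> P" using P.compl_mult[of s h] W(4,5) W(2) hR h by blast
    ultimately show ?thesis by blast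
  qed
  have "\<one> \<in> I"
  proof (rule ccontr)
    assume "\<one> \<notin> I"
    from ideal_in_prime[OF I this] obtain P where "primeideal P R" "I \<subseteq> P" .
    with not_prime[of P] show False by auto
  qed
  then obtain b where b: "b \<in> carrier R"
    "\<And>Q. primeideal Q R \<Longrightarrow> frac_mult R Q (frac R Q \<one> \<one>) (f Q) = frac R Q b \<one>"
    by (auto simp: I_def)
  have "f Q = frac R Q b \<one>" if Q: "primeideal Q R" for Q
  proof -
    interpret L: cring "loc R Q" by (rule loc_cringI[OF Q])
    show ?thesis using L.l_one[OF fQ[OF Q]] b(2)[OF Q] by (simp add: loc_simps)
  qed
  then have "f = glob b"
    by (intro sections_eqI[OF f glob_section[OF b(1)]]) (simp add: glob_def)
  with b(1) show thesis by (rule that)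
qed

lemma glob_eq_zero:
  assumes a: "a \<in> carrier R" and g: "glob a = glob \<zero>"
  shows "a = \<zero>"
proof (rule Inter_primes[OF a])
  fix P assume P: "primeideal P R"
  interpret P: prime_fractions P R by (rule prime_fractionsI[OF P])
  have "frac R P a \<one> = frac R P \<zero> \<one>" using fun_cong[OF g, of P] P by (simp add: glob_def)
  then obtain u where u: "u \<in> carrier R - P" "u \<otimes> (a \<otimes> \<one>) = u \<otimes> (\<zero> \<otimes> \<one>)"
    by (rule P.frac_eqD) (auto simp: P.one_notin)
  then have "u \<otimes> a \<in> P" using a P.zero_closed by simp
  then show "a \<in> P" using P.I_prime[of u a] u a by auto
qed

lemma glob_hom: "glob \<in> Ring.ring_hom R (sect (spec R c) {P. primeideal P R})"
proof (rule ring_hom_memI)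
  fix x y assume xy: "x \<in> carrier R" "y \<in> carrier R"
  have 1: "frac_mult R P (frac R P x \<one>) (frac R P y \<one>) = frac R P (x \<otimes> y) \<one>"
    "frac_add R P (frac R P x \<one>) (frac R P y \<one>) = frac R P (x \<oplus> y) \<one>" if "primeideal P R" for P
  proof -
    interpret P: prime_fractions P R by (rule prime_fractionsI[OF that])
    show "frac_mult R P (frac R P x \<one>) (frac R P y \<one>) = frac R P (x \<otimes> y) \<one>"
      "frac_add R P (frac R P x \<one>) (frac R P y \<one>) = frac R P (x \<oplus> y) \<one>"
      using P.frac_mult_frac[OF xy P.compl_one P.compl_one] P.frac_add_frac[OF xy P.compl_one P.compl_one] xy
      by simp_all
  qed
  show "glob (x \<otimes> y) = glob x \<otimes>\<^bsub>sect (spec R c) {P. primeideal P R}\<^esub> glob y"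
    by (auto simp: glob_def 1 intro!: restrict_ext)
  show "glob (x \<oplus> y) = glob x \<oplus>\<^bsub>sect (spec R c) {P. primeideal P R}\<^esub> glob y"
    by (auto simp: glob_def 1 intro!: restrict_ext)
  show "glob x \<in> carrier (sect (spec R c) {P. primeideal P R})" using glob_section xy by simp
next
  show "glob \<one> = \<one>\<^bsub>sect (spec R c) {P. primeideal P R}\<^esub>" by (simp add: glob_def)
qed

lemma square_zero:
  assumes "a \<in> carrier R" "a \<otimes> a = \<zero>"
  shows "a = \<zero>"
proof (rule Inter_primes[OF assms(1)])
  fix P assume "primeideal P R"
  then interpret primeideal P R .
  show "a \<in> P" using I_prime[OF assms(1,1)] assms(2) zero_closed by auto
qed

end

text \<open>Descent on the exponent: if \<open>x^(n+1) = 0\<close> with \<open>n >= 1\<close>, then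
  \<open>x^n\<close> has square 0, because \<open>2 * n >= n + 1\<close>.\<close>

lemma (in cring) pow_zero_of_square_zero:
  assumes sq: "\<And>x. x \<in> carrier R \<Longrightarrow> x \<otimes> x = \<zero> \<Longrightarrow> x = \<zero>"
    and x: "x \<in> carrier R" "x [^] (n::nat) = \<zero>"
  shows "x = \<zero>"
  using x(2)
proof (induct n)
  case 0
  then have "\<one> = \<zero>" by simp
  then show ?case using x(1) l_one[of x] l_null[of x] by simp
next
  case (Suc n)
  show ?case
  proof (cases n)
    case 0
    with Suc(2) x(1) show ?thesis by simp
  next
    case (Suc k)
    have "x [^] n \<otimes> x [^] n = x [^] (n + n)" by (rule nat_pow_mult[OF x(1)])
    also have "n + n = Suc n + k" by (simp add: Suc)
    also have "x [^] (Suc n + k) = x [^] Suc n \<otimes> x [^] k" by (rule nat_pow_mult[OF x(1), symmetric])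
    also have "\<dots> = \<zero>" using Suc.prems x(1) by simp
    finally have "x [^] n \<otimes> x [^] n = \<zero>" .
    then have "x [^] n = \<zero>" by (rule sq[OF nat_pow_closed[OF x(1)]])
    then show ?thesis by (rule Suc.hyps)
  qed
qed

lemma (in jacobson_free) reduced_spec: "reduced_scheme (spec R c)"
  unfolding reduced_scheme_def
proof (intro allI impI, elim conjE exE)
  fix U f and n :: nat
  assume "kopen (spec R c) U"
  then have U: "zariski_open R U" by simp
  interpret S: cring "sect (spec R c) U" by (rule cring_sections[OF U])
  assume f: "f \<in> carrier (sect (spec R c) U)" "f [^]\<^bsub>sect (spec R c) U\<^esub> n = \<zero>\<^bsub>sect (spec R c) U\<^esub>"
  show "f = \<zero>\<^bsub>sect (spec R c) U\<^esub>"
  proof (rule S.pow_zero_of_square_zero[OF _ f])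
    fix g assume g: "g \<in> carrier (sect (spec R c) U)"
      and sq: "g \<otimes>\<^bsub>sect (spec R c) U\<^esub> g = \<zero>\<^bsub>sect (spec R c) U\<^esub>"
    show "g = \<zero>\<^bsub>sect (spec R c) U\<^esub>"
    proof (rule sections_eqI)
      show "g \<in> spec_sections R U" using g by simp
      show "\<zero>\<^bsub>sect (spec R c) U\<^esub> \<in> spec_sections R U" using S.zero_closed by (simp del: spec_simps(5))
      fix P assume P: "P \<in> U"
      interpret P: prime_fractions P R by (rule prime_fractionsI[OF zariski_open_prime[OF U P]])
      obtain a s where a: "g P = frac R P a s" "a \<in> carrier R" "s \<in> carrier R - P"
        using section_in_loc[of g R U P] g P by (auto simp: loc_simps)
      have "frac R P (a \<otimes> a) (s \<otimes> s) = frac R P \<zero> \<one>"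
        using fun_cong[OF sq, of P] P P.frac_mult_frac[OF a(2,2,3,3)] by (simp add: a(1))
      then obtain u where u: "u \<in> carrier R - P" "u \<otimes> (a \<otimes> a \<otimes> \<one>) = u \<otimes> (\<zero> \<otimes> (s \<otimes> s))"
        by (rule P.frac_eqD) (auto simp: P.one_notin)
      then have uaa: "u \<otimes> (a \<otimes> a) = \<zero>" using a by simp
      have uR: "u \<in> carrier R" using u by simp
      \<comment> \<open>A square zero germ \<open>a/s\<close> only gives \<open>u * a^2 = 0\<close>
        for some \<open>u\<close> outside \<open>P\<close>. Moving \<open>u\<close> into the element
        makes \<open>u * a\<close> square zero in the ring, so it vanishes.\<close>
      have "(u \<otimes> a) \<otimes> (u \<otimes> a) = u \<otimes> (u \<otimes> (a \<otimes> a))" using uR a(2) by (simp add: m_ac)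
      then have "(u \<otimes> a) \<otimes> (u \<otimes> a) = \<zero>" unfolding uaa using uR by simp
      then have "u \<otimes> a = \<zero>" by (rule square_zero[OF m_closed[OF uR a(2)]])
      then have "frac R P a s = frac R P \<zero> \<one>"
        using u a P.compl_one by (intro P.frac_eqI[where u = u]) auto
      then show "g P = \<zero>\<^bsub>sect (spec R c) U\<^esub> P" using P a by simp
    qed
  qed
qed

section \<open>Affine varieties and their morphisms\<close>

lemma kisomorphic_refl:
  assumes M: "sheaf_of_algebras (M :: ('p, 's, 'k::field) kspace)"
  shows "kisomorphic M M"
proof -
  have pre: "preim M (\<lambda>x. x) V = V" if "kopen M V" for V
    using openin_subset[OF that] by (auto simp: preim_def)
  have id: "(\<lambda>s. s) \<in> Ring.ring_hom (sect M V) (sect M V)" for V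
    by (rule ring_hom_memI) auto
  have "kmorphism M M (\<lambda>x. x) (\<lambda>V s. s)"
    unfolding kmorphism_def
  proof (intro conjI allI impI ballI)
    fix x V s assume "kopen M V \<and> x \<in> V" "unit_at M x (preim M (\<lambda>x. x) V) s"
    then show "unit_at M x V s" by (simp add: pre)
  qed (auto simp: pre id)
  moreover have "homeomorphic_map (space_topology M) (space_topology M) (\<lambda>x. x)"
    using homeomorphic_map_id[of "space_topology M" "space_topology M"] by (simp add: id_def)
  moreover have "bij_betw (\<lambda>s. s) A A" for A :: "'s set"
    by (simp add: bij_betw_def)
  ultimately show ?thesis
    unfolding kisomorphic_def by (intro exI[of _ "\<lambda>x. x"] exI[of _ "\<lambda>V s. s"]) (simp add: pre)
qed

lemma restrict_kspace_whole: "restrict_kspace M (kpts M) = M"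
  by (simp add: restrict_kspace_def)

lemma affine_open_whole:
  fixes J :: "'k::field kpoly set"
  assumes "ideal J (kpoly_ring n)" "sheaf_of_algebras (closed_subscheme n J)"
  shows "affine_open (closed_subscheme n J) (kpts (closed_subscheme n J))"
  unfolding affine_open_def restrict_kspace_whole
  using kisomorphic_refl[OF assms(2)] assms(1) by blast

text \<open>The space covers itself, so all that remains of the condition on the diagonal is that
  each section \<open>s\<close> is a sum of products, and \<open>s * 1\<close> is one.\<close>

lemma separated_whole:
  fixes M :: "('p, 's, 'k::field) kspace"
  assumes M: "sheaf_of_algebras M" and aff: "affine_open M (kpts M)"
  shows "separated_scheme M"
  unfolding separated_scheme_def
proof (intro exI[of _ "{kpts M}"] conjI ballI)
  fix U W s assume UW: "U \<in> {kpts M}" "W \<in> {kpts M}"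
  have op: "kopen M (kpts M)" by simp
  have "\<forall>U. kopen M U \<longrightarrow> cring (sect M U) \<and> scal M U \<in> Ring.ring_hom cring_class_ops (sect M U) \<and>
      (\<forall>s\<in>carrier (sect M U). rstr M U U s = s)"
    using M unfolding sheaf_of_algebras_def by (rule conjunct1)
  from this[rule_format, OF op]
  have cr: "cring (sect M (kpts M))" and rs: "\<forall>s\<in>carrier (sect M (kpts M)). rstr M (kpts M) (kpts M) s = s"
    by simp_all
  interpret cring "sect M (kpts M)" by (rule cr)
  show "affine_open M (U \<inter> W)" using UW aff by simp
  assume s: "s \<in> carrier (sect M (U \<inter> W))"
  have "s = (\<Oplus>\<^bsub>sect M (kpts M)\<^esub>i\<in>{..<1::nat}. s \<otimes>\<^bsub>sect M (kpts M)\<^esub> \<one>\<^bsub>sect M (kpts M)\<^esub>)"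
    using s UW by (simp add: lessThan_Suc)
  then show "\<exists>(n::nat) a b. (\<forall>i<n. a i \<in> carrier (sect M U) \<and> b i \<in> carrier (sect M W)) \<and>
    s = (\<Oplus>\<^bsub>sect M (U \<inter> W)\<^esub>i\<in>{..<n}. rstr M U (U \<inter> W) (a i) \<otimes>\<^bsub>sect M (U \<inter> W)\<^esub> rstr M W (U \<inter> W) (b i))"
    using s UW rs by (intro exI[of _ 1] exI[of _ "\<lambda>_. s"] exI[of _ "\<lambda>_. \<one>\<^bsub>sect M (kpts M)\<^esub>"]) simp
qed (use aff in simp_all)

lemma kvariety_closed_subscheme:
  fixes J :: "'k::field kpoly set"
  assumes J: "ideal J (kpoly_ring n)" and R: "jacobson_free (kpoly_ring n Quot J)"
    and c: "(\<lambda>k. J +>\<^bsub>kpoly_ring n\<^esub> mpoly_const cring_class_ops k) \<in> Ring.ring_hom cring_class_ops (kpoly_ring n Quot J)"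
  shows "kvariety (closed_subscheme n J)"
proof -
  interpret jacobson_free "kpoly_ring n Quot J" by (rule R)
  have sh: "sheaf_of_algebras (closed_subscheme n J)"
    unfolding closed_subscheme_def by (rule sheaf_spec[OF c])
  have aff: "affine_open (closed_subscheme n J) (kpts (closed_subscheme n J))"
    by (rule affine_open_whole[OF J sh])
  have "finite_type_scheme (closed_subscheme n J)"
    unfolding finite_type_scheme_def
    using sh aff by (intro conjI exI[of _ "{kpts (closed_subscheme n J)}"]) auto
  moreover have "reduced_scheme (closed_subscheme n J)"
    unfolding closed_subscheme_def by (rule reduced_spec)
  ultimately show ?thesis
    unfolding kvariety_def using separated_whole[OF sh aff] by blast
qed

section \<open>The morphism of spectra induced by a ring homomorphism\<close>

lemma UN_pair_const:
  assumes "(a, s) \<in> A" "\<And>b t. (b, t) \<in> A \<Longrightarrow> F b t = c"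
  shows "(\<Union>(b, t)\<in>A. F b t) = c"
  using assms by fastforce

definition spec_pt :: "('a, 'm) ring_scheme \<Rightarrow> ('a \<Rightarrow> 'b) \<Rightarrow> 'b set \<Rightarrow> 'a set" where
  "spec_pt R h P = {r \<in> carrier R. h r \<in> P}"

definition frac_map :: "('b, 'm) ring_scheme \<Rightarrow> ('a \<Rightarrow> 'b) \<Rightarrow> 'b set \<Rightarrow> ('a \<times> 'a) set \<Rightarrow> ('b \<times> 'b) set" where
  "frac_map S h P x = (\<Union>(a, s)\<in>x. frac S P (h a) (h s))"

definition spec_pull :: "('a, 'm) ring_scheme \<Rightarrow> ('b, 'n) ring_scheme \<Rightarrow> ('a \<Rightarrow> 'b) \<Rightarrow> 'a set set \<Rightarrow>
    'a spec_section \<Rightarrow> 'b spec_section" where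
  "spec_pull R S h V f = (\<lambda>P\<in>{P. primeideal P S \<and> spec_pt R h P \<in> V}. frac_map S h P (f (spec_pt R h P)))"

context ring_hom_cring
begin

lemma spec_pt_prime: "primeideal P S \<Longrightarrow> primeideal (spec_pt R h P) R"
  unfolding spec_pt_def
  by (rule ring_hom_ring.primeideal_vimage[OF _ R.is_cring]) (rule ring_hom_ringI2[OF R.ring_axioms S.ring_axioms homh])

lemma frac_map_frac:
  assumes P: "primeideal P S" and a: "a \<in> carrier R" "s \<in> carrier R - spec_pt R h P"
  shows "frac_map S h P (frac R (spec_pt R h P) a s) = frac S P (h a) (h s)"
proof -
  note pfQ = R.prime_fractionsI[OF spec_pt_prime[OF P]]
  note pfP = S.prime_fractionsI[OF P]
  have compl: "h t \<in> carrier S - P" if "t \<in> carrier R - spec_pt R h P" for t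
    using that by (auto simp: spec_pt_def)
  have eq: "frac S P (h b) (h t) = frac S P (h a) (h s)" if bt: "(b, t) \<in> frac R (spec_pt R h P) a s" for b t
  proof -
    note b = prime_fractions.frac_mem_eq[OF pfQ a bt]
    obtain u where u: "u \<in> carrier R - spec_pt R h P" "u \<otimes>\<^bsub>R\<^esub> (b \<otimes>\<^bsub>R\<^esub> s) = u \<otimes>\<^bsub>R\<^esub> (a \<otimes>\<^bsub>R\<^esub> t)"
      using prime_fractions.frac_eqD[OF pfQ b(3) a] by metis
    have "h (u \<otimes>\<^bsub>R\<^esub> (b \<otimes>\<^bsub>R\<^esub> s)) = h (u \<otimes>\<^bsub>R\<^esub> (a \<otimes>\<^bsub>R\<^esub> t))" by (simp add: u(2))
    then have "h u \<otimes>\<^bsub>S\<^esub> (h b \<otimes>\<^bsub>S\<^esub> h s) = h u \<otimes>\<^bsub>S\<^esub> (h a \<otimes>\<^bsub>S\<^esub> h t)"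
      using u(1) a b by simp
    then show ?thesis using a b compl u(1) by (intro prime_fractions.frac_eqI[OF pfP, where u = "h u"]) auto
  qed
  show ?thesis
    unfolding frac_map_def by (rule UN_pair_const[OF prime_fractions.frac_self[OF pfQ a] eq])
qed

lemma zariski_open_vimage:
  assumes "zariski_open R V"
  shows "zariski_open S {P. primeideal P S \<and> spec_pt R h P \<in> V}"
proof -
  obtain E where E: "E \<subseteq> carrier R" "V = {P. primeideal P R \<and> \<not> E \<subseteq> P}"
    using assms unfolding zariski_open_def by blast
  have "{P. primeideal P S \<and> spec_pt R h P \<in> V} = {P. primeideal P S \<and> \<not> h ` E \<subseteq> P}"
    using E spec_pt_prime by (auto simp: spec_pt_def)
  moreover have "h ` E \<subseteq> carrier S" using E by auto
  ultimately show ?thesis unfolding zariski_open_def by blast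
qed

lemma spec_pull_section:
  assumes V: "zariski_open R V" and f: "f \<in> spec_sections R V"
  shows "spec_pull R S h V f \<in> spec_sections S {P. primeideal P S \<and> spec_pt R h P \<in> V}"
proof (rule sectionsI)
  show "spec_pull R S h V f \<in> extensional {P. primeideal P S \<and> spec_pt R h P \<in> V}"
    by (simp add: spec_pull_def)
  fix P assume "P \<in> {P. primeideal P S \<and> spec_pt R h P \<in> V}"
  then have P: "primeideal P S" "spec_pt R h P \<in> V" by auto
  obtain W a s where W: "zariski_open R W" "spec_pt R h P \<in> W" "W \<subseteq> V" "a \<in> carrier R" "s \<in> carrier R"
    "\<And>Q. Q \<in> W \<Longrightarrow> s \<notin> Q" "\<And>Q. Q \<in> W \<Longrightarrow> f Q = frac R Q a s"
    using sectionsE[OF f P(2)] by metis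
  have "h s \<notin> Q \<and> spec_pull R S h V f Q = frac S Q (h a) (h s)" if Q: "primeideal Q S" "spec_pt R h Q \<in> W" for Q
  proof -
    have s: "s \<in> carrier R - spec_pt R h Q" using W(5) W(6)[OF Q(2)] by blast
    moreover have "spec_pull R S h V f Q = frac S Q (h a) (h s)"
      using Q W(3) W(7)[OF Q(2)] frac_map_frac[OF Q(1) W(4) s] by (auto simp: spec_pull_def)
    ultimately show ?thesis by (simp add: spec_pt_def)
  qed
  then show "\<exists>W a s. zariski_open S W \<and> P \<in> W \<and> W \<subseteq> {P. primeideal P S \<and> spec_pt R h P \<in> V} \<and>
      a \<in> carrier S \<and> s \<in> carrier S \<and> (\<forall>Q\<in>W. s \<notin> Q \<and> spec_pull R S h V f Q = frac S Q a s)"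
    using W(2-5) P(1) zariski_open_vimage[OF W(1)]
    by (intro exI[of _ "{P. primeideal P S \<and> spec_pt R h P \<in> W}"] exI[of _ "h a"] exI[of _ "h s"]) auto
qed

lemma spec_pull_frac:
  assumes a: "a \<in> carrier R"
  shows "spec_pull R S h V (\<lambda>P\<in>V. frac R P a \<one>\<^bsub>R\<^esub>) =
    (\<lambda>P\<in>{P. primeideal P S \<and> spec_pt R h P \<in> V}. frac S P (h a) \<one>\<^bsub>S\<^esub>)"
proof -
  have "frac_map S h P (frac R (spec_pt R h P) a \<one>\<^bsub>R\<^esub>) = frac S P (h a) \<one>\<^bsub>S\<^esub>" if "primeideal P S" for P
    using frac_map_frac[OF that a, of "\<one>\<^bsub>R\<^esub>"]
      prime_fractions.compl_one[OF R.prime_fractionsI[OF spec_pt_prime[OF that]]] by simp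
  then show ?thesis unfolding spec_pull_def by (intro restrict_ext) simp
qed

text \<open>Locality on stalks comes from the unit criterion: \<open>h a\<close> lies outside
  \<open>P\<close> exactly when \<open>a\<close> lies outside the contraction of
  \<open>P\<close>.\<close>

lemma spec_morphism:
  fixes c :: "'k::field \<Rightarrow> 'a" and d :: "'k \<Rightarrow> 'c"
  assumes c: "\<And>k. c k \<in> carrier R" and cd: "\<And>k. h (c k) = d k"
  shows "kmorphism (spec S d) (spec R c) (spec_pt R h) (spec_pull R S h)"
proof -
  let ?X = "spec S d" and ?Y = "spec R c"
  have pre: "preim ?X (spec_pt R h) V = {P. primeideal P S \<and> spec_pt R h P \<in> V}" for V
    by (auto simp: preim_def S.topspace_zariski)
  have val: "\<exists>a s. f (spec_pt R h P) = frac R (spec_pt R h P) a s \<and> a \<in> carrier R \<and> s \<in> carrier R - spec_pt R h P \<and>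
      spec_pull R S h V f P = frac S P (h a) (h s) \<and> h s \<in> carrier S - P"
    if f: "f \<in> spec_sections R V" and P: "primeideal P S" "spec_pt R h P \<in> V" for V f P
  proof -
    obtain a s where a: "f (spec_pt R h P) = frac R (spec_pt R h P) a s" "a \<in> carrier R" "s \<in> carrier R - spec_pt R h P"
      using section_in_loc[OF f P(2)] by (auto simp: loc_simps)
    moreover have "spec_pull R S h V f P = frac S P (h a) (h s)"
      using frac_map_frac[OF P(1) a(2,3)] P by (simp add: spec_pull_def a(1))
    ultimately show ?thesis by (auto simp: spec_pt_def)
  qed
  note one = spec_pull_frac
  show ?thesis
    unfolding kmorphism_def
  proof (intro conjI allI impI ballI)
    show "continuous_map (space_topology ?X) (space_topology ?Y) (spec_pt R h)"
      unfolding continuous_map_def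
      using zariski_open_vimage spec_pt_prime by (auto simp: S.topspace_zariski R.topspace_zariski)
  next
    fix V assume "kopen ?Y V"
    then have V: "zariski_open R V" by simp
    show "spec_pull R S h V \<in> Ring.ring_hom (sect ?Y V) (sect ?X (preim ?X (spec_pt R h) V))"
    proof (rule ring_hom_memI)
      fix f g assume "f \<in> carrier (sect ?Y V)" and "g \<in> carrier (sect ?Y V)"
      then have fg: "f \<in> spec_sections R V" "g \<in> spec_sections R V" by auto
      have "spec_pull R S h V (\<lambda>P\<in>V. frac_mult R P (f P) (g P)) P =
          frac_mult S P (spec_pull R S h V f P) (spec_pull R S h V g P) \<and>
        spec_pull R S h V (\<lambda>P\<in>V. frac_add R P (f P) (g P)) P =
          frac_add S P (spec_pull R S h V f P) (spec_pull R S h V g P)"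
        if P: "primeideal P S" "spec_pt R h P \<in> V" for P
      proof -
        note pfP = S.prime_fractionsI[OF P(1)]
        note pfQ = R.prime_fractionsI[OF spec_pt_prime[OF P(1)]]
        obtain a s where a: "f (spec_pt R h P) = frac R (spec_pt R h P) a s" "a \<in> carrier R" "s \<in> carrier R - spec_pt R h P"
          "spec_pull R S h V f P = frac S P (h a) (h s)" "h s \<in> carrier S - P" using val[OF fg(1) P] by blast
        obtain b t where b: "g (spec_pt R h P) = frac R (spec_pt R h P) b t" "b \<in> carrier R" "t \<in> carrier R - spec_pt R h P"
          "spec_pull R S h V g P = frac S P (h b) (h t)" "h t \<in> carrier S - P" using val[OF fg(2) P] by blast
        have st: "s \<otimes>\<^bsub>R\<^esub> t \<in> carrier R - spec_pt R h P" using prime_fractions.compl_mult[OF pfQ] a b by blast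
        have m: "spec_pull R S h V (\<lambda>P\<in>V. k P) P = frac_map S h P (k (spec_pt R h P))" for k
          using P by (simp add: spec_pull_def)
        have cl: "s \<in> carrier R" "t \<in> carrier R" using a b by auto
        show ?thesis
          unfolding m a(1,4) b(1,4) prime_fractions.frac_mult_frac[OF pfQ a(2) b(2) a(3) b(3)] prime_fractions.frac_add_frac[OF pfQ a(2) b(2) a(3) b(3)]
            prime_fractions.frac_mult_frac[OF pfP hom_closed[OF a(2)] hom_closed[OF b(2)] a(5) b(5)]
            prime_fractions.frac_add_frac[OF pfP hom_closed[OF a(2)] hom_closed[OF b(2)] a(5) b(5)]
          using frac_map_frac[OF P(1) _ st] a(2) b(2) cl by simp
      qed
      note m = this
      show "spec_pull R S h V (f \<otimes>\<^bsub>sect ?Y V\<^esub> g) =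
          spec_pull R S h V f \<otimes>\<^bsub>sect ?X (preim ?X (spec_pt R h) V)\<^esub> spec_pull R S h V g"
        unfolding spec_simps pre
        by (rule extensionalityI[of _ "{P. primeideal P S \<and> spec_pt R h P \<in> V}"])
          (use m in \<open>simp_all add: spec_pull_def[of _ _ _ _ "restrict _ _"]\<close>)
      show "spec_pull R S h V (f \<oplus>\<^bsub>sect ?Y V\<^esub> g) =
          spec_pull R S h V f \<oplus>\<^bsub>sect ?X (preim ?X (spec_pt R h) V)\<^esub> spec_pull R S h V g"
        unfolding spec_simps pre
        by (rule extensionalityI[of _ "{P. primeideal P S \<and> spec_pt R h P \<in> V}"])
          (use m in \<open>simp_all add: spec_pull_def[of _ _ _ _ "restrict _ _"]\<close>)
      show "spec_pull R S h V f \<in> carrier (sect ?X (preim ?X (spec_pt R h) V))"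
        using spec_pull_section[OF V fg(1)] by (simp add: pre)
    next
      show "spec_pull R S h V \<one>\<^bsub>sect ?Y V\<^esub> = \<one>\<^bsub>sect ?X (preim ?X (spec_pt R h) V)\<^esub>"
        using one[OF R.one_closed] by (simp add: pre)
    qed
    fix k show "spec_pull R S h V (scal ?Y V k) = scal ?X (preim ?X (spec_pt R h) V) k"
      using one[OF c] by (simp add: pre cd)
  next
    fix V W f assume "kopen ?Y V \<and> kopen ?Y W \<and> W \<subseteq> V" "f \<in> carrier (sect ?Y V)"
    then show "rstr ?X (preim ?X (spec_pt R h) V) (preim ?X (spec_pt R h) W) (spec_pull R S h V f) =
        spec_pull R S h W (rstr ?Y V W f)"
      unfolding pre by (auto simp: spec_pull_def restrict_def fun_eq_iff)
  next
    fix P V f assume P: "P \<in> kpts ?X" and V: "kopen ?Y V \<and> spec_pt R h P \<in> V" and f: "f \<in> carrier (sect ?Y V)"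
      and u: "unit_at ?X P (preim ?X (spec_pt R h) V) (spec_pull R S h V f)"
    have V': "zariski_open R V" "spec_pt R h P \<in> V" and f': "f \<in> spec_sections R V" and P': "primeideal P S"
      using V f P by (auto simp: S.topspace_zariski)
    obtain a s where a: "f (spec_pt R h P) = frac R (spec_pt R h P) a s" "a \<in> carrier R" "s \<in> carrier R - spec_pt R h P"
      "spec_pull R S h V f P = frac S P (h a) (h s)" "h s \<in> carrier S - P" using val[OF f' P' V'(2)] by blast
    have "h a \<notin> P"
      using u S.unit_at_spec_iff[OF zariski_open_vimage[OF V'(1)] _ spec_pull_section[OF V'(1) f'] a(4) hom_closed[OF a(2)] a(5), where c = d]
        P' V'(2) by (simp add: pre)
    then show "unit_at ?Y (spec_pt R h P) V f"
      using R.unit_at_spec_iff[OF V' f' a(1,2,3), where c = c] by (simp add: spec_pt_def)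
  qed
qed

end

section \<open>Rational points\<close>

context cring
begin

lemma loc_a_inv:
  assumes "primeideal P R" "a \<in> carrier R" "s \<in> carrier R - P"
  shows "\<ominus>\<^bsub>loc R P\<^esub> (frac R P a s) = frac R P (\<ominus> a) s"
proof -
  interpret prime_fractions P R by (rule prime_fractionsI[OF assms(1)])
  interpret L: cring "loc R P" by (rule loc_cring)
  show ?thesis
  proof (rule L.minus_equality)
    show "frac R P (\<ominus> a) s \<oplus>\<^bsub>loc R P\<^esub> frac R P a s = \<zero>\<^bsub>loc R P\<^esub>"
      using frac_uminus[OF assms(2,3)] by (simp add: loc_simps)
  qed (use assms in \<open>auto simp: loc_simps(1)\<close>)
qed

lemma section_minus:
  assumes U: "zariski_open R U" "P \<in> U" and f: "f \<in> spec_sections R U" and g: "g \<in> spec_sections R U"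
    and fP: "f P = frac R P a s" "a \<in> carrier R" "s \<in> carrier R - P"
    and gP: "g P = frac R P b \<one>" "b \<in> carrier R"
  shows "(f \<ominus>\<^bsub>sect (spec R c) U\<^esub> g) P = frac R P (a \<ominus> b \<otimes> s) s"
proof -
  let ?S = "sect (spec R c) U"
  have P: "primeideal P R" by (rule zariski_open_prime[OF U])
  interpret P: prime_fractions P R by (rule prime_fractionsI[OF P])
  interpret S: cring ?S by (rule cring_sections[OF U(1)])
  let ?n = "\<lambda>P\<in>U. \<ominus>\<^bsub>loc R P\<^esub> (g P)"
  have n: "?n \<in> spec_sections R U" by (rule sections_uminus[OF U(1) g])
  have "?n \<oplus>\<^bsub>?S\<^esub> g = \<zero>\<^bsub>?S\<^esub>"
  proof (rule sections_eqI)
    show "?n \<oplus>\<^bsub>?S\<^esub> g \<in> spec_sections R U" "\<zero>\<^bsub>?S\<^esub> \<in> spec_sections R U"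
      using S.add.m_closed[of ?n g] S.zero_closed n g by (simp_all del: spec_simps(5,6))
    fix Q assume Q: "Q \<in> U"
    interpret L: cring "loc R Q" by (rule loc_cringI[OF zariski_open_prime[OF U(1) Q]])
    show "(?n \<oplus>\<^bsub>?S\<^esub> g) Q = \<zero>\<^bsub>?S\<^esub> Q"
      using L.l_neg[OF section_in_loc[OF g Q]] Q by (simp add: loc_simps)
  qed
  then have "\<ominus>\<^bsub>?S\<^esub> g = ?n" using S.minus_equality[of ?n g] n g by (simp del: spec_simps(5,6))
  then have "(f \<ominus>\<^bsub>?S\<^esub> g) P = frac_add R P (f P) (\<ominus>\<^bsub>loc R P\<^esub> (g P))"
    using U(2) by (simp add: a_minus_def)
  also have "\<dots> = frac_add R P (frac R P a s) (frac R P (\<ominus> b) \<one>)"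
    using loc_a_inv[OF P gP(2) P.compl_one] by (simp add: fP(1) gP(1))
  also have "\<dots> = frac R P (a \<ominus> b \<otimes> s) s"
    using fP gP P.frac_add_frac[OF fP(2) a_inv_closed[OF gP(2)] fP(3) P.compl_one]
    by (simp add: a_minus_def l_minus)
  finally show ?thesis .
qed

text \<open>The definition quantifies over all germs, but values of ring elements suffice: if
  \<open>a\<close> has value \<open>k\<close> and \<open>s\<close> has value \<open>l\<close>, then
  \<open>l\<close> is nonzero because \<open>s\<close> lies outside \<open>P\<close>, and
  \<open>a/s\<close> has value \<open>k/l\<close>.\<close>

lemma kpoints_spec_iff:
  assumes c: "c \<in> Ring.ring_hom (cring_class_ops :: 'k::field ring) R"
  shows "P \<in> kpoints (spec R c) \<longleftrightarrow> primeideal P R \<and> (\<forall>a\<in>carrier R. \<exists>k. a \<ominus> c k \<in> P)"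
proof
  have cl: "c x \<in> carrier R" for x using ring_hom_closed[OF c] by (simp add: carrier_class)
  let ?X = "{P. primeideal P R}"
  {
    assume P: "P \<in> kpoints (spec R c)"
    then have pr: "primeideal P R" by (simp add: kpoints_def)
    interpret P: prime_fractions P R by (rule prime_fractionsI[OF pr])
    have "\<exists>k. a \<ominus> c k \<in> P" if a: "a \<in> carrier R" for a
    proof -
      let ?f = "\<lambda>P\<in>?X. frac R P a \<one>"
      have f: "?f \<in> spec_sections R ?X"
        using one_notin_open[OF zariski_open_primes] a by (intro sections_const[OF zariski_open_primes]) auto
      obtain k where k: "\<not> unit_at (spec R c) P ?X (?f \<ominus>\<^bsub>sect (spec R c) ?X\<^esub> scal (spec R c) ?X k)"
        using P f zariski_open_primes pr unfolding kpoints_def by (auto simp del: spec_simps(3-8))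
      have g: "scal (spec R c) ?X k \<in> spec_sections R ?X"
        using ring_hom_closed[OF frac_scal_hom[OF c zariski_open_primes], of k] by (simp add: carrier_class del: spec_simps(8))
      have "(?f \<ominus>\<^bsub>sect (spec R c) ?X\<^esub> scal (spec R c) ?X k) P = frac R P (a \<ominus> c k \<otimes> \<one>) \<one>"
        by (rule section_minus[OF zariski_open_primes _ f g]) (use pr a cl P.compl_one in auto)
      moreover have "?f \<ominus>\<^bsub>sect (spec R c) ?X\<^esub> scal (spec R c) ?X k \<in> spec_sections R ?X"
        using ring.ring_simprules(4)[OF cring.axioms(1)[OF cring_sections[OF zariski_open_primes]], of ?f _ "scal (spec R c) ?X k"] f g
        by (simp del: spec_simps(3-8))
      ultimately have "a \<ominus> c k \<otimes> \<one> \<in> P"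
        using k unit_at_spec_iff[OF zariski_open_primes, of P] pr a cl P.compl_one by blast
      then show ?thesis using cl by auto
    qed
    with pr show "primeideal P R \<and> (\<forall>a\<in>carrier R. \<exists>k. a \<ominus> c k \<in> P)" by blast
  next
    assume P: "primeideal P R \<and> (\<forall>a\<in>carrier R. \<exists>k. a \<ominus> c k \<in> P)"
    then have pr: "primeideal P R" by blast
    interpret P: prime_fractions P R by (rule prime_fractionsI[OF pr])
    have "\<exists>k. \<not> unit_at (spec R c) P U (f \<ominus>\<^bsub>sect (spec R c) U\<^esub> scal (spec R c) U k)"
      if U: "zariski_open R U" "P \<in> U" and f: "f \<in> spec_sections R U" for U f
    proof -
      obtain a s where a: "f P = frac R P a s" "a \<in> carrier R" "s \<in> carrier R - P"
        using section_in_loc[OF f U(2)] by (auto simp: loc_simps)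
      obtain k l where kl: "a \<ominus> c k \<in> P" "s \<ominus> c l \<in> P" using P a by blast
      have "l \<noteq> 0"
      proof
        assume "l = 0"
        have "c 0 = \<zero>"
          using ring_hom_zero[OF c cring.axioms(1)[OF cring_class] ring_axioms] by (simp add: zero_class)
        then show False using kl(2) a(3) by (simp add: \<open>l = 0\<close> a_minus_def)
      qed
      then have ck: "c k = c (k / l) \<otimes> c l"
        using ring_hom_mult[OF c, of "k / l" l] by (simp add: carrier_class times_class)
      have g: "scal (spec R c) U (k / l) \<in> spec_sections R U"
        using ring_hom_closed[OF frac_scal_hom[OF c U(1)], of "k / l"] by (simp add: carrier_class del: spec_simps(8))
      have "(f \<ominus>\<^bsub>sect (spec R c) U\<^esub> scal (spec R c) U (k / l)) P = frac R P (a \<ominus> c (k / l) \<otimes> s) s"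
        by (rule section_minus[OF U f g a]) (use U cl in auto)
      moreover have "f \<ominus>\<^bsub>sect (spec R c) U\<^esub> scal (spec R c) U (k / l) \<in> spec_sections R U"
        using ring.ring_simprules(4)[OF cring.axioms(1)[OF cring_sections[OF U(1)]], of f _ "scal (spec R c) U (k / l)"] f g
        by (simp del: spec_simps(3-8))
      moreover have "a \<ominus> c (k / l) \<otimes> s \<in> P"
      proof -
        \<comment> \<open>Since \<open>k = (k/l) * l\<close>, the difference is a combination of
          \<open>a - k\<close> and \<open>s - l\<close>, both in \<open>P\<close>.\<close>
        have "a \<ominus> c (k / l) \<otimes> s = (a \<ominus> c k) \<oplus> (\<ominus> c (k / l)) \<otimes> (s \<ominus> c l)"
        proof -
          have sR: "s \<in> carrier R" using a by blast
          have "(a \<ominus> c k) \<oplus> (\<ominus> c (k / l)) \<otimes> (s \<ominus> c l)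
            = a \<oplus> (\<ominus> (c (k / l) \<otimes> c l) \<oplus> (\<ominus> (c (k / l) \<otimes> s) \<oplus> c (k / l) \<otimes> c l))"
            using cl a(2) sR by (simp add: ck a_minus_def r_distr l_minus r_minus a_assoc)
          also have "\<dots> = a \<oplus> (\<ominus> (c (k / l) \<otimes> s))"
            using cl a(2) sR by (simp add: a_lcomm[of "\<ominus> (c (k / l) \<otimes> c l)"] l_neg)
          finally show ?thesis by (simp add: a_minus_def)
        qed
        moreover have "(\<ominus> c (k / l)) \<otimes> (s \<ominus> c l) \<in> P" using kl(2) cl by (intro P.I_l_closed) auto
        ultimately show ?thesis using kl(1) P.a_closed by simp
      qed
      ultimately show ?thesis
        using unit_at_spec_iff[OF U, of "f \<ominus>\<^bsub>sect (spec R c) U\<^esub> scal (spec R c) U (k / l)"] a cl by blast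
    qed
    with pr show "P \<in> kpoints (spec R c)"
      unfolding kpoints_def by (simp del: spec_simps(3-8))
  }
qed

end

section \<open>A Nullstellensatz for towers of separable equations\<close>

text \<open>Linear factors are split off one at a time: a root of \<open>f\<close> is also a root of
  \<open>q\<close>, and cancelling it lowers both orders by one.\<close>

lemma dvd_of_order_le:
  fixes f q :: "'a::alg_closed_field poly"
  assumes "f \<noteq> 0" "q \<noteq> 0" "\<And>s. order s f \<le> order s q"
  shows "f dvd q"
  using assms
proof (induct "degree f" arbitrary: f q)
  case 0
  then obtain a where "f = [:a:]" "a \<noteq> 0" by (metis degree_eq_zeroE pCons_0_0)
  then show ?case by (simp add: const_poly_dvd_iff dvd_field_iff)
next
  case (Suc n)
  then obtain s where s: "poly f s = 0" using alg_closed_imp_poly_has_root[of f] by auto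
  then obtain f1 where f1: "f = [:-s, 1:] * f1" by (metis dvdE poly_eq_0_iff_dvd)
  have "order s f \<noteq> 0" using s Suc(3) by (simp add: order_root)
  then have "order s q \<noteq> 0" using Suc(5)[of s] by simp
  then have "poly q s = 0" using order_root[of q s] by simp
  then obtain q1 where q1: "q = [:-s, 1:] * q1" by (metis dvdE poly_eq_0_iff_dvd)
  have nz: "f1 \<noteq> 0" "q1 \<noteq> 0" using f1 q1 Suc(3,4) by auto
  have "order t f1 \<le> order t q1" for t
    using Suc(5)[of t] order_mult[of "[:-s, 1:]" f1 t] order_mult[of "[:-s, 1:]" q1 t] Suc(3,4)
    by (simp add: f1 q1)
  moreover have "degree f = Suc (degree f1)"
    using nz unfolding f1 by (subst degree_mult_eq) auto
  ultimately have "f1 dvd q1" using Suc(1)[of f1 q1] Suc(2) nz by simp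
  then show ?case unfolding f1 q1 by (rule mult_dvd_mono[OF dvd_refl])
qed

lemma order_power:
  fixes p :: "'a::idom poly"
  shows "p \<noteq> 0 \<Longrightarrow> order s (p ^ n) = n * order s p"
  by (induct n) (simp_all add: order_mult)

text \<open>Compare orders at each root \<open>s\<close> of \<open>f\<close>. A multiple root is a
  root of \<open>f'\<close>, whose power contributes at least \<open>degree f\<close>; at a simple
  root \<open>f\<close> has order 1 and \<open>p\<close> vanishes.\<close>

lemma dvd_mult_pderiv_power:
  fixes f p :: "'a::alg_closed_field poly"
  assumes f: "f \<noteq> 0" and roots: "\<And>s. poly f s = 0 \<Longrightarrow> poly (pderiv f) s \<noteq> 0 \<Longrightarrow> poly p s = 0"
  shows "f dvd p * pderiv f ^ degree f"
proof (cases "p * pderiv f ^ degree f = 0")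
  case False
  show ?thesis
  proof (rule dvd_of_order_le[OF f False])
    fix s
    have ord: "order s (p * pderiv f ^ degree f) = order s p + degree f * order s (pderiv f)"
      if "pderiv f \<noteq> 0"
      using False that by (simp add: order_mult order_power)
    show "order s f \<le> order s (p * pderiv f ^ degree f)"
    proof (cases "poly f s = 0")
      case True
      then have deg: "degree f > 0" using f by (metis degree_0 degree_eq_zeroE gr0I poly_const_conv poly_0)
      then have pd: "pderiv f \<noteq> 0" "p \<noteq> 0" using False by auto
      show ?thesis
      proof (cases "poly (pderiv f) s = 0")
        case True
        then have "order s (pderiv f) \<ge> 1" using pd by (simp add: order_root)
        then have "degree f * 1 \<le> degree f * order s (pderiv f)" by (intro mult_left_mono) auto
        with order_degree[OF f, of s] show ?thesis unfolding ord[OF pd(1)] by linarith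
      next
        case False
        \<comment> \<open>A factor \<open>(X - s)^2\<close> of \<open>f\<close> would survive once
          in \<open>f'\<close>, which does not vanish at \<open>s\<close>.\<close>
        have "order s f \<le> 1"
        proof (rule ccontr)
          assume "\<not> order s f \<le> 1"
          then have "[:-s, 1:] ^ 2 dvd f" using order_divides[of s 2 f] by simp
          then obtain g where "f = [:-s, 1:] ^ 2 * g" by (rule dvdE)
          then have g: "f = [:-s, 1:] * ([:-s, 1:] * g)" by (simp only: power2_eq_square mult.assoc)
          define l where "l = [:-s, 1:]"
          have "poly l s = 0" by (simp add: l_def)
          then have "poly (pderiv f) s = 0"
            unfolding g l_def[symmetric] by (simp add: pderiv_mult)
          with False show False by simp
        qed
        moreover have "order s p \<ge> 1" using roots[OF \<open>poly f s = 0\<close> False] pd by (simp add: order_root Suc_le_eq)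
        ultimately show ?thesis unfolding ord[OF pd(1)] by linarith
      qed
    next
      case False
      then show ?thesis by (simp add: order_0I)
    qed
  qed
next
  case True
  then show ?thesis by (simp only: dvd_0_right)
qed

text \<open>The ideal generated by \<open>G\<close>. The inductive form makes inclusions of ideals
  provable by adding one generator at a time.\<close>

inductive_set idl :: "'a::comm_ring_1 set \<Rightarrow> 'a set" for G :: "'a set" where
  idl_0: "0 \<in> idl G"
| idl_add_mult: "x \<in> idl G \<Longrightarrow> b \<in> G \<Longrightarrow> x + g * b \<in> idl G"

lemma idl_gen: "b \<in> G \<Longrightarrow> g * b \<in> idl G"
  using idl_add_mult[OF idl_0, of b G g] by simp

lemma idl_add: "y \<in> idl G \<Longrightarrow> x \<in> idl G \<Longrightarrow> x + y \<in> idl G"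
  by (induct rule: idl.induct) (auto simp: add.assoc[symmetric] intro: idl_add_mult)

lemma idl_mult: "x \<in> idl G \<Longrightarrow> g * x \<in> idl G"
  by (induct rule: idl.induct) (auto simp: distrib_left mult.assoc[symmetric] intro: idl_0 idl_add_mult)

lemma idl_sum: "(\<And>i. i \<in> A \<Longrightarrow> f i \<in> idl G) \<Longrightarrow> sum f A \<in> idl G"
  by (induct A rule: infinite_finite_induct) (auto intro: idl_0 idl_add)

lemma idl_mono: "x \<in> idl G \<Longrightarrow> G \<subseteq> H \<Longrightarrow> x \<in> idl H"
  by (induct rule: idl.induct) (auto intro: idl_0 idl_add_mult)

abbreviation acv :: "(nat \<Rightarrow> 'k::field alg_closure) \<Rightarrow> 'k mp \<Rightarrow> 'k alg_closure" where
  "acv e \<equiv> mval to_ac e"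

lemma to_ac_hom: "comm_ring_hom (to_ac :: 'k::field \<Rightarrow> _)"
  by (rule comm_ring_homI) simp_all

lemmas acv_simps = mval_simps[OF to_ac_hom]

text \<open>The base is known through its points only, so its ideal enters as the set of all
  polynomials vanishing on them, without a choice of generators.\<close>

definition tower_gens :: "nat \<Rightarrow> (nat \<Rightarrow> 'k::field alg_closure) set \<Rightarrow> 'k mp poly list \<Rightarrow> nat \<Rightarrow> 'k mp set" where
  "tower_gens m Z fs r = {c \<in> below m. \<forall>z\<in>Z. acv z c = 0} \<union> (\<lambda>i. emb (m + i) (fs ! i)) ` {..<r}"

definition tower_sol :: "nat \<Rightarrow> (nat \<Rightarrow> 'k::field alg_closure) set \<Rightarrow> 'k mp poly list \<Rightarrow> nat \<Rightarrow>
    (nat \<Rightarrow> 'k alg_closure) \<Rightarrow> bool" where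
  "tower_sol m Z fs r e \<longleftrightarrow> trunc m e \<in> Z \<and> (\<forall>i<r. simple_root to_ac (m + i) (fs ! i) e)"

text \<open>At a solution of the first \<open>r\<close> equations this is nonzero exactly when every
  coordinate is a simple root in the sense of \<open>simple_root\<close>. Derivatives and leading
  coefficients are collected in one element so that a single inversion suffices.\<close>

definition tower_unit :: "nat \<Rightarrow> 'k::field mp poly list \<Rightarrow> nat \<Rightarrow> 'k mp" where
  "tower_unit m fs r = (\<Prod>i<r. ret (m + i) (lead_coeff (fs ! i)) * emb (m + i) (pderiv (fs ! i)))"

lemma trunc_upd: "n \<le> k \<Longrightarrow> trunc n (e(k := s)) = trunc n e"
  by (auto simp: trunc_def fun_eq_iff)

lemma tower_sol_upd:
  assumes "m + r \<le> k"
  shows "tower_sol m Z fs r (e(k := s)) \<longleftrightarrow> tower_sol m Z fs r e"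
proof -
  have "simple_root to_ac (m + i) (fs ! i) (e(k := s)) \<longleftrightarrow> simple_root to_ac (m + i) (fs ! i) e" if "i < r" for i
    using that assms by (simp add: simple_root_def trunc_upd)
  then show ?thesis using assms by (simp add: tower_sol_def trunc_upd)
qed

text \<open>If \<open>p\<close> vanishes at the simple roots of \<open>f\<close>, then \<open>f\<close> divides \<open>p f'\<^sup>d\<close> with \<open>d = deg f\<close>, so the
  coefficients of the pseudo-remainder vanish on the tower below.\<close>

theorem tower_nullstellensatz:
  fixes fs :: "'k::field mp poly list"
  assumes Z: "\<And>z. z \<in> Z \<Longrightarrow> trunc m z = z"
    and "P \<in> below (m + r)" "\<And>e. tower_sol m Z fs r e \<Longrightarrow> acv e P = 0"
  shows "\<exists>N. tower_unit m fs r ^ N * P \<in> idl (tower_gens m Z fs r)"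
  using assms(2,3)
proof (induct r arbitrary: P)
  case 0
  have "acv z P = 0" if "z \<in> Z" for z
    using 0(2)[of z] that Z by (simp add: tower_sol_def)
  with 0(1) have "P \<in> tower_gens m Z fs 0" by (simp add: tower_gens_def)
  then show ?case using idl_gen[of P _ 1] by (auto simp: tower_unit_def)
next
  case (Suc r)
  define k where "k = m + r"
  define f where "f = map_poly (ret k) (fs ! r)"
  define c where "c = ret k (lead_coeff (fs ! r))"
  have cf: "coeff f j \<in> below k" for j by (simp add: f_def coeff_map_poly ret_simps)
  have F: "emb k (fs ! r) = poly f (mvar k)" and D: "emb k (pderiv (fs ! r)) = poly (pderiv f) (mvar k)"
    by (simp_all add: emb_def f_def map_poly_simps[OF ret_hom])
  have unit: "tower_unit m fs (Suc r) = tower_unit m fs r * (c * poly (pderiv f) (mvar k))"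
    unfolding tower_unit_def prod.lessThan_Suc k_def[symmetric] D c_def ..
  show ?case
  proof (cases "c = 0")
    case True
    then have "tower_unit m fs (Suc r) ^ 1 * P = 0" by (simp add: unit)
    then show ?thesis by (metis idl_0)
  next
    case False
    have degf: "degree f = degree (fs ! r)"
      unfolding f_def using False by (intro map_poly_degree_eq) (simp add: c_def)
    have lc: "lead_coeff f = c" by (simp add: degf) (simp add: f_def c_def coeff_map_poly ret_simps)
    have f0: "f \<noteq> 0" using False lc by auto
    define d where "d = degree f"
    obtain p where p: "P = poly p (mvar k)" "\<And>j. coeff p j \<in> below k"
      using below_Suc_poly[of P k] Suc(2) by (auto simp: k_def)
    define n where "n = Suc (degree (p * pderiv f ^ d)) - degree f"
    obtain q0 r0 where qr: "pseudo_divmod (p * pderiv f ^ d) f = (q0, r0)" by (cases "pseudo_divmod (p * pderiv f ^ d) f")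
    have dm: "smult (c ^ n) (p * pderiv f ^ d) = f * q0 + r0" "r0 = 0 \<or> degree r0 < degree f"
      using pseudo_divmod[OF f0 qr] by (simp_all add: lc n_def)
    \<comment> \<open>The pseudo-division makes no promise about the variables occurring in quotient
      and remainder. Retracting to the first \<open>k\<close> variables preserves the identity,
      because \<open>p\<close>, \<open>f\<close> and \<open>c\<close> are fixed by it.\<close>
    define q1 r1 where "q1 = map_poly (ret k) q0" and "r1 = map_poly (ret k) r0"
    have retp: "map_poly (ret k) g = g" if "\<And>j. coeff g j \<in> below k" for g :: "'k mp poly"
      by (rule poly_eqI) (simp add: coeff_map_poly ret_simps ret_id that)
    have c_ret: "ret k c = c" by (simp add: c_def)
    have dm1: "smult (c ^ n) (p * pderiv f ^ d) = f * q1 + r1"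
      using arg_cong[OF dm(1), of "map_poly (ret k)"]
      by (simp add: map_poly_simps[OF ret_hom] retp[OF p(2)] retp[OF cf] ret_simps c_ret q1_def r1_def)
    have deg1: "r1 = 0 \<or> degree r1 < degree f"
      using dm(2) map_poly_degree_leq[of "ret k" r0] by (auto simp: r1_def)
    \<comment> \<open>The factor \<open>c\<close> takes care of the points where the leading
      coefficient vanishes and the specialized division says nothing.\<close>
    have zero: "acv e (c * coeff r1 j) = 0" if e: "tower_sol m Z fs r e" for e j
    proof (cases "acv e c = 0")
      case True
      then show ?thesis by (simp add: acv_simps)
    next
      case c0: False
      note mp = map_poly_simps[OF mval_hom[OF to_ac_hom], of e]
      let ?b = "map_poly (acv e)"
      have "degree (?b f) = degree f" using c0 lc by (intro map_poly_degree_eq) simp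
      then have bf0: "?b f \<noteq> 0" using c0 lc mp(9)[of f "degree f"] by auto
      have tr: "map_poly (acv (trunc k e)) g = ?b g" if "\<And>j. coeff g j \<in> below k" for g
        by (rule poly_eqI) (simp add: coeff_map_poly acv_simps mval_trunc_below[OF to_ac_hom that])
      have trf: "map_poly (acv (trunc k e)) (fs ! r) = ?b f"
        unfolding f_def by (subst map_poly_comp) (simp_all add: ret_simps acv_simps mval_ret[OF to_ac_hom])
      have pe: "poly (?b p) s = 0" if s: "poly (?b f) s = 0" "poly (pderiv (?b f)) s \<noteq> 0" for s
      proof -
        let ?e = "e(k := s)"
        \<comment> \<open>A simple root of the specialized \<open>f\<close> extends the solution by
          one coordinate, and at the extended solution \<open>P\<close> vanishes by
          assumption.\<close>
        have "simple_root to_ac k (fs ! r) ?e"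
          using s c0 by (simp add: simple_root_def Let_def trunc_upd trf) (simp add: c_def mval_ret[OF to_ac_hom])
        moreover have "tower_sol m Z fs r ?e" using e by (simp add: tower_sol_upd k_def)
        ultimately have "tower_sol m Z fs (Suc r) ?e" by (auto simp: tower_sol_def k_def less_Suc_eq)
        then have "acv ?e P = 0" by (rule Suc(3))
        moreover have "P = emb k p" by (simp add: emb_def p(1) retp[OF p(2)])
        ultimately show ?thesis by (simp add: mval_emb[OF to_ac_hom] trunc_upd tr[OF p(2)])
      qed
      have "?b f dvd ?b p * pderiv (?b f) ^ degree (?b f)"
        by (rule dvd_mult_pderiv_power[OF bf0 pe])
      then have "?b f dvd ?b (smult (c ^ n) (p * pderiv f ^ d))"
        by (simp add: mp \<open>degree (?b f) = degree f\<close> d_def dvd_smult)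
      then have "?b f dvd ?b r1" unfolding dm1 by (simp add: mp dvd_add_right_iff)
      moreover have "?b r1 = 0 \<or> degree (?b r1) < degree (?b f)"
        using deg1 map_poly_degree_leq[of "acv e" r1] \<open>degree (?b f) = degree f\<close> by auto
      ultimately have "?b r1 = 0" using dvd_imp_degree_le[of "?b f" "?b r1"] by linarith
      then have "acv e (coeff r1 j) = 0" by (metis mp(9) coeff_0)
      then show ?thesis by (simp add: acv_simps)
    qed
    have "c * coeff r1 j \<in> below (m + r)" for j
      by (intro below_mult) (simp_all add: c_def r1_def coeff_map_poly ret_simps flip: k_def)
    with Suc(1)[of "c * coeff r1 _"] zero
    have "\<forall>j. \<exists>N. tower_unit m fs r ^ N * (c * coeff r1 j) \<in> idl (tower_gens m Z fs r)" by blast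
    then obtain N where N: "\<And>j. tower_unit m fs r ^ N j * (c * coeff r1 j) \<in> idl (tower_gens m Z fs r)" by metis
    \<comment> \<open>The induction hypothesis gives one exponent per coefficient of the remainder;
      finitely many are dominated by their maximum.\<close>
    define M where "M = Max (N ` {..degree r1})"
    let ?G = "tower_gens m Z fs (Suc r)" and ?u = "tower_unit m fs r" and ?D = "poly (pderiv f) (mvar k)"
    have sub: "tower_gens m Z fs r \<subseteq> ?G" by (auto simp: tower_gens_def)
    have low: "?u ^ M * (c * coeff r1 j) \<in> idl ?G" if "j \<le> degree r1" for j
    proof -
      have "N j \<le> M" unfolding M_def using that by (intro Max_ge) auto
      then have "?u ^ M = ?u ^ (M - N j) * ?u ^ N j" by (simp flip: power_add)
      then have eq: "?u ^ M * (c * coeff r1 j) = ?u ^ (M - N j) * (?u ^ N j * (c * coeff r1 j))"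
        by (simp only: mult.assoc)
      show ?thesis unfolding eq by (rule idl_mult[OF idl_mono[OF N sub]])
    qed
    have "?u ^ M * c * poly r1 (mvar k) = (\<Sum>j\<le>degree r1. mvar k ^ j * (?u ^ M * (c * coeff r1 j)))"
      by (simp add: poly_altdef sum_distrib_left mult_ac)
    then have 1: "?u ^ M * c * poly r1 (mvar k) \<in> idl ?G"
      using idl_sum[of "{..degree r1}", OF idl_mult[OF low]] by simp
    have "emb (m + r) (fs ! r) \<in> ?G" by (auto simp: tower_gens_def intro: imageI)
    then have "poly f (mvar k) \<in> ?G" using F by (simp add: k_def)
    then have 2: "(?u ^ M * c * poly q1 (mvar k)) * poly f (mvar k) \<in> idl ?G" by (rule idl_gen)
    have "c ^ n * (P * ?D ^ d) = poly f (mvar k) * poly q1 (mvar k) + poly r1 (mvar k)"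
      using arg_cong[OF dm1, of "\<lambda>g. poly g (mvar k)"] by (simp add: p(1) poly_power)
    then have "?u ^ M * c * (c ^ n * (P * ?D ^ d)) =
      (?u ^ M * c * poly q1 (mvar k)) * poly f (mvar k) + ?u ^ M * c * poly r1 (mvar k)"
      by (simp add: algebra_simps)
    then have 3: "?u ^ M * c * (c ^ n * (P * ?D ^ d)) \<in> idl ?G" using idl_add[OF 1 2] by simp
    \<comment> \<open>Large enough to contain \<open>M\<close> factors of the lower unit,
      \<open>n + 1\<close> leading coefficients and \<open>d\<close> derivatives.\<close>
    let ?L = "M + Suc n + d"
    have "tower_unit m fs (Suc r) ^ ?L * P = (?u ^ (Suc n + d) * c ^ (M + d) * ?D ^ (M + Suc n)) * (?u ^ M * c * (c ^ n * (P * ?D ^ d)))"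
      unfolding unit by (simp add: power_mult_distrib power_add algebra_simps)
    then show ?thesis using idl_mult[OF 3] by metis
  qed
qed

section \<open>Images of polynomial rings\<close>

text \<open>The bridge between the two views of a ring: \<open>h\<close> goes from a commutative
  ring type, where computation is automatic, into the carrier of a ring record.\<close>

locale class_hom = cring S for S (structure) +
  fixes h :: "'r::comm_ring_1 \<Rightarrow> 'a"
  assumes h_closed [simp]: "h x \<in> carrier S"
    and h_one: "h 1 = \<one>" and h_add: "h (x + y) = h x \<oplus> h y" and h_mult: "h (x * y) = h x \<otimes> h y"
begin

lemma h_zero: "h 0 = \<zero>"
proof -
  have "h 0 \<oplus> h 0 = h 0" using h_add[of 0 0] by simp
  then show ?thesis by (simp add: add.l_cancel_one)
qed

lemma h_uminus: "h (- x) = \<ominus> h x"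
proof -
  have "h (- x) \<oplus> h x = \<zero>" using h_add[of "- x" x] by (simp add: h_zero)
  then show ?thesis using minus_equality[of "h (- x)" "h x"] by simp
qed

lemma h_minus: "h (x - y) = h x \<ominus> h y"
  using h_add[of x "- y"] by (simp add: h_uminus a_minus_def)

lemma h_power: "h (x ^ n) = h x [^] n"
  by (induct n) (simp_all add: h_one h_mult m_comm)

lemma h_sum: "h (sum f A) = (\<Oplus>i\<in>A. h (f i))"
proof (cases "finite A")
  case True
  then show ?thesis by (induct A rule: finite_induct) (simp_all add: h_zero h_add)
qed (simp add: h_zero finsum_infinite)

lemma h_prod: "finite A \<Longrightarrow> h (prod f A) = (\<Otimes>i\<in>A. h (f i))"
  by (induct A rule: finite_induct) (simp_all add: h_one h_mult)

lemma h_of_nat: "h (of_nat n * x) = add_pow S n (h x)"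
proof (induct n)
  case (Suc n)
  then show ?case by (simp add: distrib_right h_add add.nat_pow_Suc a_comm)
qed (simp add: h_zero)

end

text \<open>Ring laws pass to surjective images. This yields them for \<open>mpoly_ring\<close> over
  a record without manipulating its convolution sums for each axiom.\<close>

lemma cring_image:
  fixes h :: "'r::comm_ring_1 \<Rightarrow> 'a" and S (structure)
  assumes surj: "range h = carrier S" and zero: "h 0 = \<zero>" and one: "h 1 = \<one>"
    and add: "\<And>x y. h (x + y) = h x \<oplus> h y" and mult: "\<And>x y. h (x * y) = h x \<otimes> h y"
  shows "cring S"
proof (rule cringI)
  have ex: "\<exists>r. x = h r" if "x \<in> carrier S" for x using that surj by auto
  have cl: "h r \<in> carrier S" for r using surj by auto
  show "abelian_group S"
  proof (rule abelian_groupI)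
    fix x y z assume "x \<in> carrier S" "y \<in> carrier S"
    then obtain a b where [simp]: "x = h a" "y = h b" using ex by metis
    show "x \<oplus> y \<in> carrier S" "x \<oplus> y = y \<oplus> x" using cl by (simp_all add: add_ac flip: add)
    assume "z \<in> carrier S"
    then obtain c where [simp]: "z = h c" using ex by metis
    show "x \<oplus> y \<oplus> z = x \<oplus> (y \<oplus> z)" by (simp add: add_ac flip: add)
  next
    fix x assume "x \<in> carrier S"
    then obtain a where [simp]: "x = h a" using ex by metis
    show "\<zero> \<oplus> x = x" by (simp flip: add zero)
    show "\<exists>y\<in>carrier S. y \<oplus> x = \<zero>"
      by (rule bexI[of _ "h (- a)"]) (simp_all add: cl flip: add zero)
  qed (use cl zero in metis)
  show "Group.comm_monoid S"
  proof (rule comm_monoidI)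
    fix x y z assume "x \<in> carrier S" "y \<in> carrier S"
    then obtain a b where [simp]: "x = h a" "y = h b" using ex by metis
    show "x \<otimes> y \<in> carrier S" "x \<otimes> y = y \<otimes> x" using cl by (simp_all add: mult_ac flip: mult)
    assume "z \<in> carrier S"
    then obtain c where [simp]: "z = h c" using ex by metis
    show "x \<otimes> y \<otimes> z = x \<otimes> (y \<otimes> z)" by (simp add: mult_ac flip: mult)
  next
    fix x assume "x \<in> carrier S"
    then obtain a where [simp]: "x = h a" using ex by metis
    show "\<one> \<otimes> x = x" by (simp flip: mult one)
  qed (use cl one in metis)
  fix x y z assume "x \<in> carrier S" "y \<in> carrier S" "z \<in> carrier S"
  then obtain a b c where [simp]: "x = h a" "y = h b" "z = h c" using ex by metis
  show "(x \<oplus> y) \<otimes> z = x \<otimes> z \<oplus> y \<otimes> z" by (simp add: distrib_right flip: mult add)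
qed

text \<open>Needed for the convolution in \<open>mpoly_ring\<close> to be a finite sum: a summand is
  determined by its exponents on the variables of \<open>\<gamma>\<close>, and those are bounded by
  the ones of \<open>\<gamma>\<close>.\<close>

lemma finite_monom_summands: "finite {\<alpha>. \<exists>\<beta>. \<alpha> + \<beta> = (\<gamma> :: monom)}" (is "finite ?D")
proof -
  let ?r = "\<lambda>\<alpha>. restrict (Poly_Mapping.lookup \<alpha>) (Poly_Mapping.keys \<gamma>)"
  have le: "Poly_Mapping.lookup \<alpha> i \<le> Poly_Mapping.lookup \<gamma> i" if "\<alpha> \<in> ?D" for \<alpha> i
    using that by (auto simp: lookup_add)
  have "inj_on ?r ?D"
  proof (rule inj_onI)
    fix \<alpha> \<beta> assume ab: "\<alpha> \<in> ?D" "\<beta> \<in> ?D" "?r \<alpha> = ?r \<beta>"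
    show "\<alpha> = \<beta>"
    proof (rule poly_mapping_eqI)
      fix i
      show "Poly_Mapping.lookup \<alpha> i = Poly_Mapping.lookup \<beta> i"
      proof (cases "i \<in> Poly_Mapping.keys \<gamma>")
        case True
        then show ?thesis using fun_cong[OF ab(3), of i] by simp
      next
        case False
        then show ?thesis using le[OF ab(1), of i] le[OF ab(2), of i] by (simp add: in_keys_iff)
      qed
    qed
  qed
  moreover have "?r ` ?D \<subseteq> PiE (Poly_Mapping.keys \<gamma>) (\<lambda>i. {..Poly_Mapping.lookup \<gamma> i})"
    using le by auto
  moreover have "finite (PiE (Poly_Mapping.keys \<gamma>) (\<lambda>i. {..Poly_Mapping.lookup \<gamma> i}))"
    by (intro finite_PiE) auto
  ultimately show ?thesis using finite_subset finite_imageD by blast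
qed

lemma lookup_mult_monom:
  fixes p q :: "'r::comm_ring_1 mp"
  shows "Poly_Mapping.lookup (p * q) \<gamma> =
    (\<Sum>\<alpha>\<in>{\<alpha>. \<exists>\<beta>. \<alpha> + \<beta> = \<gamma>}. Poly_Mapping.lookup p \<alpha> * Poly_Mapping.lookup q (\<gamma> - \<alpha>))"
proof (induct p rule: mp_induct_single)
  case (single a c)
  show ?case
  proof (induct q rule: mp_induct_single)
    case (single b d)
    have "(\<Sum>\<alpha>\<in>{\<alpha>. \<exists>\<beta>. \<alpha> + \<beta> = \<gamma>}. Poly_Mapping.lookup (Poly_Mapping.single a c) \<alpha> *
        Poly_Mapping.lookup (Poly_Mapping.single b d) (\<gamma> - \<alpha>)) =
      (\<Sum>\<alpha>\<in>{\<alpha>. \<exists>\<beta>. \<alpha> + \<beta> = \<gamma>}. if \<alpha> = a then (if b = \<gamma> - a then c * d else 0) else 0)"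
      by (rule sum.cong) (auto simp: lookup_single when_def)
    also have "\<dots> = (if \<exists>\<beta>. a + \<beta> = \<gamma> then (if b = \<gamma> - a then c * d else 0) else 0)"
      by (simp add: sum.delta finite_monom_summands)
    also have "\<dots> = Poly_Mapping.lookup (Poly_Mapping.single a c * Poly_Mapping.single b d) \<gamma>"
      by (auto simp: mult_single lookup_single when_def)
    finally show ?case ..
  qed (simp_all add: distrib_left lookup_add sum.distrib)
qed (simp_all add: distrib_right lookup_add sum.distrib)

text \<open>Monomials involving variables from \<open>n\<close> on are discarded, which makes the
  map total. It stays multiplicative because a product of monomials avoids these variables exactly
  if both factors do.\<close>

definition mpoly_map :: "('a, 'b) ring_scheme \<Rightarrow> ('r::zero \<Rightarrow> 'a) \<Rightarrow> nat \<Rightarrow> 'r mp \<Rightarrow> monom \<Rightarrow> 'a" where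
  "mpoly_map S h n p = (\<lambda>\<beta>. if Poly_Mapping.keys \<beta> \<subseteq> {..<n} then h (Poly_Mapping.lookup p \<beta>) else \<zero>\<^bsub>S\<^esub>)"

lemma keys_add_nat: "Poly_Mapping.keys (\<alpha> + \<beta>) = Poly_Mapping.keys \<alpha> \<union> Poly_Mapping.keys (\<beta> :: monom)"
  by (auto simp: in_keys_iff lookup_add)

context class_hom
begin

lemma mpoly_map_closed: "mpoly_map S h n p \<in> carrier (mpoly_ring S n)"
proof -
  have "{\<alpha>. mpoly_map S h n p \<alpha> \<noteq> \<zero>} \<subseteq> Poly_Mapping.keys p"
    by (auto simp: mpoly_map_def in_keys_iff h_zero)
  then have "finite {\<alpha>. mpoly_map S h n p \<alpha> \<noteq> \<zero>}" by (rule finite_subset) simp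
  then show ?thesis by (auto simp: mpoly_ring_def) (auto simp: mpoly_map_def split: if_splits)
qed

lemma mpoly_map_surj:
  assumes surj: "range h = carrier S" and p: "p \<in> carrier (mpoly_ring S n)"
  obtains q where "p = mpoly_map S h n q"
proof -
  have p': "\<And>\<alpha>. p \<alpha> \<in> carrier S" "finite {\<alpha>. p \<alpha> \<noteq> \<zero>}" "\<And>\<alpha>. p \<alpha> \<noteq> \<zero> \<Longrightarrow> Poly_Mapping.keys \<alpha> \<subseteq> {..<n}"
    using p by (auto simp: mpoly_ring_def)
  have "\<exists>r. p \<alpha> = h r" for \<alpha> using p'(1)[of \<alpha>] surj by auto
  then obtain l where l: "\<And>\<alpha>. p \<alpha> = h (l \<alpha>)" by metis
  define g where "g = (\<lambda>\<alpha>. if p \<alpha> = \<zero> then 0 else l \<alpha>)"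
  have "finite {\<alpha>. g \<alpha> \<noteq> 0}" by (rule finite_subset[OF _ p'(2)]) (auto simp: g_def)
  then have lk: "Poly_Mapping.lookup (Abs_poly_mapping g) = g" by simp
  have "p = mpoly_map S h n (Abs_poly_mapping g)"
    unfolding mpoly_map_def lk using p'(3) l by (auto simp: g_def h_zero fun_eq_iff)
  then show thesis by (rule that)
qed

lemma mpoly_map_ops:
  "mpoly_map S h n (p + q) = mpoly_map S h n p \<oplus>\<^bsub>mpoly_ring S n\<^esub> mpoly_map S h n q"
  "mpoly_map S h n (p * q) = mpoly_map S h n p \<otimes>\<^bsub>mpoly_ring S n\<^esub> mpoly_map S h n q"
  "mpoly_map S h n 0 = \<zero>\<^bsub>mpoly_ring S n\<^esub>" "mpoly_map S h n 1 = \<one>\<^bsub>mpoly_ring S n\<^esub>"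
proof -
  show "mpoly_map S h n (p + q) = mpoly_map S h n p \<oplus>\<^bsub>mpoly_ring S n\<^esub> mpoly_map S h n q"
    by (auto simp: mpoly_map_def mpoly_ring_def lookup_add h_add)
  show "mpoly_map S h n 0 = \<zero>\<^bsub>mpoly_ring S n\<^esub>"
    by (auto simp: mpoly_map_def mpoly_ring_def h_zero)
  show "mpoly_map S h n 1 = \<one>\<^bsub>mpoly_ring S n\<^esub>"
    by (auto simp: mpoly_map_def mpoly_ring_def lookup_one when_def h_zero h_one fun_eq_iff)
  show "mpoly_map S h n (p * q) = mpoly_map S h n p \<otimes>\<^bsub>mpoly_ring S n\<^esub> mpoly_map S h n q"
  proof
    fix \<gamma> :: monom
    let ?D = "{\<alpha>. \<exists>\<beta>. \<alpha> + \<beta> = \<gamma>}"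
    have "(\<Oplus>\<alpha>\<in>?D. mpoly_map S h n p \<alpha> \<otimes> mpoly_map S h n q (\<gamma> - \<alpha>)) = mpoly_map S h n (p * q) \<gamma>"
    proof (cases "Poly_Mapping.keys \<gamma> \<subseteq> {..<n}")
      case True
      have "(\<Oplus>\<alpha>\<in>?D. mpoly_map S h n p \<alpha> \<otimes> mpoly_map S h n q (\<gamma> - \<alpha>)) =
          (\<Oplus>\<alpha>\<in>?D. h (Poly_Mapping.lookup p \<alpha> * Poly_Mapping.lookup q (\<gamma> - \<alpha>)))"
      proof (rule finsum_cong')
        fix \<alpha> assume "\<alpha> \<in> ?D"
        then obtain \<beta> where "\<gamma> = \<alpha> + \<beta>" by blast
        with True show "mpoly_map S h n p \<alpha> \<otimes> mpoly_map S h n q (\<gamma> - \<alpha>) =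
          h (Poly_Mapping.lookup p \<alpha> * Poly_Mapping.lookup q (\<gamma> - \<alpha>))"
          by (simp add: mpoly_map_def h_mult keys_add_nat)
      qed auto
      also have "\<dots> = mpoly_map S h n (p * q) \<gamma>"
        using True by (simp add: mpoly_map_def lookup_mult_monom h_sum)
      finally show ?thesis .
    next
      case False
      have "(\<Oplus>\<alpha>\<in>?D. mpoly_map S h n p \<alpha> \<otimes> mpoly_map S h n q (\<gamma> - \<alpha>)) = (\<Oplus>\<alpha>\<in>?D. \<zero>)"
      proof (rule finsum_cong')
        fix \<alpha> assume "\<alpha> \<in> ?D"
        then obtain \<beta> where "\<gamma> = \<alpha> + \<beta>" by blast
        with False show "mpoly_map S h n p \<alpha> \<otimes> mpoly_map S h n q (\<gamma> - \<alpha>) = \<zero>"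
          by (auto simp: mpoly_map_def keys_add_nat)
      qed auto
      with False show ?thesis by (simp add: mpoly_map_def)
    qed
    then show "mpoly_map S h n (p * q) \<gamma> = (mpoly_map S h n p \<otimes>\<^bsub>mpoly_ring S n\<^esub> mpoly_map S h n q) \<gamma>"
      by (simp add: mpoly_ring_def)
  qed
qed

lemma mpoly_ring_class_hom:
  assumes surj: "range h = carrier S"
  shows "class_hom (mpoly_ring S n) (mpoly_map S h n)"
proof -
  have "range (mpoly_map S h n) = carrier (mpoly_ring S n)"
    using mpoly_map_closed mpoly_map_surj[OF surj] by blast
  then have "cring (mpoly_ring S n)"
    by (rule cring_image) (rule mpoly_map_ops)+
  then show ?thesis
    by (intro class_hom.intro class_hom_axioms.intro) (simp_all add: mpoly_map_ops mpoly_map_closed)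
qed

lemma mpoly_map_pderiv:
  assumes "i < n"
  shows "mpoly_pderiv S i (mpoly_map S h n p) = mpoly_map S h n (mderiv i p)"
proof
  fix \<alpha> :: monom
  have keys: "Poly_Mapping.keys (\<alpha> + Poly_Mapping.single i 1) \<subseteq> {..<n} \<longleftrightarrow> Poly_Mapping.keys \<alpha> \<subseteq> {..<n}"
    using assms by (simp add: keys_add_nat)
  show "mpoly_pderiv S i (mpoly_map S h n p) \<alpha> = mpoly_map S h n (mderiv i p) \<alpha>"
  proof (cases "Poly_Mapping.keys \<alpha> \<subseteq> {..<n}")
    case True
    show ?thesis
      unfolding mpoly_pderiv_def mpoly_map_def mderiv.rep_eq keys if_P[OF True] h_of_nat ..
  next
    case False
    show ?thesis
      unfolding mpoly_pderiv_def mpoly_map_def mderiv.rep_eq keys if_not_P[OF False] by simp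
  qed
qed

text \<open>\<open>k\<close> after \<open>h\<close> equals \<open>g\<close> after
  \<open>\<iota>\<close>, so the evaluation in the records is the image of an evaluation in types.
  Setting \<open>e\<close> to 0 from \<open>n\<close> on imitates the monomials discarded by
  \<open>mpoly_map\<close>.\<close>

lemma mpoly_eval_map:
  fixes T :: "('c, 'd) ring_scheme" (structure) and g :: "'s::comm_ring_1 \<Rightarrow> 'c"
  assumes T: "class_hom T g" and k: "\<And>r. k (h r) = g (\<iota> r)" and \<iota>: "comm_ring_hom \<iota>"
    and b: "\<And>i. i < n \<Longrightarrow> b i = g (e i)" and e: "\<And>i. n \<le> i \<Longrightarrow> e i = 0"
  shows "mpoly_eval S T k b (mpoly_map S h n p) = g (mval \<iota> e p)"
proof -
  interpret T: class_hom T g by (rule T)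
  let ?A = "{\<alpha>. mpoly_map S h n p \<alpha> \<noteq> \<zero>\<^bsub>S\<^esub>}"
  have A: "?A \<subseteq> Poly_Mapping.keys p" by (auto simp: mpoly_map_def in_keys_iff h_zero)
  then have finA: "finite ?A" by (rule finite_subset) simp
  have i0: "\<iota> 0 = 0" by (rule comm_ring_hom_0[OF \<iota>])
  have term_eq: "k (mpoly_map S h n p \<alpha>) \<otimes>\<^bsub>T\<^esub> (\<Otimes>\<^bsub>T\<^esub>i\<in>Poly_Mapping.keys \<alpha>. b i [^]\<^bsub>T\<^esub> Poly_Mapping.lookup \<alpha> i)
      = g (\<iota> (Poly_Mapping.lookup p \<alpha>) * monom_val e \<alpha>)" if "\<alpha> \<in> ?A" for \<alpha>
  proof -
    have keys: "Poly_Mapping.keys \<alpha> \<subseteq> {..<n}" using that by (auto simp: mpoly_map_def split: if_splits)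
    have "(\<Otimes>\<^bsub>T\<^esub>i\<in>Poly_Mapping.keys \<alpha>. b i [^]\<^bsub>T\<^esub> Poly_Mapping.lookup \<alpha> i) =
      (\<Otimes>\<^bsub>T\<^esub>i\<in>Poly_Mapping.keys \<alpha>. g (e i ^ Poly_Mapping.lookup \<alpha> i))"
      using keys by (intro T.finprod_cong') (auto simp: b T.h_power)
    also have "\<dots> = g (monom_val e \<alpha>)" by (simp add: monom_val_def T.h_prod)
    finally show ?thesis using keys by (simp add: mpoly_map_def k T.h_mult)
  qed
  have "mpoly_eval S T k b (mpoly_map S h n p) = (\<Oplus>\<^bsub>T\<^esub>\<alpha>\<in>?A. g (\<iota> (Poly_Mapping.lookup p \<alpha>) * monom_val e \<alpha>))"
    unfolding mpoly_eval_def by (rule T.finsum_cong') (use term_eq in auto)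
  also have "\<dots> = (\<Oplus>\<^bsub>T\<^esub>\<alpha>\<in>Poly_Mapping.keys p. g (\<iota> (Poly_Mapping.lookup p \<alpha>) * monom_val e \<alpha>))"
  proof (rule T.add.finprod_mono_neutral_cong_left)
    fix \<alpha> assume "\<alpha> \<in> Poly_Mapping.keys p - ?A"
    then have "Poly_Mapping.keys \<alpha> \<subseteq> {..<n} \<Longrightarrow> h (Poly_Mapping.lookup p \<alpha>) = \<zero>\<^bsub>S\<^esub>"
      by (auto simp: mpoly_map_def)
    \<comment> \<open>The sum in \<open>mpoly_eval\<close> omits coefficients killed by
      \<open>h\<close>; commutativity of the square shows that \<open>g\<close> kills them
      too.\<close>
    moreover have "g (\<iota> (Poly_Mapping.lookup p \<alpha>)) = \<zero>\<^bsub>T\<^esub>" if "h (Poly_Mapping.lookup p \<alpha>) = \<zero>\<^bsub>S\<^esub>"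
      using that k[of 0] k[of "Poly_Mapping.lookup p \<alpha>"] by (simp add: h_zero i0 T.h_zero)
    moreover have "monom_val e \<alpha> = 0" if nsub: "\<not> Poly_Mapping.keys \<alpha> \<subseteq> {..<n}"
    proof -
      obtain i where "i \<in> Poly_Mapping.keys \<alpha>" "n \<le> i" using nsub by (metis lessThan_iff not_less subsetI)
      then show ?thesis unfolding monom_val_def using e
        by (intro prod_zero) (auto simp: in_keys_iff power_0_left intro!: bexI[of _ i])
    qed
    ultimately show "g (\<iota> (Poly_Mapping.lookup p \<alpha>) * monom_val e \<alpha>) = \<zero>\<^bsub>T\<^esub>"
      by (cases "Poly_Mapping.keys \<alpha> \<subseteq> {..<n}") (simp_all add: T.h_mult T.h_zero)
  qed (use A in auto)
  also have "\<dots> = g (mval \<iota> e p)" by (simp add: mval_def T.h_sum)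
  finally show ?thesis .
qed

end

section \<open>Coordinate rings of sets of geometric points\<close>

lemma class_ring_hom: "class_hom (cring_class_ops :: 'k::comm_ring_1 ring) (\<lambda>x. x)"
  by (intro class_hom.intro class_hom_axioms.intro cring_class) (simp_all add: class_simps)

abbreviation to_kpoly :: "nat \<Rightarrow> 'k::field mp \<Rightarrow> 'k kpoly" where
  "to_kpoly n \<equiv> mpoly_map cring_class_ops (\<lambda>x. x) n"

lemma kpoly_class_hom: "class_hom (kpoly_ring n) (to_kpoly n :: 'k::field mp \<Rightarrow> _)"
  by (rule class_hom.mpoly_ring_class_hom[OF class_ring_hom]) (simp add: cring_class_ops_def)

lemma kpoly_surj:
  assumes "p \<in> carrier (kpoly_ring n :: 'k::field kpoly ring)"
  obtains P where "P \<in> below n" "p = to_kpoly n P"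
proof -
  obtain P where P: "p = to_kpoly n P"
    using class_hom.mpoly_map_surj[OF class_ring_hom _ assms] by (auto simp: cring_class_ops_def)
  have "to_kpoly n (ret n P) = to_kpoly n P"
    by (auto simp: mpoly_map_def lookup_ret fun_eq_iff)
  with P show thesis by (intro that[of "ret n P"]) simp_all
qed

lemma to_kpoly_eq: "to_kpoly n P = to_kpoly n Q \<longleftrightarrow> ret n P = ret n Q"
proof
  assume *: "to_kpoly n P = to_kpoly n Q"
  show "ret n P = ret n Q"
  proof (rule poly_mapping_eqI)
    fix \<alpha>
    show "Poly_Mapping.lookup (ret n P) \<alpha> = Poly_Mapping.lookup (ret n Q) \<alpha>"
      using fun_cong[OF *, of \<alpha>] by (auto simp: lookup_ret mpoly_map_def)
  qed
next
  assume *: "ret n P = ret n Q"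
  show "to_kpoly n P = to_kpoly n Q"
  proof
    fix \<alpha>
    show "to_kpoly n P \<alpha> = to_kpoly n Q \<alpha>"
      using arg_cong[OF *, of "\<lambda>p. Poly_Mapping.lookup p \<alpha>"] by (auto simp: lookup_ret mpoly_map_def)
  qed
qed

text \<open>The points have coordinates in the algebraic closure, the polynomials have coefficients
  in \<open>K\<close>. Such an ideal is automatically radical.\<close>

definition vanishing :: "(nat \<Rightarrow> 'k::field alg_closure) set \<Rightarrow> 'k mp set" where
  "vanishing Z = {P. \<forall>z\<in>Z. acv z P = 0}"

definition pideal :: "nat \<Rightarrow> (nat \<Rightarrow> 'k::field alg_closure) set \<Rightarrow> 'k kpoly set" where
  "pideal n Z = to_kpoly n ` vanishing Z"

abbreviation pring :: "nat \<Rightarrow> (nat \<Rightarrow> 'k::field alg_closure) set \<Rightarrow> 'k kpoly set ring" where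
  "pring n Z \<equiv> kpoly_ring n Quot pideal n Z"

definition pcls :: "nat \<Rightarrow> (nat \<Rightarrow> 'k::field alg_closure) set \<Rightarrow> 'k mp \<Rightarrow> 'k kpoly set" where
  "pcls n Z P = pideal n Z +>\<^bsub>kpoly_ring n\<^esub> to_kpoly n P"

definition lift_env :: "(nat \<Rightarrow> 'k::field) \<Rightarrow> nat \<Rightarrow> 'k alg_closure" where
  "lift_env e = (\<lambda>i. to_ac (e i))"

lemma acv_lift: "acv (lift_env e) P = to_ac (ev e P)"
  using mval_comp[OF to_ac_hom comm_ring_hom_id, of e P] by (simp add: lift_env_def)

text \<open>Because of the padding, variables from \<open>n\<close> on vanish on \<open>Z\<close>,
  so polynomials in any number of variables may represent elements of the coordinate ring.\<close>

locale point_ring =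
  fixes n :: nat and Z :: "(nat \<Rightarrow> 'k::field alg_closure) set"
  assumes trunc_Z: "z \<in> Z \<Longrightarrow> trunc n z = z"
begin

lemma vanishing_ret: "ret n P \<in> vanishing Z \<longleftrightarrow> P \<in> vanishing Z"
  by (auto simp: vanishing_def mval_ret[OF to_ac_hom] trunc_Z)

lemma pideal_iff: "to_kpoly n P \<in> pideal n Z \<longleftrightarrow> P \<in> vanishing Z"
proof
  assume "to_kpoly n P \<in> pideal n Z"
  then obtain Q where "Q \<in> vanishing Z" "to_kpoly n P = to_kpoly n Q" by (auto simp: pideal_def)
  then show "P \<in> vanishing Z" using vanishing_ret by (metis to_kpoly_eq)
qed (simp add: pideal_def)

lemma pideal_ideal: "ideal (pideal n Z) (kpoly_ring n)"
proof -
  interpret K: class_hom "kpoly_ring n" "to_kpoly n :: 'k mp \<Rightarrow> _" by (rule kpoly_class_hom)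
  show ?thesis
  proof (rule K.ideal_cringI)
    show "pideal n Z \<subseteq> carrier (kpoly_ring n)" by (auto simp: pideal_def)
    show "\<zero>\<^bsub>kpoly_ring n\<^esub> \<in> pideal n Z"
      using pideal_iff[of 0] by (simp add: K.h_zero vanishing_def acv_simps)
    fix a b assume "a \<in> pideal n Z" "b \<in> pideal n Z"
    then obtain P Q where "a = to_kpoly n P" "b = to_kpoly n Q" "P \<in> vanishing Z" "Q \<in> vanishing Z"
      by (auto simp: pideal_def)
    then show "a \<oplus>\<^bsub>kpoly_ring n\<^esub> b \<in> pideal n Z"
      by (simp add: pideal_iff vanishing_def acv_simps flip: K.h_add)
  next
    fix a x :: "'k kpoly" assume "a \<in> pideal n Z" "x \<in> carrier (kpoly_ring n)"
    then obtain P where P: "a = to_kpoly n P" "P \<in> vanishing Z" by (auto simp: pideal_def)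
    obtain Q where "x = to_kpoly n Q" using kpoly_surj[OF \<open>x \<in> carrier (kpoly_ring n)\<close>] by blast
    with P show "x \<otimes>\<^bsub>kpoly_ring n\<^esub> a \<in> pideal n Z"
      by (simp add: pideal_iff vanishing_def acv_simps flip: K.h_mult)
  qed
qed

lemma pideal_radical: "radical_ideal (pideal n Z) (kpoly_ring n)"
  unfolding radical_ideal_def
proof (intro conjI pideal_ideal ballI allI impI)
  interpret K: class_hom "kpoly_ring n" "to_kpoly n :: 'k mp \<Rightarrow> _" by (rule kpoly_class_hom)
  fix p and k :: nat assume p: "p \<in> carrier (kpoly_ring n)" "p [^]\<^bsub>kpoly_ring n\<^esub> k \<in> pideal n Z"
  obtain P where P: "p = to_kpoly n P" using kpoly_surj[OF p(1)] by blast
  have "P ^ k \<in> vanishing Z" using p(2) by (simp add: P pideal_iff flip: K.h_power)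
  then show "p \<in> pideal n Z" by (auto simp: P pideal_iff vanishing_def acv_simps)
qed

lemma pring_class_hom: "class_hom (pring n Z) (pcls n Z)"
proof -
  interpret K: class_hom "kpoly_ring n" "to_kpoly n :: 'k mp \<Rightarrow> _" by (rule kpoly_class_hom)
  interpret J: ideal "pideal n Z" "kpoly_ring n" by (rule pideal_ideal)
  note hom = J.rcos_ring_hom
  show ?thesis
  proof (intro class_hom.intro class_hom_axioms.intro)
    show "cring (pring n Z)" by (rule J.quotient_is_cring) (rule K.is_cring)
    fix P Q
    show "pcls n Z P \<in> carrier (pring n Z)"
      unfolding pcls_def by (rule ring_hom_closed[OF hom]) simp
    show "pcls n Z 1 = \<one>\<^bsub>pring n Z\<^esub>"
      unfolding pcls_def K.h_one by (rule ring_hom_one[OF hom])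
    show "pcls n Z (P + Q) = pcls n Z P \<oplus>\<^bsub>pring n Z\<^esub> pcls n Z Q"
      unfolding pcls_def K.h_add by (rule ring_hom_add[OF hom]) simp_all
    show "pcls n Z (P * Q) = pcls n Z P \<otimes>\<^bsub>pring n Z\<^esub> pcls n Z Q"
      unfolding pcls_def K.h_mult by (rule ring_hom_mult[OF hom]) simp_all
  qed
qed

sublocale R: class_hom "pring n Z" "pcls n Z"
  by (rule pring_class_hom)

lemma pcls_surj:
  assumes "x \<in> carrier (pring n Z)"
  obtains P where "x = pcls n Z P"
proof -
  obtain p where "p \<in> carrier (kpoly_ring n)" "x = pideal n Z +>\<^bsub>kpoly_ring n\<^esub> p"
    using assms by (auto simp: FactRing_def A_RCOSETS_def')
  then show thesis using kpoly_surj[of p n] that by (metis pcls_def)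
qed

lemma pcls_zero: "pcls n Z P = \<zero>\<^bsub>pring n Z\<^esub> \<longleftrightarrow> P \<in> vanishing Z"
proof -
  interpret K: class_hom "kpoly_ring n" "to_kpoly n :: 'k mp \<Rightarrow> _" by (rule kpoly_class_hom)
  interpret J: ideal "pideal n Z" "kpoly_ring n" by (rule pideal_ideal)
  have "pcls n Z P = \<zero>\<^bsub>pring n Z\<^esub> \<longleftrightarrow> to_kpoly n P \<in> pideal n Z"
    unfolding pcls_def using J.a_rcos_const J.a_rcos_self[of "to_kpoly n P"] by (auto simp: FactRing_def)
  then show ?thesis by (simp add: pideal_iff)
qed

lemma pcls_eq: "pcls n Z P = pcls n Z Q \<longleftrightarrow> P - Q \<in> vanishing Z"
  using R.r_right_minus_eq[of "pcls n Z P" "pcls n Z Q"] by (simp flip: pcls_zero R.h_minus)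

lemma pcls_mvar_ge: "n \<le> i \<Longrightarrow> pcls n Z (mvar i) = \<zero>\<^bsub>pring n Z\<^esub>"
  unfolding pcls_zero vanishing_def
proof (intro CollectI ballI)
  fix z assume "n \<le> i" "z \<in> Z"
  then have "z i = 0" using fun_cong[OF trunc_Z, of z i] by (simp add: trunc_def)
  then show "acv z (mvar i) = 0" by simp
qed

text \<open>The prime of all classes vanishing at a point; the values may lie in any field extension.\<close>

lemma prime_at:
  fixes h :: "'k mp \<Rightarrow> 'l::field"
  assumes h: "comm_ring_hom h" and van: "\<And>P. P \<in> vanishing Z \<Longrightarrow> h P = 0"
  shows "primeideal {pcls n Z P | P. h P = 0} (pring n Z)" "pcls n Z P \<in> {pcls n Z P | P. h P = 0} \<longleftrightarrow> h P = 0"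
proof -
  note hs = comm_ring_hom_simps[OF h]
  show mem: "pcls n Z P \<in> {pcls n Z P | P. h P = 0} \<longleftrightarrow> h P = 0" for P
  proof
    assume "pcls n Z P \<in> {pcls n Z P | P. h P = 0}"
    then obtain Q where "pcls n Z P = pcls n Z Q" "h Q = 0" by auto
    then show "h P = 0" using van[of "P - Q"] by (simp add: pcls_eq hs)
  qed blast
  show "primeideal {pcls n Z P | P. h P = 0} (pring n Z)"
  proof (rule primeidealI)
    show "ideal {pcls n Z P | P. h P = 0} (pring n Z)"
    proof (rule R.ideal_cringI)
      show "\<zero>\<^bsub>pring n Z\<^esub> \<in> {pcls n Z P | P. h P = 0}"
        using mem[of 0] by (simp only: R.h_zero hs)
      fix a b assume "a \<in> {pcls n Z P | P. h P = 0}" "b \<in> {pcls n Z P | P. h P = 0}"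
      then obtain P Q where "a = pcls n Z P" "b = pcls n Z Q" "h P = 0" "h Q = 0" by auto
      then show "a \<oplus>\<^bsub>pring n Z\<^esub> b \<in> {pcls n Z P | P. h P = 0}"
        using mem[of "P + Q"] by (simp only: R.h_add hs add_0)
    next
      fix a x assume "a \<in> {pcls n Z P | P. h P = 0}" and x: "x \<in> carrier (pring n Z)"
      then obtain P where P: "a = pcls n Z P" "h P = 0" by auto
      obtain Q where "x = pcls n Z Q" using pcls_surj[OF x] .
      with P show "x \<otimes>\<^bsub>pring n Z\<^esub> a \<in> {pcls n Z P | P. h P = 0}"
        using mem[of "Q * P"] by (simp only: R.h_mult hs mult_zero_right)
    qed auto
    show "cring (pring n Z)" by (rule R.is_cring)
    show "carrier (pring n Z) \<noteq> {pcls n Z P | P. h P = 0}"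
    proof
      assume eq: "carrier (pring n Z) = {pcls n Z P | P. h P = 0}"
      have "pcls n Z 1 \<in> {pcls n Z P | P. h P = 0}" unfolding eq[symmetric] by (rule R.h_closed)
      then show False using mem[of 1] by (simp only: hs) simp
    qed
    fix a b assume ab: "a \<in> carrier (pring n Z)" "b \<in> carrier (pring n Z)"
      "a \<otimes>\<^bsub>pring n Z\<^esub> b \<in> {pcls n Z P | P. h P = 0}"
    obtain P where P: "a = pcls n Z P" using pcls_surj[OF ab(1)] .
    obtain Q where Q: "b = pcls n Z Q" using pcls_surj[OF ab(2)] .
    have "h (P * Q) = 0" using ab(3) mem[of "P * Q"] by (simp only: P Q R.h_mult)
    then show "a \<in> {pcls n Z P | P. h P = 0} \<or> b \<in> {pcls n Z P | P. h P = 0}"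
      using mem by (simp only: P Q hs mult_eq_0_iff)
  qed
qed

text \<open>The points of \<open>Z\<close> already supply enough primes: a class contained in all of
  these vanishes on \<open>Z\<close>.\<close>

lemma pring_jacobson_free: "jacobson_free (pring n Z)"
proof (intro jacobson_free.intro jacobson_free_axioms.intro R.is_cring)
  fix a assume a: "a \<in> carrier (pring n Z)" and pr: "\<And>P. primeideal P (pring n Z) \<Longrightarrow> a \<in> P"
  obtain P where P: "a = pcls n Z P" using pcls_surj[OF a] .
  have "acv z P = 0" if z: "z \<in> Z" for z
  proof -
    have van: "\<And>P. P \<in> vanishing Z \<Longrightarrow> acv z P = 0" using z by (simp add: vanishing_def)
    show ?thesis
      using pr[OF prime_at(1)[OF mval_hom[OF to_ac_hom] van]] prime_at(2)[OF mval_hom[OF to_ac_hom] van] P by simp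
  qed
  then show "a = \<zero>\<^bsub>pring n Z\<^esub>" unfolding P pcls_zero by (simp add: vanishing_def)
qed

definition pscal :: "'k \<Rightarrow> 'k kpoly set" where
  "pscal k = pideal n Z +>\<^bsub>kpoly_ring n\<^esub> mpoly_const cring_class_ops k"

lemma pscal_eq: "pscal k = pcls n Z (mconst k)"
proof -
  have "mpoly_const cring_class_ops k = to_kpoly n (mconst k)"
    by (auto simp: mpoly_const_def mpoly_map_def lookup_mconst class_simps fun_eq_iff)
  then show ?thesis by (simp add: pscal_def pcls_def)
qed

lemma pscal_hom: "pscal \<in> Ring.ring_hom cring_class_ops (pring n Z)"
  by (rule ring_hom_memI)
    (simp_all add: pscal_eq class_simps mconst_simps R.h_add R.h_mult R.h_one)

lemma closed_subscheme_eq: "closed_subscheme n (pideal n Z) = spec (pring n Z) pscal"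
  by (simp add: closed_subscheme_def pscal_def[abs_def])

lemma kvariety_pideal: "kvariety (closed_subscheme n (pideal n Z))"
  by (rule kvariety_closed_subscheme[OF pideal_ideal pring_jacobson_free])
    (use pscal_hom in \<open>simp add: pscal_def[abs_def]\<close>)

lemma ev_to_kpoly:
  assumes "length a = n"
  shows "mpoly_eval cring_class_ops cring_class_ops id (nth a) (to_kpoly n P) = ev (lenv a) P"
proof -
  have "mpoly_eval cring_class_ops cring_class_ops (\<lambda>x. x) (nth a) (to_kpoly n P) = ev (lenv a) P"
    by (rule class_hom.mpoly_eval_map[OF class_ring_hom class_ring_hom _ comm_ring_hom_id])
      (simp_all add: lenv_def assms)
  then show ?thesis by (simp add: id_def)
qed

lemma point_ideal_eq:
  assumes "length a = n"
  shows "point_ideal n (pideal n Z) a = {pcls n Z P | P. ev (lenv a) P = 0}"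
proof -
  interpret K: class_hom "kpoly_ring n" "to_kpoly n :: 'k mp \<Rightarrow> _" by (rule kpoly_class_hom)
  have "(\<exists>p. x = pideal n Z +>\<^bsub>kpoly_ring n\<^esub> p \<and> p \<in> carrier (kpoly_ring n) \<and>
      mpoly_eval cring_class_ops cring_class_ops id (nth a) p = 0) \<longleftrightarrow>
    (\<exists>P. x = pcls n Z P \<and> ev (lenv a) P = 0)" (is "?l \<longleftrightarrow> ?r") for x
  proof
    assume ?l
    then obtain p where p: "x = pideal n Z +>\<^bsub>kpoly_ring n\<^esub> p" "p \<in> carrier (kpoly_ring n)"
      "mpoly_eval cring_class_ops cring_class_ops id (nth a) p = 0" by blast
    obtain P where P: "p = to_kpoly n P" using kpoly_surj[OF p(2)] by blast
    show ?r using p(1,3) by (intro exI[of _ P]) (simp add: P pcls_def ev_to_kpoly[OF assms])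
  next
    assume ?r
    then obtain P where "x = pcls n Z P" "ev (lenv a) P = 0" by blast
    then show ?l by (intro exI[of _ "to_kpoly n P"]) (simp add: pcls_def ev_to_kpoly[OF assms])
  qed
  then show ?thesis unfolding point_ideal_def by blast
qed

text \<open>A rational point is recovered from the values of the coordinate functions at it; modulo
  its prime, every polynomial then equals its value at that tuple.\<close>

lemma kpoints_pideal:
  "kpoints (closed_subscheme n (pideal n Z)) =
    point_ideal n (pideal n Z) ` {a \<in> affine_points n. \<forall>P\<in>vanishing Z. ev (lenv a) P = 0}"
proof (intro equalityI subsetI)
  fix x assume "x \<in> kpoints (closed_subscheme n (pideal n Z))"
  then have x: "primeideal x (pring n Z)" "\<And>a. a \<in> carrier (pring n Z) \<Longrightarrow> \<exists>k. a \<ominus>\<^bsub>pring n Z\<^esub> pscal k \<in> x"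
    unfolding closed_subscheme_eq R.kpoints_spec_iff[OF pscal_hom] by auto
  interpret x: primeideal x "pring n Z" by (rule x(1))
  have "\<exists>k. pcls n Z (mvar i - mconst k) \<in> x" for i
    using x(2)[of "pcls n Z (mvar i)"] by (simp add: pscal_eq R.h_minus)
  then obtain k where k: "\<And>i. pcls n Z (mvar i - mconst (k i)) \<in> x" by metis
  define a where "a = map k [0..<n]"
  have la: "length a = n" by (simp add: a_def)
  \<comment> \<open>The congruence holds for constants and variables and is preserved by sums and
    products.\<close>
  have lin: "pcls n Z (Q - mconst (ev (lenv a) Q)) \<in> x" for Q
  proof (induct Q rule: mp_induct)
    case (const c)
    show ?case by (simp add: R.h_zero additive_subgroup.zero_closed[OF x.is_additive_subgroup])
  next
    case (var i)
    show ?case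
    proof (cases "i < n")
      case True
      then show ?thesis using k[of i] by (simp add: lenv_def a_def)
    next
      case False
      then show ?thesis
        by (simp add: lenv_def a_def pcls_mvar_ge additive_subgroup.zero_closed[OF x.is_additive_subgroup])
    qed
  next
    case (add p q)
    have eq: "p + q - mconst (ev (lenv a) (p + q)) = (p - mconst (ev (lenv a) p)) + (q - mconst (ev (lenv a) q))"
      by (simp add: ev_simps mconst_simps)
    show ?case unfolding eq R.h_add by (rule x.a_closed[OF add])
  next
    case (mult p q)
    have eq: "p * q - mconst (ev (lenv a) (p * q)) =
      q * (p - mconst (ev (lenv a) p)) + mconst (ev (lenv a) p) * (q - mconst (ev (lenv a) q))"
      by (simp add: ev_simps mconst_simps algebra_simps)
    show ?case unfolding eq R.h_add R.h_mult
      by (rule x.a_closed[OF x.I_l_closed[OF mult(1) R.h_closed] x.I_l_closed[OF mult(2) R.h_closed]])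
  qed
  have ev0: "ev (lenv a) Q = 0" if Q: "pcls n Z Q \<in> x" for Q
  proof (rule ccontr)
    assume c: "ev (lenv a) Q \<noteq> 0"
    let ?c = "ev (lenv a) Q"
    \<comment> \<open>If the value were nonzero, the prime would contain an invertible
      constant.\<close>
    have "pcls n Z (mconst ?c) = pcls n Z Q \<ominus>\<^bsub>pring n Z\<^esub> pcls n Z (Q - mconst ?c)"
      by (simp flip: R.h_minus)
    also have "\<dots> \<in> x" unfolding a_minus_def
      by (intro x.a_closed Q additive_subgroup.a_inv_closed[OF x.is_additive_subgroup] lin)
    finally have "pcls n Z (mconst (inverse ?c)) \<otimes>\<^bsub>pring n Z\<^esub> pcls n Z (mconst ?c) \<in> x"
      by (intro x.I_l_closed R.h_closed)
    moreover have "mconst (inverse ?c) * mconst ?c = (1 :: 'k mp)"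
      using c by (simp flip: mconst_simps(4))
    ultimately have "\<one>\<^bsub>pring n Z\<^esub> \<in> x" by (simp flip: R.h_mult R.h_one)
    then show False using x.one_imp_carrier x.I_notcarr by blast
  qed
  have ev1: "pcls n Z Q \<in> x" if "ev (lenv a) Q = 0" for Q
    using lin[of Q] that by simp
  have "\<forall>P\<in>vanishing Z. ev (lenv a) P = 0"
    using ev0 additive_subgroup.zero_closed[OF x.is_additive_subgroup] by (metis (no_types) pcls_zero)
  moreover have "x = {pcls n Z P | P. ev (lenv a) P = 0}"
  proof (intro equalityI subsetI)
    fix y assume y: "y \<in> x"
    then have "y \<in> carrier (pring n Z)" using x.a_subset by blast
    then obtain Q where Q: "y = pcls n Z Q" by (rule pcls_surj)
    with ev0[of Q] y show "y \<in> {pcls n Z P | P. ev (lenv a) P = 0}" by auto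
  qed (use ev1 in blast)
  ultimately show "x \<in> point_ideal n (pideal n Z) ` {a \<in> affine_points n. \<forall>P\<in>vanishing Z. ev (lenv a) P = 0}"
    using la by (intro image_eqI[of _ _ a]) (simp_all add: point_ideal_eq affine_points_def)
next
  fix x assume "x \<in> point_ideal n (pideal n Z) ` {a \<in> affine_points n. \<forall>P\<in>vanishing Z. ev (lenv a) P = 0}"
  then obtain a where a: "length a = n" "\<And>P. P \<in> vanishing Z \<Longrightarrow> ev (lenv a) P = 0"
    and x: "x = {pcls n Z P | P. ev (lenv a) P = 0}"
    by (auto simp: point_ideal_eq affine_points_def)
  note pr = prime_at[OF ev_hom a(2)]
  have "\<exists>k. b \<ominus>\<^bsub>pring n Z\<^esub> pscal k \<in> x" if "b \<in> carrier (pring n Z)" for b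
  proof -
    obtain P where P: "b = pcls n Z P" using pcls_surj[OF \<open>b \<in> carrier (pring n Z)\<close>] .
    have "pcls n Z (P - mconst (ev (lenv a) P)) \<in> x"
      unfolding x using pr(2)[of "P - mconst (ev (lenv a) P)"] by (simp add: ev_simps)
    then show ?thesis by (auto simp: P pscal_eq R.h_minus)
  qed
  then show "x \<in> kpoints (closed_subscheme n (pideal n Z))"
    unfolding closed_subscheme_eq R.kpoints_spec_iff[OF pscal_hom] using pr(1) by (simp add: x)
qed

lemma mem_point_ideal:
  assumes "length a = n" "\<And>P. P \<in> vanishing Z \<Longrightarrow> ev (lenv a) P = 0"
  shows "pcls n Z P \<in> point_ideal n (pideal n Z) a \<longleftrightarrow> ev (lenv a) P = 0"
  unfolding point_ideal_eq[OF assms(1)] by (rule prime_at(2)[OF ev_hom assms(2)])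

end

section \<open>Global sections of the coordinate rings\<close>

context point_ring
begin

text \<open>\<open>standard_smooth\<close> refers to rings of sections, not to coordinate rings.
  This map presents the global sections directly as a quotient of the type of polynomials.\<close>

definition gsec :: "'k mp \<Rightarrow> 'k kpoly set spec_section" where
  "gsec P = (\<lambda>Q\<in>{Q. primeideal Q (pring n Z)}. frac (pring n Z) Q (pcls n Z P) \<one>\<^bsub>pring n Z\<^esub>)"

abbreviation gring :: "'k kpoly set spec_section ring" where
  "gring \<equiv> sect (spec (pring n Z) pscal) {Q. primeideal Q (pring n Z)}"

lemma gsec_glob: "gsec P = jacobson_free.glob (pring n Z) (pcls n Z P)"
  by (simp add: gsec_def jacobson_free.glob_def[OF pring_jacobson_free])

lemma gsec_class_hom: "class_hom gring gsec"
proof (intro class_hom.intro class_hom_axioms.intro)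
  show "cring gring" by (rule R.cring_sections[OF R.zariski_open_primes])
  note hom = jacobson_free.glob_hom[OF pring_jacobson_free, where c = pscal]
  fix P Q
  show "gsec P \<in> carrier gring" unfolding gsec_glob by (rule ring_hom_closed[OF hom R.h_closed])
  show "gsec 1 = \<one>\<^bsub>gring\<^esub>" unfolding gsec_glob R.h_one by (rule ring_hom_one[OF hom])
  show "gsec (P + Q) = gsec P \<oplus>\<^bsub>gring\<^esub> gsec Q"
    unfolding gsec_glob R.h_add by (rule ring_hom_add[OF hom R.h_closed R.h_closed])
  show "gsec (P * Q) = gsec P \<otimes>\<^bsub>gring\<^esub> gsec Q"
    unfolding gsec_glob R.h_mult by (rule ring_hom_mult[OF hom R.h_closed R.h_closed])
qed

lemma gsec_range: "range gsec = carrier gring"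
proof
  show "range gsec \<subseteq> carrier gring" using class_hom.h_closed[OF gsec_class_hom] by blast
  show "carrier gring \<subseteq> range gsec"
  proof
    fix x assume "x \<in> carrier gring"
    then have "x \<in> spec_sections (pring n Z) {Q. primeideal Q (pring n Z)}" by (simp only: spec_simps)
    then obtain a where a: "a \<in> carrier (pring n Z)" "x = jacobson_free.glob (pring n Z) a"
      by (rule jacobson_free.glob_surj[OF pring_jacobson_free])
    obtain P where "a = pcls n Z P" using pcls_surj[OF a(1)] .
    with a(2) show "x \<in> range gsec" by (auto simp: gsec_glob)
  qed
qed

lemma gsec_zero: "gsec P = \<zero>\<^bsub>gring\<^esub> \<longleftrightarrow> P \<in> vanishing Z"
proof
  assume "gsec P = \<zero>\<^bsub>gring\<^esub>"
  moreover have "gsec 0 = \<zero>\<^bsub>gring\<^esub>" by (rule class_hom.h_zero[OF gsec_class_hom])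
  ultimately have "jacobson_free.glob (pring n Z) (pcls n Z P) = jacobson_free.glob (pring n Z) \<zero>\<^bsub>pring n Z\<^esub>"
    by (simp only: gsec_glob R.h_zero)
  then show "P \<in> vanishing Z"
    using jacobson_free.glob_eq_zero[OF pring_jacobson_free R.h_closed] pcls_zero by blast
next
  assume "P \<in> vanishing Z"
  then have "pcls n Z P = pcls n Z 0" by (simp add: pcls_eq)
  then have "gsec P = gsec 0" by (simp add: gsec_def)
  then show "gsec P = \<zero>\<^bsub>gring\<^esub>" using class_hom.h_zero[OF gsec_class_hom] by simp
qed

lemma gsec_eq: "P - Q \<in> vanishing Z \<Longrightarrow> gsec P = gsec Q"
  by (simp add: gsec_def flip: pcls_eq)

lemma gsec_ret: "gsec (ret n P) = gsec P"
  by (rule gsec_eq) (simp add: vanishing_def acv_simps mval_ret[OF to_ac_hom] trunc_Z)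

lemma kpts_closed: "kpts (closed_subscheme n (pideal n Z)) = {Q. primeideal Q (pring n Z)}"
  unfolding closed_subscheme_eq by (simp add: R.topspace_zariski)

lemma affine_open_pideal: "affine_open (closed_subscheme n (pideal n Z)) (kpts (closed_subscheme n (pideal n Z)))"
  by (rule affine_open_whole[OF pideal_ideal]) (unfold closed_subscheme_eq, rule R.sheaf_spec[OF pscal_hom])

end

section \<open>Towers are standard smooth of relative dimension zero\<close>

lemma power_minus_one_idl:
  assumes "x - 1 \<in> idl G"
  shows "x ^ N - 1 \<in> idl G"
proof (induct N)
  case (Suc N)
  have eq: "x ^ Suc N - 1 = x * (x ^ N - 1) + (x - 1)" by (simp add: algebra_simps)
  show ?case unfolding eq by (rule idl_add[OF assms idl_mult[OF Suc]])
qed (simp add: idl_0)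

text \<open>Only the equations are imposed. Simplicity of the roots is not part of the definition,
  as in an \<open>etale_tower\<close> it follows from the unit relation.\<close>

definition tower_points :: "nat \<Rightarrow> (nat \<Rightarrow> 'k::field alg_closure) set \<Rightarrow> 'k mp poly list \<Rightarrow> (nat \<Rightarrow> 'k alg_closure) set" where
  "tower_points m Z fs = {e. trunc (m + length fs) e = e \<and> trunc m e \<in> Z \<and>
    (\<forall>i<length fs. acv e (emb (m + i) (fs ! i)) = 0)}"

text \<open>\<open>w\<close> inverts all leading coefficients and derivatives modulo the equations.
  The relation is stated in the generated ideal, not pointwise, so that it can be used before that
  ideal is known to be radical.\<close>

locale etale_tower = V: point_ring m Z for m and Z :: "(nat \<Rightarrow> 'k::field alg_closure) set" +
  fixes fs :: "'k mp poly list" and w :: "'k mp"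
  assumes unit: "w * tower_unit m fs (length fs) - 1 \<in> idl (tower_gens m Z fs (length fs))"
begin

definition r :: nat where "r = length fs"
definition Y :: "(nat \<Rightarrow> 'k alg_closure) set" where "Y = tower_points m Z fs"
definition F :: "nat \<Rightarrow> 'k mp" where "F i = emb (m + i) (fs ! i)"

sublocale Y: point_ring "m + r" Y
  by unfold_locales (simp add: Y_def tower_points_def r_def)

lemma gens_vanishing: "P \<in> idl (tower_gens m Z fs r) \<Longrightarrow> P \<in> vanishing Y"
proof (induct rule: idl.induct)
  case (idl_add_mult x b g)
  have "acv e b = 0" if e: "e \<in> Y" for e
  proof -
    from idl_add_mult(3) consider "b \<in> below m" "\<forall>z\<in>Z. acv z b = 0" | i where "i < r" "b = F i"
      by (auto simp: tower_gens_def F_def)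
    then show ?thesis
    proof cases
      case 1
      have "trunc m e \<in> Z" using e by (simp add: Y_def tower_points_def)
      then show ?thesis using 1(2) mval_trunc_below[OF to_ac_hom 1(1), of e] by simp
    next
      case 2
      then show ?thesis using e by (simp add: Y_def tower_points_def F_def r_def)
    qed
  qed
  with idl_add_mult show ?case by (simp add: vanishing_def acv_simps)
qed (simp add: vanishing_def acv_simps)

lemma F_below: "i < r \<Longrightarrow> F i \<in> below (m + r)"
  unfolding F_def by (rule below_mono[OF _ emb_below]) simp

text \<open>The Nullstellensatz puts \<open>u^N * P\<close> into the ideal. As \<open>w * u\<close>
  is 1 modulo the ideal, the power is cancelled by writing
  \<open>P = w^N * (u^N * P) + P * (1 - (w * u)^N)\<close>.\<close>

lemma vanishing_idl:
  assumes P: "P \<in> below (m + r)" "P \<in> vanishing Y"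
  shows "P \<in> idl (tower_gens m Z fs r)"
proof -
  let ?u = "tower_unit m fs r"
  have "acv e P = 0" if e: "tower_sol m Z fs r e" for e
  proof -
    have "acv (trunc (m + r) e) (F i) = 0" if "i < r" for i
      using e that mval_trunc_below[OF to_ac_hom F_below[OF that], of e]
      by (simp add: tower_sol_def simple_root_iff[OF to_ac_hom] F_def)
    then have "trunc (m + r) e \<in> Y"
      using e by (simp add: Y_def tower_points_def tower_sol_def min_def flip: r_def F_def)
    then show ?thesis
      using P(2) mval_trunc_below[OF to_ac_hom P(1), of e] by (simp add: vanishing_def)
  qed
  then obtain N where N: "?u ^ N * P \<in> idl (tower_gens m Z fs r)"
    using tower_nullstellensatz[OF V.trunc_Z P(1)] by blast
  have 1: "P * (1 - (w * ?u) ^ N) \<in> idl (tower_gens m Z fs r)"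
    using idl_mult[OF power_minus_one_idl[OF unit[folded r_def], of N], of "- P"] by (simp add: algebra_simps)
  have "P = w ^ N * (?u ^ N * P) + P * (1 - (w * ?u) ^ N)"
    by (simp add: algebra_simps power_mult_distrib)
  then show ?thesis using idl_add[OF 1 idl_mult[OF N, of "w ^ N"]] by simp
qed

text \<open>The inclusion of the base ring, on classes. The chosen representative is harmless:
  points of \<open>Y\<close> lie over \<open>Z\<close>, so \<open>ret m\<close> maps
  \<open>vanishing Z\<close> into \<open>vanishing Y\<close>.\<close>

definition hom :: "'k kpoly set \<Rightarrow> 'k kpoly set" where
  "hom x = pcls (m + r) Y (ret m (SOME P. x = pcls m Z P))"

lemma ret_vanishing: "P \<in> vanishing Z \<Longrightarrow> ret m P \<in> vanishing Y"
  by (simp add: vanishing_def mval_ret[OF to_ac_hom] Y_def tower_points_def)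

lemma hom_pcls: "hom (pcls m Z P) = pcls (m + r) Y (ret m P)"
proof -
  have "pcls m Z P = pcls m Z (SOME Q. pcls m Z P = pcls m Z Q)" by (rule someI[of _ P]) simp
  then have "P - (SOME Q. pcls m Z P = pcls m Z Q) \<in> vanishing Z" by (simp only: V.pcls_eq)
  then show ?thesis
    unfolding hom_def using ret_vanishing by (simp add: Y.pcls_eq ret_simps[symmetric] Y.R.h_closed) 
      (metis Y.pcls_eq ret_simps(6))
qed

lemma hom_ring_hom: "ring_hom_cring (pring m Z) (pring (m + r) Y) hom"
proof (intro ring_hom_cring.intro ring_hom_cring_axioms.intro V.R.is_cring Y.R.is_cring ring_hom_memI)
  fix x y assume xy: "x \<in> carrier (pring m Z)" "y \<in> carrier (pring m Z)"
  obtain P where P: "x = pcls m Z P" using V.pcls_surj[OF xy(1)] .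
  obtain Q where Q: "y = pcls m Z Q" using V.pcls_surj[OF xy(2)] .
  show "hom x \<in> carrier (pring (m + r) Y)" by (simp add: P hom_pcls)
  show "hom (x \<otimes>\<^bsub>pring m Z\<^esub> y) = hom x \<otimes>\<^bsub>pring (m + r) Y\<^esub> hom y"
    unfolding P Q V.R.h_mult[symmetric] hom_pcls ret_simps Y.R.h_mult ..
  show "hom (x \<oplus>\<^bsub>pring m Z\<^esub> y) = hom x \<oplus>\<^bsub>pring (m + r) Y\<^esub> hom y"
    unfolding P Q V.R.h_add[symmetric] hom_pcls ret_simps Y.R.h_add ..
next
  show "hom \<one>\<^bsub>pring m Z\<^esub> = \<one>\<^bsub>pring (m + r) Y\<^esub>"
    unfolding V.R.h_one[symmetric] hom_pcls ret_simps Y.R.h_one ..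
qed

definition f :: "'k kpoly set set \<Rightarrow> 'k kpoly set set" where
  "f = spec_pt (pring m Z) hom"

definition pull :: "'k kpoly set set set \<Rightarrow> 'k kpoly set spec_section \<Rightarrow> 'k kpoly set spec_section" where
  "pull = spec_pull (pring m Z) (pring (m + r) Y) hom"

lemma f_kmorphism:
  "kmorphism (closed_subscheme (m + r) (pideal (m + r) Y)) (closed_subscheme m (pideal m Z)) f pull"
  unfolding f_def pull_def V.closed_subscheme_eq Y.closed_subscheme_eq
proof (rule ring_hom_cring.spec_morphism[OF hom_ring_hom])
  fix k
  show "V.pscal k \<in> carrier (pring m Z)" by (simp add: V.pscal_eq)
  show "hom (V.pscal k) = Y.pscal k" by (simp add: V.pscal_eq Y.pscal_eq hom_pcls)
qed

lemma f_prime: "primeideal P (pring (m + r) Y) \<Longrightarrow> primeideal (f P) (pring m Z)"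
  unfolding f_def by (rule ring_hom_cring.spec_pt_prime[OF hom_ring_hom])

lemma pull_gsec: "pull {Q. primeideal Q (pring m Z)} (V.gsec P) = Y.gsec (ret m P)"
  unfolding pull_def V.gsec_def Y.gsec_def
    ring_hom_cring.spec_pull_frac[OF hom_ring_hom V.R.h_closed] hom_pcls
  using f_prime by (intro arg_cong[where f = "restrict _"]) (auto simp: f_def)

text \<open>\<open>flat\<close> and \<open>nest\<close> pass between polynomials in
  \<open>m + r\<close> variables and polynomials in \<open>r\<close> variables with coefficients in
  \<open>m\<close> variables; the latter form is the one demanded by a presentation over the
  base.\<close>

definition flat :: "'k mp mp \<Rightarrow> 'k mp" where
  "flat = mval (ret m) (\<lambda>j. if j < r then mvar (m + j) else 0)"

definition nest :: "'k mp \<Rightarrow> 'k mp mp" where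
  "nest = mval (\<lambda>c. mconst (mconst c)) (\<lambda>i. if i < m then mconst (mvar i) else mvar (i - m))"

lemma flat_hom: "comm_ring_hom flat" and nest_hom: "comm_ring_hom nest"
  unfolding flat_def nest_def
  by (rule mval_hom[OF ret_hom], rule mval_hom[OF comm_ring_hom_comp[OF mconst_hom mconst_hom]])

lemma flat_base [simp]: "flat (mconst p) = ret m p" "flat (mvar j) = (if j < r then mvar (m + j) else 0)"
  by (simp_all add: flat_def ret_simps)

lemma nest_base [simp]: "nest (mconst c) = mconst (mconst c)"
  "nest (mvar i) = (if i < m then mconst (mvar i) else mvar (i - m))"
  by (simp_all add: nest_def)

lemmas flat_simps = comm_ring_hom_simps[OF flat_hom]
lemmas nest_simps = comm_ring_hom_simps[OF nest_hom]

lemma flat_nest: "flat (nest P) = ret (m + r) P"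
  by (rule mp_hom_ext[where f = "\<lambda>P. flat (nest P)", OF comm_ring_hom_comp[OF flat_hom nest_hom] ret_hom])
    (auto simp: ret_mvar flat_simps)

lemma flat_below: "flat q \<in> below (m + r)"
  by (induct q rule: mp_induct) (auto simp: flat_simps intro: below_add below_mult below_mono[OF _ ret_below])

lemma nest_below: "p \<in> below m \<Longrightarrow> nest p = mconst p"
  by (induct p rule: below_induct) (simp_all add: nest_simps mconst_simps)

lemma mderiv_nest: "mderiv j (nest P) = nest (mderiv (m + j) P)"
proof (induct P rule: mp_induct)
  case (var i)
  show ?case by (auto simp: mderiv_mvar nest_simps)
qed (simp_all add: mderiv_add mderiv_mult nest_simps)

abbreviation "A \<equiv> V.gring"
abbreviation "B \<equiv> Y.gring"

text \<open>The structure map exactly as it occurs in \<open>etale_morphism\<close> when both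
  neighbourhoods are the whole spaces.\<close>

definition base_map :: "'k kpoly set spec_section \<Rightarrow> 'k kpoly set spec_section" where
  "base_map s = rstr (closed_subscheme (m + r) (pideal (m + r) Y))
    (preim (closed_subscheme (m + r) (pideal (m + r) Y)) f {Q. primeideal Q (pring m Z)})
    {Q. primeideal Q (pring (m + r) Y)} (pull {Q. primeideal Q (pring m Z)} s)"

lemma base_map_gsec: "base_map (V.gsec P) = Y.gsec (ret m P)"
  unfolding base_map_def pull_gsec Y.closed_subscheme_eq
  by (simp add: Y.gsec_def)

abbreviation "mapA \<equiv> mpoly_map A V.gsec r"

lemma mapA_hom: "class_hom (mpoly_ring A r) mapA"
  by (rule class_hom.mpoly_ring_class_hom[OF V.gsec_class_hom V.gsec_range])

text \<open>\<open>flat\<close> forgets fibre variables from \<open>r\<close> on and base variables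
  from \<open>m\<close> on; \<open>mapA\<close> discards the former and \<open>gsec\<close> sends
  the latter to 0.\<close>

lemma mapA_flat: "mapA (nest (flat q)) = mapA q"
proof -
  interpret M: class_hom "mpoly_ring A r" mapA by (rule mapA_hom)
  show ?thesis
  proof (induct q rule: mp_induct)
    case (const p)
    show ?case
      using V.gsec_ret[of p] by (auto simp: nest_below mpoly_map_def lookup_mconst fun_eq_iff simp del: spec_simps)
  next
    case (var j)
    show ?case
    proof (cases "j < r")
      case True
      then show ?thesis by simp
    next
      case False
      have "mapA (mvar j) = mapA 0"
        using False by (auto simp: mpoly_map_def mvar_def lookup_single when_def fun_eq_iff)
      with False show ?thesis by (simp add: nest_simps)
    qed
  qed (simp_all add: flat_simps nest_simps M.h_add M.h_mult)
qed

lemma eval_mapA: "mpoly_eval A B base_map (\<lambda>j. Y.gsec (mvar (m + j))) (mapA q) = Y.gsec (flat q)"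
  unfolding flat_def
proof (rule class_hom.mpoly_eval_map[OF V.gsec_class_hom Y.gsec_class_hom])
  show "base_map (V.gsec P) = Y.gsec (ret m P)" for P by (rule base_map_gsec)
  show "comm_ring_hom (ret m :: 'k mp \<Rightarrow> 'k mp)" by (rule ret_hom)
qed simp_all

definition fA :: "nat \<Rightarrow> monom \<Rightarrow> 'k kpoly set spec_section" where
  "fA i = mapA (nest (F i))"

lemma eval_surj:
  "mpoly_eval A B base_map (\<lambda>j. Y.gsec (mvar (m + j))) ` carrier (mpoly_ring A r) = carrier B"
proof (intro equalityI subsetI)
  fix y assume "y \<in> mpoly_eval A B base_map (\<lambda>j. Y.gsec (mvar (m + j))) ` carrier (mpoly_ring A r)"
  then obtain p where "p \<in> carrier (mpoly_ring A r)" "y = mpoly_eval A B base_map (\<lambda>j. Y.gsec (mvar (m + j))) p"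
    by blast
  then obtain q where "y = Y.gsec (flat q)"
    using class_hom.mpoly_map_surj[OF V.gsec_class_hom V.gsec_range] eval_mapA by metis
  then show "y \<in> carrier B" using class_hom.h_closed[OF Y.gsec_class_hom] by simp
next
  fix y assume "y \<in> carrier B"
  then obtain P where "y = Y.gsec P" using Y.gsec_range by blast
  then have "y = mpoly_eval A B base_map (\<lambda>j. Y.gsec (mvar (m + j))) (mapA (nest P))"
    by (simp add: eval_mapA flat_nest Y.gsec_ret)
  then show "y \<in> mpoly_eval A B base_map (\<lambda>j. Y.gsec (mvar (m + j))) ` carrier (mpoly_ring A r)"
    using class_hom.mpoly_map_closed[OF V.gsec_class_hom] by blast
qed

lemma eval_fA: "i < r \<Longrightarrow> mpoly_eval A B base_map (\<lambda>j. Y.gsec (mvar (m + j))) (fA i) = \<zero>\<^bsub>B\<^esub>"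
  unfolding fA_def eval_mapA flat_nest Y.gsec_ret Y.gsec_zero
  by (simp add: vanishing_def Y_def tower_points_def F_def r_def)

text \<open>A polynomial in the kernel flattens to one vanishing on \<open>Y\<close>, which is a
  combination of base relations and tower equations by \<open>vanishing_idl\<close>. The base
  relations are already 0 over the ring \<open>A\<close>.\<close>

lemma eval_kernel:
  "{p \<in> carrier (mpoly_ring A r). mpoly_eval A B base_map (\<lambda>j. Y.gsec (mvar (m + j))) p = \<zero>\<^bsub>B\<^esub>} =
    genideal (mpoly_ring A r) (fA ` {..<r})"
    (is "?K = ?I")
proof
  interpret M: class_hom "mpoly_ring A r" mapA by (rule mapA_hom)
  interpret B: class_hom B Y.gsec by (rule Y.gsec_class_hom)
  have fc: "fA i \<in> carrier (mpoly_ring A r)" for i by (simp add: fA_def)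
  have ex: "\<exists>q. p = mapA q" if "p \<in> carrier (mpoly_ring A r)" for p
    using class_hom.mpoly_map_surj[OF V.gsec_class_hom V.gsec_range that] by blast
  have kerE: "\<exists>p. a = mapA p \<and> Y.gsec (flat p) = \<zero>\<^bsub>B\<^esub>" if a: "a \<in> ?K" for a
  proof -
    from a have "a \<in> carrier (mpoly_ring A r)" by blast
    then obtain p where p: "a = mapA p" using ex by blast
    have "Y.gsec (flat p) = \<zero>\<^bsub>B\<^esub>" using a unfolding p mem_Collect_eq eval_mapA by (rule conjunct2)
    with p show ?thesis by blast
  qed
  have kerI: "mapA p \<in> ?K" if "Y.gsec (flat p) = \<zero>\<^bsub>B\<^esub>" for p
    unfolding mem_Collect_eq eval_mapA using M.h_closed that by blast
  have "ideal ?K (mpoly_ring A r)"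
  proof (rule M.ideal_cringI)
    show "\<zero>\<^bsub>mpoly_ring A r\<^esub> \<in> ?K"
      using eval_mapA[of 0] by (simp add: M.h_zero[symmetric] flat_simps B.h_zero)
    fix a b assume "a \<in> ?K" "b \<in> ?K"
    from kerE[OF this(1)] kerE[OF this(2)]
    obtain p q where pq: "a = mapA p" "b = mapA q" "Y.gsec (flat p) = \<zero>\<^bsub>B\<^esub>" "Y.gsec (flat q) = \<zero>\<^bsub>B\<^esub>"
      by blast
    have "Y.gsec (flat (p + q)) = \<zero>\<^bsub>B\<^esub>" by (simp only: flat_simps B.h_add pq B.l_zero B.zero_closed)
    then show "a \<oplus>\<^bsub>mpoly_ring A r\<^esub> b \<in> ?K"
      unfolding pq M.h_add[symmetric] by (rule kerI)
  next
    fix a x assume "a \<in> ?K" and x: "x \<in> carrier (mpoly_ring A r)"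
    from kerE[OF this(1)] obtain p where p: "a = mapA p" "Y.gsec (flat p) = \<zero>\<^bsub>B\<^esub>" by blast
    obtain q where q: "x = mapA q" using ex[OF x] by blast
    have "Y.gsec (flat (q * p)) = \<zero>\<^bsub>B\<^esub>" by (simp only: flat_simps B.h_mult p B.r_null B.h_closed)
    then show "x \<otimes>\<^bsub>mpoly_ring A r\<^esub> a \<in> ?K"
      unfolding p(1) q M.h_mult[symmetric] by (rule kerI)
  qed auto
  then show "?I \<subseteq> ?K"
    by (rule M.genideal_minimal) (use eval_fA fc in auto)
  have I: "ideal ?I (mpoly_ring A r)" by (rule M.genideal_ideal) (use fc in auto)
  interpret I: ideal ?I "mpoly_ring A r" by (rule I)
  have fI: "fA i \<in> ?I" if "i < r" for i
    using M.genideal_self[of "fA ` {..<r}"] fc that by auto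
  have idl: "mapA (nest P) \<in> ?I" if "P \<in> idl (tower_gens m Z fs r)" for P
    using that
  proof (induct rule: idl.induct)
    case idl_0
    show ?case
      using additive_subgroup.zero_closed[OF I.is_additive_subgroup] by (simp only: nest_simps M.h_zero)
  next
    case (idl_add_mult x b g)
    have "mapA (nest b) \<in> ?I"
    proof -
      from idl_add_mult(3) consider "b \<in> below m" "\<forall>z\<in>Z. acv z b = 0" | i where "i < r" "b = F i"
        by (auto simp: tower_gens_def F_def)
      then show ?thesis
      proof cases
        case 1
        then have "V.gsec b = \<zero>\<^bsub>A\<^esub>" unfolding V.gsec_zero by (simp add: vanishing_def)
        then have "mapA (nest b) = mapA 0"
          unfolding nest_below[OF 1(1)]
          by (auto simp: mpoly_map_def lookup_mconst fun_eq_iff class_hom.h_zero[OF V.gsec_class_hom] simp del: spec_simps)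
        then show ?thesis
          using additive_subgroup.zero_closed[OF I.is_additive_subgroup] by (simp only: M.h_zero)
      next
        case 2
        then show ?thesis using fI by (simp add: fA_def)
      qed
    qed
    then show ?case
      unfolding nest_simps M.h_add M.h_mult by (intro I.a_closed idl_add_mult I.I_l_closed M.h_closed)
  qed
  show "?K \<subseteq> ?I"
  proof
    fix p assume p: "p \<in> ?K"
    from kerE[OF this] obtain q where q: "p = mapA q" and "Y.gsec (flat q) = \<zero>\<^bsub>B\<^esub>" by blast
    then have "flat q \<in> vanishing Y" by (simp only: Y.gsec_zero)
    from idl[OF vanishing_idl[OF flat_below this]] show "p \<in> ?I" by (simp only: q mapA_flat)
  qed
qed

lemma eval_pderiv:
  assumes "i < r" "j < r"
  shows "mpoly_eval A B base_map (\<lambda>j. Y.gsec (mvar (m + j))) (mpoly_pderiv A j (fA i)) = Y.gsec (mderiv (m + j) (F i))"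
  unfolding fA_def class_hom.mpoly_map_pderiv[OF V.gsec_class_hom assms(2)] eval_mapA mderiv_nest flat_nest Y.gsec_ret ..

text \<open>Equation \<open>i\<close> involves no variable beyond \<open>m + i\<close>, so the
  determinant is the product of the derivatives on the diagonal.\<close>

lemma jacobian_invertible:
  "invertible_matrix B r (\<lambda>i j. mpoly_eval A B base_map (\<lambda>j. Y.gsec (mvar (m + j))) (mpoly_pderiv A j (fA i)))"
proof -
  interpret B: class_hom B Y.gsec by (rule Y.gsec_class_hom)
  define M where "M = mat r r (\<lambda>(i, j). mderiv (m + j) (F i))"
  have M: "M \<in> carrier_mat r r" by (simp add: M_def)
  have diag: "mderiv (m + i) (F i) = emb (m + i) (pderiv (fs ! i))" for i
    unfolding F_def emb_def
    by (subst mderiv_poly_mvar) (simp_all add: coeff_map_poly ret_simps map_poly_simps[OF ret_hom])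
  have "M $$ (i, j) = 0" if "i < j" "j < r" for i j
    using that mderiv_below[OF emb_below, of "m + i" "m + j"] by (simp add: M_def F_def)
  then have "det M = prod_list (diag_mat M)" by (rule det_lower_triangular[OF _ M])
  also have "\<dots> = (\<Prod>i<r. emb (m + i) (pderiv (fs ! i)))"
    by (simp add: prod_list_diag_prod M_def diag atLeast0LessThan)
  finally have det: "det M = (\<Prod>i<r. emb (m + i) (pderiv (fs ! i)))" .
  \<comment> \<open>The leading coefficients in \<open>tower_unit\<close> are shifted to the side of
    \<open>w\<close>; what remains is an inverse of the determinant.\<close>
  define v where "v = w * (\<Prod>i<r. ret (m + i) (lead_coeff (fs ! i)))"
  have "v * det M = w * tower_unit m fs r" by (simp add: v_def det tower_unit_def prod.distrib)
  then have "v * det M - 1 \<in> vanishing Y" using gens_vanishing unit by (simp add: r_def)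
  then have vd: "Y.gsec (v * det M) = \<one>\<^bsub>B\<^esub>" unfolding B.h_one[symmetric] by (rule Y.gsec_eq)
  have adj: "(\<Sum>k<r. M $$ (i, k) * adj_mat M $$ (k, j)) = (if i = j then det M else 0)"
    "(\<Sum>k<r. adj_mat M $$ (i, k) * M $$ (k, j)) = (if i = j then det M else 0)" if "i < r" "j < r" for i j
  proof -
    have *: "(\<Sum>k<r. S $$ (i, k) * T $$ (k, j)) = (S * T) $$ (i, j)"
      if "S \<in> carrier_mat r r" "T \<in> carrier_mat r r" for S T :: "'k mp mat"
      using that \<open>i < r\<close> \<open>j < r\<close> by (simp add: scalar_prod_def atLeast0LessThan)
    show "(\<Sum>k<r. M $$ (i, k) * adj_mat M $$ (k, j)) = (if i = j then det M else 0)"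
      "(\<Sum>k<r. adj_mat M $$ (i, k) * M $$ (k, j)) = (if i = j then det M else 0)"
      using *[OF M adj_mat(1)[OF M]] *[OF adj_mat(1)[OF M] M] adj_mat(2,3)[OF M] that by simp_all
  qed
  \<comment> \<open>The inverse by the adjugate formula.\<close>
  let ?N = "\<lambda>i j. Y.gsec (v * adj_mat M $$ (i, j))"
  have Mij: "mpoly_eval A B base_map (\<lambda>j. Y.gsec (mvar (m + j))) (mpoly_pderiv A j (fA i)) = Y.gsec (M $$ (i, j))"
    if "i < r" "j < r" for i j
    using eval_pderiv[OF that] that by (simp add: M_def)
  have one: "Y.gsec (v * (if i = j then det M else 0)) = (if i = j then \<one>\<^bsub>B\<^esub> else \<zero>\<^bsub>B\<^esub>)" for i j :: nat
    using vd by (simp only: B.h_zero mult_zero_right split: if_splits) simp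
  show ?thesis
    unfolding invertible_matrix_def
  proof (intro exI[of _ ?N] conjI allI impI)
    fix i j assume ij: "i < r" "j < r"
    show "?N i j \<in> carrier B" by (rule B.h_closed)
    have "(\<Oplus>\<^bsub>B\<^esub>k\<in>{..<r}. mpoly_eval A B base_map (\<lambda>j. Y.gsec (mvar (m + j))) (mpoly_pderiv A k (fA i)) \<otimes>\<^bsub>B\<^esub> ?N k j)
      = (\<Oplus>\<^bsub>B\<^esub>k\<in>{..<r}. Y.gsec (v * (M $$ (i, k) * adj_mat M $$ (k, j))))"
    proof (rule B.finsum_cong')
      fix k assume "k \<in> {..<r}"
      then show "mpoly_eval A B base_map (\<lambda>j. Y.gsec (mvar (m + j))) (mpoly_pderiv A k (fA i)) \<otimes>\<^bsub>B\<^esub> ?N k j =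
        Y.gsec (v * (M $$ (i, k) * adj_mat M $$ (k, j)))"
        using Mij[OF ij(1), of k] by (simp only: lessThan_iff B.h_mult[symmetric] mult.left_commute)
    qed (simp_all only: B.h_closed Pi_I)
    also have "\<dots> = Y.gsec (v * (\<Sum>k<r. M $$ (i, k) * adj_mat M $$ (k, j)))"
      by (simp only: B.h_sum[symmetric] sum_distrib_left)
    finally show "(\<Oplus>\<^bsub>B\<^esub>k\<in>{..<r}. mpoly_eval A B base_map (\<lambda>j. Y.gsec (mvar (m + j))) (mpoly_pderiv A k (fA i)) \<otimes>\<^bsub>B\<^esub> ?N k j)
      = (if i = j then \<one>\<^bsub>B\<^esub> else \<zero>\<^bsub>B\<^esub>)" by (simp only: adj(1)[OF ij] one)
    have "(\<Oplus>\<^bsub>B\<^esub>k\<in>{..<r}. ?N i k \<otimes>\<^bsub>B\<^esub> mpoly_eval A B base_map (\<lambda>j. Y.gsec (mvar (m + j))) (mpoly_pderiv A j (fA k)))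
      = (\<Oplus>\<^bsub>B\<^esub>k\<in>{..<r}. Y.gsec (v * (adj_mat M $$ (i, k) * M $$ (k, j))))"
    proof (rule B.finsum_cong')
      fix k assume "k \<in> {..<r}"
      then show "?N i k \<otimes>\<^bsub>B\<^esub> mpoly_eval A B base_map (\<lambda>j. Y.gsec (mvar (m + j))) (mpoly_pderiv A j (fA k)) =
        Y.gsec (v * (adj_mat M $$ (i, k) * M $$ (k, j)))"
        using Mij[OF _ ij(2), of k] by (simp only: lessThan_iff B.h_mult[symmetric] mult.assoc)
    qed (simp_all only: B.h_closed Pi_I)
    also have "\<dots> = Y.gsec (v * (\<Sum>k<r. adj_mat M $$ (i, k) * M $$ (k, j)))"
      by (simp only: B.h_sum[symmetric] sum_distrib_left)
    finally show "(\<Oplus>\<^bsub>B\<^esub>k\<in>{..<r}. ?N i k \<otimes>\<^bsub>B\<^esub> mpoly_eval A B base_map (\<lambda>j. Y.gsec (mvar (m + j))) (mpoly_pderiv A j (fA k)))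
      = (if i = j then \<one>\<^bsub>B\<^esub> else \<zero>\<^bsub>B\<^esub>)" by (simp only: adj(2)[OF ij] one)
  qed
qed

lemma tower_standard_smooth: "standard_smooth A B base_map 0"
  unfolding standard_smooth_def
proof (intro exI[of _ r] exI[of _ "\<lambda>j. Y.gsec (mvar (m + j))"] exI[of _ fA] conjI allI impI)
  show "Y.gsec (mvar (m + i)) \<in> carrier B" for i by (rule class_hom.h_closed[OF Y.gsec_class_hom])
  show "fA i \<in> carrier (mpoly_ring A (r + 0))" for i
    unfolding fA_def by (simp only: add_0_right class_hom.mpoly_map_closed[OF V.gsec_class_hom])
qed (simp_all only: add_0_right eval_surj eval_kernel jacobian_invertible)

lemma f_etale:
  "etale_morphism (closed_subscheme (m + r) (pideal (m + r) Y)) (closed_subscheme m (pideal m Z)) f pull"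
  unfolding etale_morphism_def
proof (intro conjI ballI f_kmorphism)
  let ?E = "closed_subscheme (m + r) (pideal (m + r) Y)" and ?V = "closed_subscheme m (pideal m Z)"
  fix x assume x: "x \<in> kpts ?E"
  have "f ` kpts ?E \<subseteq> kpts ?V" unfolding V.kpts_closed Y.kpts_closed using f_prime by auto
  moreover have "standard_smooth (sect ?V (kpts ?V)) (sect ?E (kpts ?E))
      (\<lambda>s. rstr ?E (preim ?E f (kpts ?V)) (kpts ?E) (pull (kpts ?V) s)) 0"
    unfolding V.kpts_closed Y.kpts_closed
    using tower_standard_smooth
    unfolding base_map_def[abs_def] V.closed_subscheme_eq Y.closed_subscheme_eq .
  ultimately show "\<exists>U W. affine_open ?E U \<and> affine_open ?V W \<and> x \<in> U \<and> f ` U \<subseteq> W \<and>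
      standard_smooth (sect ?V W) (sect ?E U) (\<lambda>s. rstr ?E (preim ?E f W) U (pull W s)) 0"
    using x V.affine_open_pideal Y.affine_open_pideal by blast
qed

text \<open>On rational points the morphism forgets the tower coordinates; this identifies its image
  with a projection.\<close>

lemma f_point:
  assumes a: "length a = m + r" "\<And>P. P \<in> vanishing Y \<Longrightarrow> ev (lenv a) P = 0"
  shows "f (point_ideal (m + r) (pideal (m + r) Y) a) = point_ideal m (pideal m Z) (take m a)"
proof -
  have tr: "trunc m (lenv a) = lenv (take m a)" using a(1) by (auto simp: trunc_def lenv_def)
  have len: "length (take m a) = m" using a(1) by simp
  have mem: "hom (pcls m Z P) \<in> point_ideal (m + r) (pideal (m + r) Y) a \<longleftrightarrow> ev (lenv (take m a)) P = 0" for P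
    by (simp add: hom_pcls Y.mem_point_ideal[OF a] mval_ret[OF comm_ring_hom_id] tr)
  show ?thesis
    unfolding f_def spec_pt_def V.point_ideal_eq[OF len]
  proof (intro equalityI subsetI)
    fix x assume x: "x \<in> {x \<in> carrier (pring m Z). hom x \<in> point_ideal (m + r) (pideal (m + r) Y) a}"
    then have "x \<in> carrier (pring m Z)" by blast
    then obtain P where "x = pcls m Z P" by (rule V.pcls_surj)
    with x mem show "x \<in> {pcls m Z P | P. ev (lenv (take m a)) P = 0}" by blast
  next
    fix x assume "x \<in> {pcls m Z P | P. ev (lenv (take m a)) P = 0}"
    then obtain P where "x = pcls m Z P" "ev (lenv (take m a)) P = 0" by blast
    with mem show "x \<in> {x \<in> carrier (pring m Z). hom x \<in> point_ideal (m + r) (pideal (m + r) Y) a}"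
      using V.R.h_closed by blast
  qed
qed

theorem tower_etale_image:
  "etale_image (closed_subscheme m (pideal m Z)) (point_ideal m (pideal m Z) `
    (take m ` {a. length a = m + r \<and> (\<forall>P\<in>vanishing Y. ev (lenv a) P = 0)}))"
proof -
  have img: "f ` kpoints (closed_subscheme (m + r) (pideal (m + r) Y)) = point_ideal m (pideal m Z) `
    (take m ` {a. length a = m + r \<and> (\<forall>P\<in>vanishing Y. ev (lenv a) P = 0)})"
    unfolding Y.kpoints_pideal affine_points_def mem_Collect_eq image_image
  proof (rule image_cong[OF refl])
    fix a assume "a \<in> {a. length a = m + r \<and> (\<forall>P\<in>vanishing Y. ev (lenv a) P = 0)}"
    then have "length a = m + r" "\<And>P. P \<in> vanishing Y \<Longrightarrow> ev (lenv a) P = 0" by simp_all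
    then show "f (point_ideal (m + r) (pideal (m + r) Y) a) = point_ideal m (pideal m Z) (take m a)"
      by (rule f_point)
  qed
  show ?thesis
    unfolding etale_image_def by (intro exI conjI, rule Y.kvariety_pideal, rule f_etale, rule img[symmetric])
qed

end

section \<open>Images of towers are etale open\<close>

lemma otower_iff:
  "otower k \<tau> e \<longleftrightarrow> (\<forall>i<length \<tau>. \<forall>f. \<tau> ! i = Some f \<longrightarrow> simple_root (\<lambda>x. x) (k + i) f e)"
proof (induct \<tau> arbitrary: k)
  case (Cons a \<tau>)
  show ?case
    by (cases a) (auto simp: Cons All_less_Suc2)
qed simp

lemma emb_linear: "emb k [:a, b:] = ret k a + mvar k * ret k (b :: 'k::field mp)"
  by (simp add: emb_def map_poly_simps[OF ret_hom])

lemma emb_const: "emb k [:a:] = ret k (a :: 'k::field mp)"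
  by (simp add: emb_def map_poly_simps[OF ret_hom])

text \<open>Only rational zeros of \<open>C\<close> are taken. The base variety is thus the Zariski
  closure of these zeros, and its rational points are still zeros of \<open>C\<close>.\<close>

definition base_points :: "nat \<Rightarrow> 'k::field mp list \<Rightarrow> (nat \<Rightarrow> 'k alg_closure) set" where
  "base_points m C = {lift_env (lenv a) | a. length a = m \<and> (\<forall>c\<in>set C. ev (lenv a) c = 0)}"

lemma lenv_trunc: "length a \<le> n \<Longrightarrow> trunc n (lenv a) = lenv a"
  by (auto simp: trunc_def lenv_def fun_eq_iff)

lemma trunc_lift: "trunc n (lift_env e) = lift_env (trunc n e)"
  by (auto simp: trunc_def lift_env_def fun_eq_iff)

lemma base_points_ring: "point_ring m (base_points m (C :: 'k::field mp list))"
  by unfold_locales (auto simp: base_points_def trunc_lift lenv_trunc)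

lemma tower_unit_below: "tower_unit m fs r \<in> below (m + r)"
  unfolding tower_unit_def
proof (induct r)
  case (Suc r)
  have "ret (m + r) (lead_coeff (fs ! r)) * emb (m + r) (pderiv (fs ! r)) \<in> below (m + Suc r)"
    using emb_below[of "m + r" "pderiv (fs ! r)"] below_mono[OF _ ret_below, of "m + r" "m + Suc r"]
    by (intro below_mult) simp_all
  moreover have "(\<Prod>i<r. ret (m + i) (lead_coeff (fs ! i)) * emb (m + i) (pderiv (fs ! i))) \<in> below (m + Suc r)"
    by (rule below_mono[OF _ Suc]) simp
  ultimately show ?case by (simp add: below_mult)
qed simp

lemma tower_unit_append:
  "r \<le> length fs \<Longrightarrow> tower_unit m (fs @ gs) r = tower_unit m fs r"
  unfolding tower_unit_def by (rule prod.cong) (auto simp: nth_append)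

text \<open>Around each of its points a basic set contains the image of a tower: free variables are frozen
  at their value and the inequation is encoded by one more linear equation.\<close>

lemma basic_etale_image:
  fixes m :: nat and C :: "'k::field mp list" and \<tau> :: "'k mp poly option list" and q :: "'k mp" and a0 :: "'k list"
  defines "Z \<equiv> base_points m C" and "T \<equiv> {a \<in> affine_points m. fiber m (basic m C \<tau> q) (lenv a)}"
  assumes a0: "a0 \<in> T"
  obtains U where "a0 \<in> U" "U \<subseteq> T" "etale_image (closed_subscheme m (pideal m Z)) (point_ideal m (pideal m Z) ` U)"
proof -
  define l where "l = length \<tau>"
  define n where "n = m + l"
  obtain e where e: "trunc m e = trunc m (lenv a0)" "basic m C \<tau> q e" and la0: "length a0 = m"
    using a0 by (auto simp: T_def fiber_def affine_points_def)
  define fs where "fs = map (\<lambda>i. case \<tau> ! i of None \<Rightarrow> [:- mconst (e (m + i)), 1:] | Some f \<Rightarrow> f) [0..<l]"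
  have lfs: "length fs = l" by (simp add: fs_def)
  \<comment> \<open>The Rabinowitsch trick: a new variable \<open>t\<close> with
    \<open>H * t = 1\<close> makes both the inequation and the simplicity of all roots part of the
    equations.\<close>
  define H where "H = ret n q * tower_unit m fs l"
  have Hb: "H \<in> below n" unfolding H_def n_def by (intro below_mult tower_unit_below) simp
  define gs where "gs = fs @ [[:- 1, H:]]"
  have lgs: "length gs = Suc l" by (simp add: gs_def lfs)
  have gs_l: "gs ! l = [:- 1, H:]" by (simp add: gs_def lfs nth_append)
  have gs_i: "gs ! i = fs ! i" if "i < l" for i using that by (simp add: gs_def lfs nth_append)
  have emb_l: "emb n [:- 1, H:] = H * mvar n - 1"
    by (simp add: emb_linear ret_id[OF Hb] ret_simps)
  \<comment> \<open>The equation \<open>H * t - 1\<close> has leading coefficient \<open>H\<close>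
    and derivative \<open>H\<close>, whence the factor \<open>H * H\<close>. If \<open>H\<close> is
    0 it degenerates to a constant, but then its derivative and hence both sides vanish.\<close>
  have unit_gs: "tower_unit m gs (Suc l) = tower_unit m fs l * (H * H)"
  proof (cases "H = 0")
    case True
    have "tower_unit m gs (Suc l) = tower_unit m gs l * (ret n (lead_coeff [:- 1, H:]) * emb n (pderiv [:- 1, H:]))"
      by (simp add: tower_unit_def gs_l n_def)
    also have "emb n (pderiv [:- 1, H:]) = 0" using True by (simp add: emb_def)
    finally show ?thesis using True by simp
  next
    case False
    have "tower_unit m gs (Suc l) = tower_unit m gs l * (ret n (lead_coeff [:- 1, H:]) * emb n (pderiv [:- 1, H:]))"
      by (simp add: tower_unit_def gs_l n_def)
    also have "tower_unit m gs l = tower_unit m fs l" by (simp add: gs_def tower_unit_append lfs)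
    also have "lead_coeff [:- 1, H:] = H" using False by simp
    also have "pderiv [:- 1, H:] = [:H:]" by (simp add: pderiv_pCons)
    finally show ?thesis by (simp add: emb_const ret_id[OF Hb])
  qed
  \<comment> \<open>With \<open>u\<close> the unit of \<open>fs\<close>, the relation
    \<open>q * u = H\<close> gives \<open>w * u * H^2 = (H * t)^3\<close>, which is 1 modulo the
    last equation; hence the exponent 3.\<close>
  define w where "w = ret n q * mvar n ^ 3"
  interpret V: point_ring m Z unfolding Z_def by (rule base_points_ring)
  have et: "etale_tower m Z gs w"
  proof
    have "1 * emb n [:- 1, H:] \<in> idl (tower_gens m Z gs (Suc l))"
      by (rule idl_gen) (auto simp: tower_gens_def n_def gs_l intro!: image_eqI[of _ _ l])
    then have "H * mvar n - 1 \<in> idl (tower_gens m Z gs (Suc l))" by (simp add: emb_l)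
    from power_minus_one_idl[OF this, of 3]
    show "w * tower_unit m gs (length gs) - 1 \<in> idl (tower_gens m Z gs (length gs))"
      unfolding lgs unit_gs w_def by (simp add: H_def power3_eq_cube mult_ac)
  qed
  interpret E: etale_tower m Z gs w by (rule et)
  have rE: "E.r = Suc l" by (simp add: E.r_def lgs)
  define U where "U = take m ` {a. length a = m + Suc l \<and> (\<forall>P\<in>vanishing E.Y. ev (lenv a) P = 0)}"
  have img: "etale_image (closed_subscheme m (pideal m Z)) (point_ideal m (pideal m Z) ` U)"
    using E.tower_etale_image by (simp add: U_def rE)
  have unit_val: "ev x (tower_unit m fs l) \<noteq> 0 \<longleftrightarrow>
      (\<forall>i<l. ev x (ret (m + i) (lead_coeff (fs ! i))) \<noteq> 0 \<and> ev x (emb (m + i) (pderiv (fs ! i))) \<noteq> 0)" for x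
    by (auto simp: tower_unit_def ev_simps)
  have "a0 \<in> U"
  proof -
    have ot: "otower m \<tau> e" and q: "ev (trunc n e) q \<noteq> 0" and Cz: "\<And>c. c \<in> set C \<Longrightarrow> ev (trunc m e) c = 0"
      using e(2) by (auto simp: basic_def n_def l_def)
    have root: "simple_root (\<lambda>x. x) (m + i) (fs ! i) e" if i: "i < l" for i
    proof (cases "\<tau> ! i")
      case None
      then have "fs ! i = [:- mconst (e (m + i)), 1:]" using i by (simp add: fs_def)
      then show ?thesis
        by (simp add: simple_root_iff[OF comm_ring_hom_id] emb_linear emb_const pderiv_pCons ev_simps ret_simps)
    next
      case (Some f)
      then have "fs ! i = f" using i by (simp add: fs_def)
      then show ?thesis using ot Some i by (auto simp: otower_iff l_def)
    qed
    have uv: "ev e (tower_unit m fs l) \<noteq> 0"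
      unfolding unit_val using root by (simp add: simple_root_iff[OF comm_ring_hom_id])
    have eH: "ev e H \<noteq> 0" using uv q by (simp add: H_def ev_simps mval_ret[OF comm_ring_hom_id])
    \<comment> \<open>The given witness, extended by the inverse of \<open>H\<close> as value of the
      new variable.\<close>
    define e1 where "e1 = (trunc n e)(n := inverse (ev e H))"
    have tr: "trunc k e1 = trunc k e" if "k \<le> n" for k
      using that by (auto simp: e1_def trunc_def fun_eq_iff)
    have ev1: "ev e1 P = ev e P" if "P \<in> below n" for P
      using mval_trunc_below[OF comm_ring_hom_id that, of e1] mval_trunc_below[OF comm_ring_hom_id that, of e] tr[of n] by simp
    define a where "a = map e1 [0..<m + Suc l]"
    have la: "lenv a = e1"
      by (auto simp: lenv_def a_def e1_def trunc_def n_def fun_eq_iff nth_append)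
    have "lift_env e1 \<in> E.Y"
      unfolding E.Y_def tower_points_def
    proof (intro CollectI conjI allI impI)
      show "trunc (m + length gs) (lift_env e1) = lift_env e1"
        unfolding trunc_lift lgs by (auto simp: lift_env_def e1_def trunc_def n_def fun_eq_iff)
      have "trunc m (lift_env e1) = lift_env (lenv a0)"
        using e(1) tr[of m] by (simp add: trunc_lift n_def lenv_trunc la0)
      moreover have "ev (lenv a0) c = 0" if "c \<in> set C" for c
        using Cz[OF that] e(1) by (simp add: lenv_trunc la0)
      ultimately show "trunc m (lift_env e1) \<in> Z"
        unfolding Z_def base_points_def using la0 by auto
      fix i assume "i < length gs"
      then consider "i < l" | "i = l" using lgs by linarith
      then show "acv (lift_env e1) (emb (m + i) (gs ! i)) = 0"
      proof cases
        case 1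
        have "emb (m + i) (fs ! i) \<in> below n"
          by (rule below_mono[OF _ emb_below]) (use 1 in \<open>simp add: n_def\<close>)
        then have "ev e1 (emb (m + i) (fs ! i)) = 0"
          using root[OF 1] by (simp add: ev1 simple_root_iff[OF comm_ring_hom_id])
        then show ?thesis by (simp add: acv_lift gs_i[OF 1])
      next
        case 2
        have "ev e1 (emb n [:- 1, H:]) = 0"
          unfolding emb_l using eH by (simp add: ev_simps ev1[OF Hb]) (simp add: e1_def)
        then show ?thesis by (simp add: acv_lift 2 gs_l n_def)
      qed
    qed
    then have "to_ac (ev e1 P) = 0" if "P \<in> vanishing E.Y" for P
      using that unfolding vanishing_def acv_lift[symmetric] by blast
    then have "\<forall>P\<in>vanishing E.Y. ev (lenv a) P = 0" unfolding la by simp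
    moreover have "take m a = a0"
    proof (rule nth_equalityI)
      show "length (take m a) = length a0" by (simp add: a_def la0)
      fix i assume "i < length (take m a)"
      then have "i < m" by (simp add: a_def)
      then have "e i = a0 ! i" using e(1) la0 by (auto simp: trunc_Suc_eq lenv_def)
      then show "take m a ! i = a0 ! i" using \<open>i < m\<close> by (simp add: a_def e1_def trunc_def n_def)
    qed
    ultimately show ?thesis unfolding U_def by (intro image_eqI[of _ _ a]) (simp_all add: a_def)
  qed
  moreover have "U \<subseteq> T"
  proof
    fix b assume "b \<in> U"
    then obtain a where a: "length a = m + Suc l" "\<And>P. P \<in> vanishing E.Y \<Longrightarrow> ev (lenv a) P = 0" and b: "b = take m a"
      unfolding U_def by auto
    have Fz: "ev (lenv a) (emb (m + i) (gs ! i)) = 0" if "i < Suc l" for i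
      using that by (intro a(2)) (simp add: vanishing_def E.Y_def tower_points_def lgs)
    \<comment> \<open>Conversely, the last equation forces \<open>H\<close> to be nonzero, which
      returns the inequation and the simplicity of the roots.\<close>
    have "ev (lenv a) (H * mvar n - 1) = 0"
      using Fz[of l] by (simp add: gs_l emb_l flip: n_def)
    then have "ev (lenv a) H \<noteq> 0" by (auto simp: ev_simps)
    then have q: "ev (trunc n (lenv a)) q \<noteq> 0" and u: "ev (lenv a) (tower_unit m fs l) \<noteq> 0"
      by (auto simp: H_def ev_simps mval_ret[OF comm_ring_hom_id])
    have root: "simple_root (\<lambda>x. x) (m + i) (fs ! i) (lenv a)" if "i < l" for i
      using u[unfolded unit_val] that Fz[of i] by (simp add: simple_root_iff[OF comm_ring_hom_id] gs_i)
    have "otower m \<tau> (lenv a)"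
      unfolding otower_iff
    proof (intro allI impI)
      fix i f assume "i < length \<tau>" "\<tau> ! i = Some f"
      then show "simple_root (\<lambda>x. x) (m + i) f (lenv a)" using root[of i] by (simp add: fs_def l_def)
    qed
    moreover have "ev (trunc m (lenv a)) c = 0" if c: "c \<in> set C" for c
    proof -
      have "acv z c = 0" if "z \<in> Z" for z using that c by (auto simp: Z_def base_points_def acv_lift)
      then have "ret m c \<in> vanishing E.Y"
        by (simp add: vanishing_def mval_ret[OF to_ac_hom] E.Y_def tower_points_def)
      from a(2)[OF this] show ?thesis by (simp add: mval_ret[OF comm_ring_hom_id])
    qed
    ultimately have "basic m C \<tau> q (lenv a)" using q by (simp add: basic_def n_def l_def)
    moreover have "trunc m (lenv a) = trunc m (lenv b)"
      using a(1) by (auto simp: b trunc_def lenv_def fun_eq_iff)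
    ultimately show "b \<in> T"
      using a(1) by (auto simp: T_def fiber_def affine_points_def b)
  qed
  ultimately show thesis using img by (rule that)
qed

text \<open>Freezing the free coordinates depends on a witness above the chosen point, so a basic
  set is exhibited only as a union of etale images, one around each of its points.\<close>

lemma basic_etale_open:
  fixes C :: "'k::field mp list"
  shows "etale_open_in m (pideal m (base_points m C)) {a \<in> affine_points m. fiber m (basic m C \<tau> q) (lenv a)}"
proof -
  define Z where "Z = base_points m C"
  define T where "T = {a \<in> affine_points m. fiber m (basic m C \<tau> q) (lenv a)}"
  interpret V: point_ring m Z unfolding Z_def by (rule base_points_ring)
  have "T \<subseteq> zero_locus m (pideal m Z)"
  proof
    fix a assume "a \<in> T"
    then obtain e where la: "length a = m" and e: "trunc m e = trunc m (lenv a)" "basic m C \<tau> q e"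
      by (auto simp: T_def fiber_def affine_points_def)
    then have "ev (lenv a) c = 0" if "c \<in> set C" for c
      using that by (simp add: basic_def lenv_trunc)
    then have "lift_env (lenv a) \<in> Z" using la by (auto simp: Z_def base_points_def)
    then have "ev (lenv a) P = 0" if "P \<in> vanishing Z" for P
      using that acv_lift[of "lenv a" P] by (auto simp: vanishing_def)
    then show "a \<in> zero_locus m (pideal m Z)"
      using la V.ev_to_kpoly[OF la] by (auto simp: zero_locus_def affine_points_def pideal_def)
  qed
  moreover have "etale_open (closed_subscheme m (pideal m Z)) (point_ideal m (pideal m Z) ` T)"
    unfolding etale_open_def union_of_def
  proof (intro exI conjI)
    let ?\<U> = "{point_ideal m (pideal m Z) ` U | U. U \<subseteq> T \<and>
      etale_image (closed_subscheme m (pideal m Z)) (point_ideal m (pideal m Z) ` U)}"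
    show "arbitrary ?\<U>" by (simp add: arbitrary_def)
    show "?\<U> \<subseteq> Collect (etale_image (closed_subscheme m (pideal m Z)))" by auto
    show "\<Union>?\<U> = point_ideal m (pideal m Z) ` T"
    proof (intro equalityI subsetI)
      fix x assume "x \<in> point_ideal m (pideal m Z) ` T"
      then obtain a where a: "a \<in> T" "x = point_ideal m (pideal m Z) a" by blast
      from a(1) obtain U where "a \<in> U" "U \<subseteq> T"
        "etale_image (closed_subscheme m (pideal m Z)) (point_ideal m (pideal m Z) ` U)"
        unfolding T_def Z_def by (rule basic_etale_image)
      with a(2) show "x \<in> \<Union>?\<U>" by blast
    qed auto
  qed
  ultimately show ?thesis unfolding etale_open_in_def T_def Z_def by blast
qed

theorem existentially_definable_ez:
  fixes S :: "'k::field list set"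
  assumes "perfect_field TYPE('k)" "existentially_definable m S"
  shows "ez_set m S"
proof -
  obtain B where B: "finite B" "S = (\<Union>(C, \<tau>, q)\<in>B. {a \<in> affine_points m. fiber m (basic m C \<tau> q) (lenv a)})"
    using existentially_definable_basic[OF assms] .
  let ?T = "(\<lambda>(C, \<tau>, q). {a \<in> affine_points m. fiber m (basic m C \<tau> q) (lenv a)}) ` B"
  have "definable m T \<and> (\<exists>J. radical_ideal J (kpoly_ring m) \<and> etale_open_in m J T)" if "T \<in> ?T" for T
  proof -
    from that obtain C \<tau> q where T: "T = {a \<in> affine_points m. fiber m (basic m C \<tau> q) (lenv a)}" by auto
    show ?thesis
      unfolding T
      by (intro conjI exI definable_basic, rule point_ring.pideal_radical[OF base_points_ring], rule basic_etale_open)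
  qed
  moreover have "finite ?T" "S = \<Union>?T" using B by auto
  ultimately show ?thesis unfolding ez_set_def by blast
qed

section \<open>The affine line\<close>

text \<open>In one variable the coefficients lie in \<open>below 0\<close>, hence are constants, and
  \<open>p\<close> is an ordinary nonzero univariate polynomial.\<close>

lemma finite_zero_locus_line:
  fixes p :: "'k::field kpoly"
  assumes p: "p \<in> carrier (kpoly_ring 1)" "p \<noteq> \<zero>\<^bsub>kpoly_ring 1\<^esub>"
  shows "finite {x. mpoly_eval cring_class_ops cring_class_ops id (nth [x]) p = 0}"
proof -
  interpret K: class_hom "kpoly_ring 1" "to_kpoly 1 :: 'k mp \<Rightarrow> _" by (rule kpoly_class_hom)
  obtain P where P: "P \<in> below 1" "p = to_kpoly 1 P" using kpoly_surj[OF p(1)] .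
  have "P \<noteq> 0" using p(2) unfolding P(2) by (metis K.h_zero)
  obtain g where g: "P = poly g (mvar 0)" "\<And>j. coeff g j \<in> below 0"
    using below_Suc_poly[of P 0] P(1) by auto
  have const: "c = mconst (ev (\<lambda>_. 0) c)" if "c \<in> below 0" for c :: "'k mp"
    using that
  proof (induct c rule: below_induct)
    case (add p q)
    have "ev (\<lambda>_. 0) (p + q) = ev (\<lambda>_. 0) p + ev (\<lambda>_. 0) q" by (simp add: ev_simps)
    then show ?case using add by (metis mconst_simps(3))
  next
    case (mult p q)
    have "ev (\<lambda>_. 0) (p * q) = ev (\<lambda>_. 0) p * ev (\<lambda>_. 0) q" by (simp add: ev_simps)
    then show ?case using mult by (metis mconst_simps(4))
  qed (simp_all add: ev_simps)
  define g0 where "g0 = map_poly (ev (\<lambda>_. 0)) g"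
  have "g \<noteq> 0" using \<open>P \<noteq> 0\<close> g(1) by auto
  then have "lead_coeff g \<noteq> 0" by simp
  then have "ev (\<lambda>_. 0) (lead_coeff g) \<noteq> 0" using const[OF g(2)[of "degree g"]] by (metis mconst_01(1))
  then have g0: "g0 \<noteq> 0" by (metis coeff_0 g0_def map_poly_simps(9)[OF ev_hom])
  have "mpoly_eval cring_class_ops cring_class_ops id (nth [x]) p = poly g0 x" for x
  proof -
    \<comment> \<open>The empty point set only serves to reach \<open>ev_to_kpoly\<close>, whose
      statement does not mention the points.\<close>
    interpret point_ring 1 "{} :: (nat \<Rightarrow> 'k alg_closure) set" by unfold_locales simp
    have "mpoly_eval cring_class_ops cring_class_ops id (nth [x]) p = ev (lenv [x]) P"
      unfolding P(2) by (rule ev_to_kpoly) simp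
    also have "\<dots> = poly (map_poly (ev (lenv [x])) g) (ev (lenv [x]) (mvar 0))"
      unfolding g(1) by (rule map_poly_simps(12)[OF ev_hom, symmetric])
    also have "map_poly (ev (lenv [x])) g = g0"
      unfolding g0_def
    proof (rule map_poly_cong)
      fix c assume "c \<in> set (coeffs g)"
      then have "c \<in> below 0" using g(2) by (auto simp: coeffs_def split: if_splits)
      from const[OF this] show "ev (lenv [x]) c = ev (\<lambda>_. 0) c" by (metis mval_mconst)
    qed
    finally show ?thesis by (simp add: lenv_def id_def)
  qed
  then show ?thesis using poly_roots_finite[OF g0] by simp
qed

lemma etale_open_Union:
  assumes "\<And>T. T \<in> \<T> \<Longrightarrow> etale_open V T"
  shows "etale_open V (\<Union>\<T>)"
proof -
  have cover: "\<exists>I. etale_image V I \<and> x \<in> I \<and> I \<subseteq> T" if "T \<in> \<T>" "x \<in> T" for x T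
    using assms[OF that(1)] that(2) unfolding etale_open_def union_of_def by auto
  show ?thesis
    unfolding etale_open_def union_of_def
  proof (intro exI[of _ "{I. etale_image V I \<and> I \<subseteq> \<Union>\<T>}"] conjI equalityI subsetI)
    fix x assume "x \<in> \<Union>\<T>"
    then obtain T where T: "T \<in> \<T>" "x \<in> T" ..
    from cover[OF this] obtain I where "etale_image V I" "x \<in> I" "I \<subseteq> T" by auto
    then show "x \<in> \<Union>{I. etale_image V I \<and> I \<subseteq> \<Union>\<T>}" using T(1) by auto
  qed (auto simp: arbitrary_def)
qed

lemma definable_empty: "definable m ({} :: 'k::field list set)"
  unfolding definable_def
  by (rule exI[of _ "FEq (RPar 0) (RPar 1)"]) simp

lemma definable_Un:
  fixes S T :: "'k::field list set"
  assumes "definable m S" "definable m T"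
  shows "definable m (S \<union> T)"
proof -
  from assms obtain \<phi> \<psi> where "rform_free \<phi> \<subseteq> {..<m}" "rform_free \<psi> \<subseteq> {..<m}"
    "S = {a \<in> affine_points m. rform_sat (nth a) \<phi>}" "T = {a \<in> affine_points m. rform_sat (nth a) \<psi>}"
    unfolding definable_def by blast
  then show ?thesis
    unfolding definable_def by (intro exI[of _ "FNeg (FConj (FNeg \<phi>) (FNeg \<psi>))"]) auto
qed

lemma definable_Union:
  fixes \<T> :: "'k::field list set set"
  assumes "finite \<T>" "\<And>T. T \<in> \<T> \<Longrightarrow> definable m T"
  shows "definable m (\<Union>\<T>)"
  using assms by (induct \<T> rule: finite_induct) (auto intro: definable_Un definable_empty)

lemma ez_line:
  fixes S :: "'k::field set"
  assumes "ez_set 1 (singletons S)"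
  shows "\<exists>U F. S = U \<union> F \<and> definable 1 (singletons U) \<and> etale_open_line U \<and> finite F"
proof -
  obtain \<T> where T0: "finite \<T> \<and> singletons S = \<Union>\<T> \<and> (\<forall>T\<in>\<T>. definable 1 T \<and>
      (\<exists>J. radical_ideal J (kpoly_ring 1) \<and> etale_open_in 1 J T))"
    using assms unfolding ez_set_def ..
  have T: "finite \<T>" "singletons S = \<Union>\<T>" "\<And>T. T \<in> \<T> \<Longrightarrow> definable 1 T"
    "\<And>T. T \<in> \<T> \<Longrightarrow> \<exists>J. radical_ideal J (kpoly_ring 1) \<and> etale_open_in 1 J T"
    using T0 by simp_all
  let ?Z = "{\<zero>\<^bsub>kpoly_ring 1\<^esub>} :: 'k kpoly set"
  \<comment> \<open>Pieces are sorted by whether they are open for the zero ideal. A piece that is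
    not must be attached to an ideal with a nonzero element, whose zeros contain it.\<close>
  define \<O> where "\<O> = {T \<in> \<T>. etale_open_in 1 ?Z T}"
  define U where "U = {x. [x] \<in> \<Union>\<O>}"
  define F where "F = {x. [x] \<in> \<Union>(\<T> - \<O>)}"
  have sing: "\<exists>x. a = [x]" if "T \<in> \<T>" "a \<in> T" for a T
  proof -
    have "a \<in> singletons S" unfolding T(2) using that by blast
    then show ?thesis by blast
  qed
  have SU: "S = U \<union> F"
  proof -
    have "x \<in> S \<longleftrightarrow> [x] \<in> \<Union>\<T>" for x unfolding T(2)[symmetric] by auto
    then show ?thesis by (auto simp: U_def F_def \<O>_def)
  qed
  have U: "singletons U = \<Union>\<O>"
  proof (intro equalityI subsetI)
    fix a assume "a \<in> singletons U"
    then show "a \<in> \<Union>\<O>" by (auto simp: U_def)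
  next
    fix a assume a: "a \<in> \<Union>\<O>"
    then obtain T where "T \<in> \<T>" "a \<in> T" by (auto simp: \<O>_def)
    then obtain x where "a = [x]" using sing by blast
    then show "a \<in> singletons U" using a by (simp add: U_def)
  qed
  have fin: "finite {x. [x] \<in> T}" if TO: "T \<in> \<T> - \<O>" for T
  proof -
    have "T \<in> \<T>" using TO by simp
    from T(4)[OF this] obtain J where J: "radical_ideal J (kpoly_ring 1)" "etale_open_in 1 J T" by blast
    then have id: "ideal J (kpoly_ring 1)" by (simp add: radical_ideal_def)
    then have "\<zero>\<^bsub>kpoly_ring 1\<^esub> \<in> J" using additive_subgroup.zero_closed[OF ideal.axioms(1)] by blast
    moreover have "J \<noteq> ?Z" using J(2) TO by (auto simp: \<O>_def)
    ultimately obtain p where p: "p \<in> J" "p \<noteq> \<zero>\<^bsub>kpoly_ring 1\<^esub>" by blast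
    have pc: "p \<in> carrier (kpoly_ring 1)" using p(1) additive_subgroup.a_subset[OF ideal.axioms(1)[OF id]] by blast
    have "{x. [x] \<in> T} \<subseteq> {x. mpoly_eval cring_class_ops cring_class_ops id (nth [x]) p = 0}"
      using J(2) p(1) by (auto simp: etale_open_in_def zero_locus_def)
    then show ?thesis by (rule finite_subset[OF _ finite_zero_locus_line[OF pc p(2)]])
  qed
  have "F = (\<Union>T\<in>\<T> - \<O>. {x. [x] \<in> T})" by (auto simp: F_def)
  then have "finite F" using T(1) fin by auto
  moreover have "definable 1 (singletons U)"
    unfolding U by (rule definable_Union) (use T(1,3) in \<open>auto simp: \<O>_def\<close>)
  moreover have "etale_open_line U"
    unfolding etale_open_line_def etale_open_in_def U
  proof
    show "\<Union>\<O> \<subseteq> zero_locus 1 ?Z" by (auto simp: \<O>_def etale_open_in_def)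
    have "etale_open (closed_subscheme 1 ?Z) (\<Union>((`) (point_ideal 1 ?Z) ` \<O>))"
      by (rule etale_open_Union) (auto simp: \<O>_def etale_open_in_def)
    then show "etale_open (closed_subscheme 1 ?Z) (point_ideal 1 ?Z ` \<Union>\<O>)"
      by (simp add: image_Union)
  qed
  ultimately show ?thesis using SU by blast
qed

theorem theoremB:
  assumes "large_field TYPE('k::field)"
    and "perfect_field TYPE('k)"
  shows "(\<forall>m (S :: 'k list set). existentially_definable m S \<longrightarrow> ez_set m S) \<and>
    (\<forall>S :: 'k set. existentially_definable 1 (singletons S) \<longrightarrow>
      (\<exists>U F. S = U \<union> F \<and> definable 1 (singletons U) \<and> etale_open_line U \<and> finite F))"
proof (intro conjI allI impI)
  fix m and S :: "'k list set"
  assume "existentially_definable m S"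
  then show "ez_set m S" by (rule existentially_definable_ez[OF assms(2)])
next
  fix S :: "'k set"
  assume "existentially_definable 1 (singletons S)"
  then show "\<exists>U F. S = U \<union> F \<and> definable 1 (singletons U) \<and> etale_open_line U \<and> finite F"
    by (intro ez_line existentially_definable_ez[OF assms(2)])
qed

end
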